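(* Let $(X,\mathsf d)$ be a complete separable metric space and let $\mathfrak m$ be a nonnegative Borel measure on $X$, finite on bounded sets, with $\operatorname{supp}\mathfrak m=X$. Assume that $\rho=g\mathfrak m\in\mathscr P_2(X)$ with $g\in L^\infty(X,\mathfrak m)$ and $|D\sqrt g|_w\in L^2(X,\mathfrak m)$ (that is, $\sqrt g\in\mathcal S^2$). Then: (a) $f\in\mathcal S^2$ and $|Df|_w\in L^2(X,\rho)$ imply $f\in\mathcal S^2_\rho$ and $|Df|_{w,\rho}=|Df|_w$ $\rho$-a.e. in $X$; (b) $\log g\in\mathcal S^2_\rho$ and $|D\log g|_{w,\rho}=|Dg|_w/g$ $\rho$-a.e. in $X$.
   Context: $\mathscr P_2(X)$ is the space of Borel probability measures with finite second moment. Let $\mathfrak n$ be a nonnegative Borel measure on $X$, finite on bounded sets. A 2-test plan relative to $\mathfrak n$ is a Borel probability measure $\pi$ on $C([0,1];X)$ concentrated on $AC^2([0,1];X)$ (absolutely continuous curves whose metric derivative $|\dot\gamma_t|$ is in $L^2(0,1)$), with $\int\int_0^1|\dot\gamma_t|^2dt\,d\pi(\gamma)<\infty$, and such that for some $C\ge0$, $(e_t)_\sharp\pi\le C\mathfrak n$ for all $t\in[0,1]$, where $e_t(\gamma)=\gamma_t$. A Borel $G:X\to[0,\infty]$ is a 2-weak upper gradient relative to $\mathfrak n$ of a Borel $f:X\to\mathbb R$ if for all 2-test plans $\pi$ relative to $\mathfrak n$ one has $|f(\gamma_1)-f(\gamma_0)|\le\int_0^1G(\gamma_s)|\dot\gamma_s|ds<\infty$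 for $\pi$-a.e. $\gamma$. One writes $f\in\mathcal S^2_{\mathfrak n}$ if $f$ has a 2-weak upper gradient relative to $\mathfrak n$ in $L^2(X,\mathfrak n)$; the one with minimal $L^2(X,\mathfrak n)$ norm is denoted $|Df|_{w,\mathfrak n}$. These notions are invariant under modification of $f$ on $\mathfrak n$-negligible sets, so they make sense for functions defined $\mathfrak n$-a.e. (such as $\log g$, finite $\rho$-a.e.). Conventions: $\mathcal S^2:=\mathcal S^2_{\mathfrak m}$, $|Df|_w:=|Df|_{w,\mathfrak m}$. *)

theory Defs
  imports "HOL-Analysis.Analysis" "HOL-Probability.Probability"
begin

definition boundedly_finite_borel_measure :: "'a::metric_space measure \<Rightarrow> bool" where
  "boundedly_finite_borel_measure n \<longleftrightarrow>
     sets n = sets borel \<and> (\<forall>A\<in>sets borel. bounded A \<longrightarrow> emeasure n A < \<infinity>)"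

definition measure_support :: "'a::topological_space measure \<Rightarrow> 'a set" where
  "measure_support n = {x. \<forall>U. open U \<longrightarrow> x \<in> U \<longrightarrow> 0 < emeasure n U}"

definition P2 :: "'a::metric_space measure set" where
  "P2 = {\<mu>. prob_space \<mu> \<and> sets \<mu> = sets borel \<and>
             (\<exists>x0. (\<integral>\<^sup>+x. ennreal ((dist x x0)\<^sup>2) \<partial>\<mu>) < \<infinity>)}"

text \<open>
  The space of continuous curves on the unit interval with the uniform distance. Its points are
  functions on the reals that take the value \<^const>\<open>undefined\<close> outside the unit interval; the
  boundedness built into \<^const>\<open>cfunspace\<close> is automatic, the interval being compact.
\<close>
definition curve_metric :: "(real \<Rightarrow> 'a::metric_space) metric" where
  "curve_metric = cfunspace (top_of_set {0..1}) euclidean_metric"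

definition curve_borel :: "(real \<Rightarrow> 'a::metric_space) measure" where
  "curve_borel = sigma (mspace curve_metric) {U. openin (mtopology_of curve_metric) U}"

definition AC :: "(real \<Rightarrow> 'a::metric_space) set" where
  "AC = {\<gamma>. \<exists>h::real \<Rightarrow> real. set_integrable lborel {0..1} h \<and>
            (\<forall>s t. 0 \<le> s \<longrightarrow> s \<le> t \<longrightarrow> t \<le> 1 \<longrightarrow> dist (\<gamma> s) (\<gamma> t) \<le> (LBINT r:{s..t}. h r))}"

text \<open>
  The limit of difference quotients, set to 0 where the limit does not exist. For absolutely
  continuous curves it exists almost everywhere, so that this convention has no influence on the
  integrals below.
\<close>
definition metric_derivative :: "(real \<Rightarrow> 'a::metric_space) \<Rightarrow> real \<Rightarrow> real" where
  "metric_derivative \<gamma> t =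
     (if \<exists>l. ((\<lambda>s. dist (\<gamma> s) (\<gamma> t) / \<bar>s - t\<bar>) \<longlongrightarrow> l) (at t within {0..1})
      then Lim (at t within {0..1}) (\<lambda>s. dist (\<gamma> s) (\<gamma> t) / \<bar>s - t\<bar>)
      else 0)"

definition AC2 :: "(real \<Rightarrow> 'a::metric_space) set" where
  "AC2 = {\<gamma> \<in> AC. (\<integral>\<^sup>+t\<in>{0..1}. ennreal ((metric_derivative \<gamma> t)\<^sup>2) \<partial>lborel) < \<infinity>}"

definition test_plan2 :: "'a::metric_space measure \<Rightarrow> (real \<Rightarrow> 'a) measure \<Rightarrow> bool" where
  "test_plan2 n \<pi> \<longleftrightarrow>
     prob_space \<pi> \<and> space \<pi> = space curve_borel \<and> sets \<pi> = sets curve_borel \<and>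
     (AE \<gamma> in \<pi>. \<gamma> \<in> AC2) \<and>
     (\<integral>\<^sup>+\<gamma>. (\<integral>\<^sup>+t\<in>{0..1}. ennreal ((metric_derivative \<gamma> t)\<^sup>2) \<partial>lborel) \<partial>\<pi>) < \<infinity> \<and>
     (\<exists>C\<ge>0. \<forall>t\<in>{0..1}. \<forall>A\<in>sets borel.
        emeasure (distr \<pi> borel (\<lambda>\<gamma>. \<gamma> t)) A \<le> ennreal C * emeasure n A)"

definition weak_upper_gradient2 ::
  "'a::metric_space measure \<Rightarrow> ('a \<Rightarrow> real) \<Rightarrow> ('a \<Rightarrow> ennreal) \<Rightarrow> bool" where
  "weak_upper_gradient2 n f G \<longleftrightarrow>
     f \<in> borel_measurable borel \<and> G \<in> borel_measurable borel \<and>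
     (\<forall>\<pi>. test_plan2 n \<pi> \<longrightarrow>
        (AE \<gamma> in \<pi>.
           ennreal \<bar>f (\<gamma> 1) - f (\<gamma> 0)\<bar>
             \<le> (\<integral>\<^sup>+s\<in>{0..1}. G (\<gamma> s) * ennreal (metric_derivative \<gamma> s) \<partial>lborel) \<and>
           (\<integral>\<^sup>+s\<in>{0..1}. G (\<gamma> s) * ennreal (metric_derivative \<gamma> s) \<partial>lborel) < \<infinity>))"

definition S2 :: "'a::metric_space measure \<Rightarrow> ('a \<Rightarrow> real) set" where
  "S2 n = {f. \<exists>G. weak_upper_gradient2 n f G \<and> (\<integral>\<^sup>+x. (G x)\<^sup>2 \<partial>n) < \<infinity>}"

definition minimal_weak_upper_gradient ::
  "'a::metric_space measure \<Rightarrow> ('a \<Rightarrow> real) \<Rightarrow> ('a \<Rightarrow> ennreal) \<Rightarrow> bool" where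
  "minimal_weak_upper_gradient n f G \<longleftrightarrow>
     weak_upper_gradient2 n f G \<and> (\<integral>\<^sup>+x. (G x)\<^sup>2 \<partial>n) < \<infinity> \<and>
     (\<forall>H. weak_upper_gradient2 n f H \<longrightarrow> (\<integral>\<^sup>+x. (G x)\<^sup>2 \<partial>n) \<le> (\<integral>\<^sup>+x. (H x)\<^sup>2 \<partial>n))"

text \<open>
  Minimal weak upper gradients are determined only up to equality \<open>n\<close>-almost everywhere; this is
  an arbitrary Borel representative. It is meaningful for \<open>f \<in> S2 n\<close> only.
\<close>
definition weak_gradient :: "'a::metric_space measure \<Rightarrow> ('a \<Rightarrow> real) \<Rightarrow> 'a \<Rightarrow> ennreal" where
  "weak_gradient n f = (SOME G. minimal_weak_upper_gradient n f G)"

end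

theory Submission
  imports Defs
begin

text \<open>
  Test plans relative to \<open>\<rho>\<close> are test plans relative to \<open>m\<close>, so the \<open>\<rho>\<close>-gradient of \<open>f\<close> is at most
  its \<open>m\<close>-gradient. For the converse, \<open>g\<close> is the square of \<open>sqrt g\<close> and therefore has a weak upper
  gradient relative to \<open>m\<close>; hence \<open>g\<close> agrees at almost every time of almost every curve with a
  continuous function, and the times where it is positive are exhausted by dyadic intervals on which
  it is bounded below. The curves that satisfy such a bound on a given dyadic interval form, after
  restriction to this interval, a test plan relative to \<open>\<rho>\<close>, so that the \<open>\<rho>\<close>-gradient controls the
  increments of \<open>f\<close> there. Consequently the \<open>m\<close>-gradient may be replaced by the \<open>\<rho>\<close>-gradient on
  \<open>{g > 0}\<close>, and minimality gives equality. The statement about \<open>ln g\<close> follows by applying the same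
  argument to \<open>g\<close> itself, with the chain rule for \<open>ln\<close> in one direction and for \<open>exp\<close> in the other.
\<close>

subsection \<open>The space of curves\<close>

text \<open>A weak upper gradient compares a curve only at times 0 and 1, and its exceptional set of
  curves depends on the plan. Increments on subintervals must therefore be extracted by restricting
  whole plans, one interval at a time, and only countably many intervals can be treated
  simultaneously. This is why dyadic intervals and rational times carry the argument, and why
  \<open>f\<close>, merely Borel, is never assumed continuous along curves. General times are
  reached through Fubini's theorem, which asks for joint measurability, in curve and time, of
  evaluation and metric derivative. The two measures are comparable asymmetrically: boundedness of
  \<open>g\<close> gives \<rho> \<le> c m globally, whereas m is dominated by \<rho> / \<kappa> only
  on \<open>{g \<ge> \<kappa>}\<close>. Since the constant of a test plan may be any real number,
  each dyadic piece can use its own \<kappa>. For the logarithm, integrability is a Fisher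
  information bound: if K is a gradient of sqrt g, then |Dg| \<le> 2 sqrt g K, hence g (|Dg| / g)^2
  \<le> 4 K^2, and the hypothesis on sqrt g puts |Dg| / g in L^2(\<rho>).\<close>

lemma mspace_curve_metric:
  "\<gamma> \<in> mspace curve_metric \<longleftrightarrow> continuous_on {0..1} \<gamma> \<and> \<gamma> \<in> extensional {0..1}"
proof -
  have "Metric_space.mbounded UNIV dist (\<gamma> ` {0..1})" if "continuous_on {0..1} \<gamma>"
    using compact_imp_bounded[OF compact_continuous_image[OF that compact_Icc]]
    by (simp add: Met_TC.mbounded_def bounded_def Met_TC.mcball_def subset_iff)
  then show ?thesis
    unfolding curve_metric_def by auto
qed

lemma space_curve_borel: "space curve_borel = mspace curve_metric"
  unfolding curve_borel_def by (simp add: space_measure_of_conv)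

lemma openin_imp_sets_curve_borel:
  fixes U :: "(real \<Rightarrow> 'a::metric_space) set"
  assumes "openin (mtopology_of curve_metric) U"
  shows "U \<in> sets curve_borel"
proof -
  have "Collect (openin (mtopology_of curve_metric)) \<subseteq> Pow (mspace (curve_metric :: (real \<Rightarrow> 'a) metric))"
    by (metis PowI mem_Collect_eq openin_subset subsetI topspace_mtopology_of)
  then show ?thesis
    unfolding curve_borel_def using assms by (intro in_measure_of) auto
qed

lemma mdist_curve_metric_le:
  assumes "\<gamma> \<in> mspace curve_metric" "\<eta> \<in> mspace curve_metric"
  shows "mdist curve_metric \<gamma> \<eta> \<le> a \<longleftrightarrow> (\<forall>t\<in>{0..1}. dist (\<gamma> t) (\<eta> t) \<le> a)"
  using cfunspace_mdist_le[of \<gamma> "top_of_set {0..1}" euclidean_metric \<eta> a] assms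
  unfolding curve_metric_def by simp

lemma openin_curve_metric:
  "openin (mtopology_of curve_metric) U \<longleftrightarrow> U \<subseteq> mspace curve_metric \<and>
     (\<forall>\<gamma>\<in>U. \<exists>r>0. \<forall>\<eta>\<in>mspace curve_metric. mdist curve_metric \<gamma> \<eta> < r \<longrightarrow> \<eta> \<in> U)"
  unfolding mtopology_of_def
  unfolding Metric_space.openin_mtopology[OF Metric_space_mspace_mdist]
  by (simp add: Metric_space.in_mball[OF Metric_space_mspace_mdist] subset_iff) blast

text \<open>Such an \<open>R\<close> is 1-Lipschitz for the uniform distance, hence continuous, and
  open sets generate \<open>curve_borel\<close>. The intended \<open>R\<close> is the restriction of
  curves to a subinterval.\<close>

lemma measurable_nonexpansive:
  assumes R: "\<And>\<gamma>. \<gamma> \<in> mspace curve_metric \<Longrightarrow> R \<gamma> \<in> mspace curve_metric"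
    and le: "\<And>\<gamma> \<eta> t. \<gamma> \<in> mspace curve_metric \<Longrightarrow> \<eta> \<in> mspace curve_metric \<Longrightarrow> t \<in> {0..1} \<Longrightarrow>
      dist (R \<gamma> t) (R \<eta> t) \<le> mdist curve_metric \<gamma> \<eta>"
  shows "R \<in> curve_borel \<rightarrow>\<^sub>M curve_borel"
proof -
  have "R -` U \<inter> mspace curve_metric \<in> sets curve_borel"
    if U: "openin (mtopology_of curve_metric) U" for U
  proof (rule openin_imp_sets_curve_borel, unfold openin_curve_metric, intro conjI ballI)
    fix \<gamma> assume g: "\<gamma> \<in> R -` U \<inter> mspace curve_metric"
    then obtain r where "r > 0"
      and r: "\<And>\<eta>. \<eta> \<in> mspace curve_metric \<Longrightarrow> mdist curve_metric (R \<gamma>) \<eta> < r \<Longrightarrow> \<eta> \<in> U"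
      using U unfolding openin_curve_metric by blast
    have "mdist curve_metric (R \<gamma>) (R \<eta>) \<le> mdist curve_metric \<gamma> \<eta>" if "\<eta> \<in> mspace curve_metric" for \<eta>
      using g that R le by (subst mdist_curve_metric_le) auto
    then show "\<exists>r>0. \<forall>\<eta>\<in>mspace curve_metric. mdist curve_metric \<gamma> \<eta> < r \<longrightarrow> \<eta> \<in> R -` U \<inter> mspace curve_metric"
      using \<open>r > 0\<close> r R g by (intro exI[of _ r]) (meson IntD2 IntI le_less_trans vimageI2)
  qed simp
  then show ?thesis
    by (subst (2) curve_borel_def, intro measurable_measure_of)
      (use R in \<open>auto simp: space_curve_borel openin_curve_metric\<close>)
qed

lemma measurable_evaluation:
  fixes t :: real
  assumes "t \<in> {0..1}"
  shows "(\<lambda>\<gamma>. \<gamma> t :: 'a::metric_space) \<in> curve_borel \<rightarrow>\<^sub>M borel"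
proof (rule borel_measurableI)
  fix S :: "'a set" assume "open S"
  have "openin (mtopology_of curve_metric) ((\<lambda>\<gamma>. \<gamma> t) -` S \<inter> mspace curve_metric)"
    unfolding openin_curve_metric
  proof (intro conjI ballI)
    fix \<gamma> assume g: "\<gamma> \<in> (\<lambda>\<gamma>. \<gamma> t) -` S \<inter> mspace curve_metric"
    then obtain e where "e > 0" and e: "\<And>y. dist y (\<gamma> t) < e \<Longrightarrow> y \<in> S"
      using \<open>open S\<close> unfolding open_dist by auto
    have "dist (\<gamma> t) (\<eta> t) \<le> mdist curve_metric \<gamma> \<eta>" if "\<eta> \<in> mspace curve_metric" for \<eta>
      using mdist_curve_metric_le[of \<gamma> \<eta> "mdist curve_metric \<gamma> \<eta>"] g that assms by auto
    then show "\<exists>r>0. \<forall>\<eta>\<in>mspace curve_metric. mdist curve_metric \<gamma> \<eta> < r \<longrightarrow>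
        \<eta> \<in> (\<lambda>\<gamma>. \<gamma> t) -` S \<inter> mspace curve_metric"
      using \<open>e > 0\<close> e by (intro exI[of _ e]) (metis IntI dist_commute le_less_trans vimageI2)
  qed simp
  then show "(\<lambda>\<gamma>. \<gamma> t) -` S \<inter> space curve_borel \<in> sets curve_borel"
    by (simp add: space_curve_borel openin_imp_sets_curve_borel)
qed

lemma continuous_on_curve: "\<gamma> \<in> space curve_borel \<Longrightarrow> continuous_on {0..1} \<gamma>"
  by (simp add: space_curve_borel mspace_curve_metric)

text \<open>Times are rounded down to the dyadic grid: the rounded time takes countably many values,
  so only evaluations at fixed times occur, and continuity of the curves gives the limit.\<close>

lemma measurable_evaluation_pair:
  fixes f :: "'b \<Rightarrow> real \<Rightarrow> 'a::metric_space"
  assumes f [measurable]: "f \<in> M \<rightarrow>\<^sub>M curve_borel" and T [measurable]: "T \<in> borel_measurable M"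
    and T01: "\<And>x. x \<in> space M \<Longrightarrow> T x \<in> {0..1}"
  shows "(\<lambda>x. f x (T x)) \<in> borel_measurable M"
proof (rule borel_measurable_LIMSEQ_metric)
  \<comment> \<open>Clamping keeps \<open>a n i\<close> in the unit interval for every integer
    \<open>i\<close>, which is where \<open>measurable_evaluation\<close> applies.\<close>
  define a where "a n i = max 0 (min 1 (real_of_int i / 2 ^ n))" for n i
  have [measurable]: "(\<lambda>x. f x (a n i)) \<in> borel_measurable M" for n i
    by (rule measurable_compose[OF f measurable_evaluation]) (simp add: a_def)
  show "(\<lambda>x. f x (a n \<lfloor>T x * 2 ^ n\<rfloor>)) \<in> borel_measurable M" for n
    by (rule measurable_compose_countable) measurable
  fix x assume x: "x \<in> space M"
  have "(\<lambda>n. a n \<lfloor>T x * 2 ^ n\<rfloor>) \<longlonglongrightarrow> T x"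
  proof (rule tendsto_sandwich[of "\<lambda>n. T x - (1/2) ^ n" _ _ "\<lambda>n. T x"])
    have "T x - (1 / 2) ^ n \<le> \<lfloor>T x * 2 ^ n\<rfloor> / 2 ^ n" for n
    proof -
      have "T x * 2 ^ n - 1 \<le> \<lfloor>T x * 2 ^ n\<rfloor>" by linarith
      then have "(T x * 2 ^ n - 1) / 2 ^ n \<le> \<lfloor>T x * 2 ^ n\<rfloor> / 2 ^ n"
        by (rule divide_right_mono) simp
      then show ?thesis by (simp add: diff_divide_distrib power_divide)
    qed
    moreover have "T x - (1 / 2) ^ n \<le> 1" for n
    proof -
      have "0 \<le> (1 / 2 :: real) ^ n" by simp
      moreover have "T x \<le> 1" using T01[OF x] by simp
      ultimately show ?thesis by linarith
    qed
    ultimately show "\<forall>\<^sub>F n in sequentially. T x - (1 / 2) ^ n \<le> a n \<lfloor>T x * 2 ^ n\<rfloor>"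
      unfolding a_def by (intro always_eventually allI) (simp add: le_max_iff_disj)
    have "\<lfloor>T x * 2 ^ n\<rfloor> / 2 ^ n \<le> T x" for n
      by (simp add: pos_divide_le_eq)
    then show "\<forall>\<^sub>F n in sequentially. a n \<lfloor>T x * 2 ^ n\<rfloor> \<le> T x"
      using T01[OF x] unfolding a_def
      by (intro always_eventually allI) (auto simp: min_le_iff_disj)
    have "(\<lambda>n. T x - (1 / 2) ^ n) \<longlonglongrightarrow> T x - 0"
      by (intro tendsto_intros LIMSEQ_power_zero) auto
    then show "(\<lambda>n. T x - (1 / 2) ^ n) \<longlonglongrightarrow> T x" by simp
  qed simp
  then show "(\<lambda>n. f x (a n \<lfloor>T x * 2 ^ n\<rfloor>)) \<longlonglongrightarrow> f x (T x)"
  proof (rule continuous_on_tendsto_compose[OF continuous_on_curve[OF measurable_space[OF f x]]])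
    show "\<forall>\<^sub>F n in sequentially. a n \<lfloor>T x * 2 ^ n\<rfloor> \<in> {0..1}"
      unfolding a_def by simp
  qed (rule T01[OF x])
qed

section \<open>Measurability of the metric derivative in curve and time\<close>

definition approach :: "real \<Rightarrow> nat \<Rightarrow> real" where
  "approach t n = (if t \<le> 1/2 then t + inverse (2 * real (Suc n)) else t - inverse (2 * real (Suc n)))"

text \<open>The sequence moves right from the left half of the interval and left from the right
  half. Its steps are at most 1/2, so it stays inside, and nonzero, so it avoids \<open>t\<close>
  itself.\<close>

lemma approach_in: 
  assumes "t \<in> {0..1}"
  shows "approach t n \<in> {0..1} - {t}"
proof -
  define e where "e = inverse (2 * real (Suc n))"
  have "0 < e" unfolding e_def by simp
  moreover have "e \<le> inverse 2"
    unfolding e_def by (rule le_imp_inverse_le) auto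
  ultimately show ?thesis
    using assms unfolding approach_def e_def[symmetric] by auto
qed

lemma approach_filterlim:
  assumes "t \<in> {0..1}"
  shows "filterlim (approach t) (at t within {0..1}) sequentially"
proof -
  have "(\<lambda>n. inverse 2 * inverse (real (Suc n))) \<longlonglongrightarrow> inverse 2 * 0"
    by (intro tendsto_intros LIMSEQ_inverse_real_of_nat)
  then have lim: "(\<lambda>n. inverse (2 * real (Suc n))) \<longlonglongrightarrow> 0"
    by (simp only: inverse_mult_distrib mult_zero_right)
  have "approach t \<longlonglongrightarrow> t"
  proof (cases "t \<le> 1/2")
    case True
    then show ?thesis
      using tendsto_add[OF tendsto_const lim, of t] unfolding approach_def[abs_def] by (simp only: if_True add_0_right)
  next
    case False
    then show ?thesis
      using tendsto_diff[OF tendsto_const lim, of t] unfolding approach_def[abs_def] by (simp only: if_False diff_zero)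
  qed
  then show ?thesis
    unfolding filterlim_at using approach_in[OF assms] by (intro conjI always_eventually) auto
qed

lemma at_within_Icc_neq_bot: "t \<in> {0..1} \<Longrightarrow> at t within {0..1::real} \<noteq> bot"
  by (simp add: trivial_limit_within islimpt_Icc)

lemma Rats_Int_Icc_dense:
  fixes s :: real
  assumes "s \<in> {0..1}"
  shows "s \<in> closure (\<rat> \<inter> {0..1})"
  unfolding closure_approachable
proof (intro allI impI)
  fix e :: real assume "e > 0"
  show "\<exists>q\<in>\<rat> \<inter> {0..1}. dist q s < e"
  proof (cases "s < 1")
    case True
    obtain q where "q \<in> \<rat>" "s < q" "q < min 1 (s + e)"
      using Rats_dense_in_real[of s "min 1 (s + e)"] True \<open>e > 0\<close> by auto
    then show ?thesis using assms by (intro bexI[of _ q]) (auto simp: dist_real_def)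
  next
    case False
    then show ?thesis using assms \<open>e > 0\<close> by (intro bexI[of _ 1]) auto
  qed
qed

text \<open>The limit over a continuum of times is replaced by countable operations. The candidate
  \<open>L\<close> is read off along one fixed sequence, and convergence to \<open>L\<close> is
  tested at rational times only, which suffices because the quotient is continuous away from
  \<open>t\<close>. If that sequence diverges, \<open>L\<close> is an arbitrary value and the test
  fails, in accordance with the default value 0.\<close>

lemma metric_derivative_eq_lim_approach:
  fixes \<gamma> :: "real \<Rightarrow> 'a::metric_space"
  assumes cont: "continuous_on {0..1} \<gamma>" and t: "t \<in> {0..1}"
  defines "L \<equiv> lim (\<lambda>n. dist (\<gamma> (approach t n)) (\<gamma> t) / \<bar>approach t n - t\<bar>)"
  shows "metric_derivative \<gamma> t =
    (if \<forall>k::nat. \<exists>j::nat. \<forall>s\<in>\<rat> \<inter> {0..1}. s \<noteq> t \<and> \<bar>s - t\<bar> < inverse (Suc j) \<longrightarrow>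
           \<bar>dist (\<gamma> s) (\<gamma> t) / \<bar>s - t\<bar> - L\<bar> \<le> inverse (Suc k) then L else 0)"
proof -
  let ?Q = "\<lambda>s. dist (\<gamma> s) (\<gamma> t) / \<bar>s - t\<bar>"
  let ?C = "\<forall>k::nat. \<exists>j::nat. \<forall>s\<in>\<rat> \<inter> {0..1}. s \<noteq> t \<and> \<bar>s - t\<bar> < inverse (Suc j) \<longrightarrow>
           \<bar>?Q s - L\<bar> \<le> inverse (Suc k)"
  have nt: "at t within {0..1} \<noteq> bot" using t by (rule at_within_Icc_neq_bot)
  have L: "l = L" if "(?Q \<longlongrightarrow> l) (at t within {0..1})" for l
    using limI[OF filterlim_compose[OF that approach_filterlim[OF t]]] unfolding L_def by simp
  have 1: "(?Q \<longlongrightarrow> L) (at t within {0..1})" if C: ?C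
  proof (rule tendstoI)
    fix e :: real assume "e > 0"
    then obtain k where k: "inverse (Suc k) < e" using reals_Archimedean by blast
    obtain j where j: "\<And>s. s \<in> \<rat> \<inter> {0..1} \<Longrightarrow> s \<noteq> t \<Longrightarrow> \<bar>s - t\<bar> < inverse (Suc j) \<Longrightarrow>
           \<bar>?Q s - L\<bar> \<le> inverse (Suc k)" using C by blast
    \<comment> \<open>Approximation of \<open>s\<close> by rationals preserves the nonstrict bound
      only; strictness is recovered from \<open>inverse (Suc k) < e\<close>.\<close>
    have "\<bar>?Q s - L\<bar> < e" if s: "s \<in> {0..1}" "s \<noteq> t" "\<bar>s - t\<bar> < inverse (Suc j)" for s
    proof -
      obtain q where q: "\<And>n. q n \<in> \<rat> \<inter> {0..1}" "q \<longlonglongrightarrow> s"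
      proof -
        have "s \<in> closure (\<rat> \<inter> {0..1})" using s(1) by (rule Rats_Int_Icc_dense)
        then show ?thesis using that unfolding closure_sequential by blast
      qed
      have "(\<lambda>n. \<bar>?Q (q n) - L\<bar>) \<longlonglongrightarrow> \<bar>?Q s - L\<bar>"
        by (intro tendsto_intros q continuous_on_tendsto_compose[OF cont])
          (use s q in auto)
      moreover have "\<forall>\<^sub>F n in sequentially. \<bar>?Q (q n) - L\<bar> \<le> inverse (Suc k)"
      proof -
        have "\<forall>\<^sub>F n in sequentially. q n \<noteq> t"
          using q(2) s(2) by (rule tendsto_imp_eventually_ne)
        moreover have "(\<lambda>n. \<bar>q n - t\<bar>) \<longlonglongrightarrow> \<bar>s - t\<bar>" by (intro tendsto_intros q)
        then have "\<forall>\<^sub>F n in sequentially. \<bar>q n - t\<bar> < inverse (Suc j)"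
          using s(3) by (rule order_tendstoD)
        ultimately show ?thesis by eventually_elim (rule j[OF q(1)])
      qed
      ultimately have "\<bar>?Q s - L\<bar> \<le> inverse (Suc k)" by (rule tendsto_upperbound) simp
      with k show ?thesis by simp
    qed
    then show "\<forall>\<^sub>F s in at t within {0..1}. dist (?Q s) L < e"
      unfolding eventually_at by (intro exI[of _ "inverse (Suc j)"]) (auto simp: dist_real_def)
  qed
  have 2: ?C if "(?Q \<longlongrightarrow> L) (at t within {0..1})"
  proof
    fix k :: nat
    have "\<forall>\<^sub>F s in at t within {0..1}. dist (?Q s) L < inverse (Suc k)"
      using that by (rule tendstoD) simp
    then obtain d where "d > 0" and d: "\<And>s. s \<in> {0..1} \<Longrightarrow> s \<noteq> t \<Longrightarrow> dist s t < d \<Longrightarrow> dist (?Q s) L < inverse (Suc k)"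
      unfolding eventually_at by blast
    obtain j where "inverse (Suc j) < d" using \<open>d > 0\<close> reals_Archimedean by blast
    then show "\<exists>j::nat. \<forall>s\<in>\<rat> \<inter> {0..1}. s \<noteq> t \<and> \<bar>s - t\<bar> < inverse (Suc j) \<longrightarrow>
           \<bar>?Q s - L\<bar> \<le> inverse (Suc k)"
      using d by (intro exI[of _ j]) (force simp: dist_real_def)
  qed
  show ?thesis
  proof (cases ?C)
    case True
    have ex: "\<exists>l. (?Q \<longlongrightarrow> l) (at t within {0..1})" using 1[OF True] by blast
    then show ?thesis
      unfolding metric_derivative_def if_P[OF True] if_P[OF ex] by (intro tendsto_Lim[OF nt 1[OF True]])
  next
    case False
    have nex: "\<not> (\<exists>l. (?Q \<longlongrightarrow> l) (at t within {0..1}))"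
    proof
      assume "\<exists>l. (?Q \<longlongrightarrow> l) (at t within {0..1})"
      then obtain l where l: "(?Q \<longlongrightarrow> l) (at t within {0..1})" by (rule exE)
      then have "(?Q \<longlongrightarrow> L) (at t within {0..1})" by (subst (asm) L[OF l])
      then show False by (rule 2[THEN notE[OF False]])
    qed
    show ?thesis unfolding metric_derivative_def if_not_P[OF False] if_not_P[OF nex] ..
  qed
qed

lemma measurable_metric_derivative_pair:
  fixes f :: "'b \<Rightarrow> real \<Rightarrow> 'a::polish_space"
  assumes f [measurable]: "f \<in> M \<rightarrow>\<^sub>M curve_borel" and T [measurable]: "T \<in> borel_measurable M"
    and T01: "\<And>x. x \<in> space M \<Longrightarrow> T x \<in> {0..1}"
  shows "(\<lambda>x. metric_derivative (f x) (T x)) \<in> borel_measurable M"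
proof -
  have [measurable]: "(\<lambda>x. f x (T x)) \<in> borel_measurable M"
    by (rule measurable_evaluation_pair[OF f T T01])
  have a1 [measurable]: "(\<lambda>x. approach (T x) n) \<in> borel_measurable M" for n
    unfolding approach_def by measurable
  have [measurable]: "(\<lambda>x. f x (approach (T x) n)) \<in> borel_measurable M" for n
    by (rule measurable_evaluation_pair[OF f a1]) (use T01 approach_in in blast)
  have [measurable]: "(\<lambda>x. f x s) \<in> borel_measurable M" if "s \<in> \<rat> \<inter> {0..1}" for s
    using that by (intro measurable_compose[OF f measurable_evaluation]) auto
  define L where "L x = lim (\<lambda>n. dist (f x (approach (T x) n)) (f x (T x)) / \<bar>approach (T x) n - T x\<bar>)" for x
  have [measurable]: "L \<in> borel_measurable M" unfolding L_def[abs_def] by measurable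
  have "countable (\<rat> \<inter> {0..1::real})" using countable_rat by blast
  then have "Measurable.pred M (\<lambda>x. \<forall>k::nat. \<exists>j::nat. \<forall>s\<in>\<rat> \<inter> {0..1}. s \<noteq> T x \<and> \<bar>s - T x\<bar> < inverse (Suc j) \<longrightarrow>
           \<bar>dist (f x s) (f x (T x)) / \<bar>s - T x\<bar> - L x\<bar> \<le> inverse (Suc k))"
    by (intro pred_intros_countable pred_intros_countable_bounded) measurable
  then have "(\<lambda>x. if \<forall>k::nat. \<exists>j::nat. \<forall>s\<in>\<rat> \<inter> {0..1}. s \<noteq> T x \<and> \<bar>s - T x\<bar> < inverse (Suc j) \<longrightarrow>
           \<bar>dist (f x s) (f x (T x)) / \<bar>s - T x\<bar> - L x\<bar> \<le> inverse (Suc k) then L x else 0) \<in> borel_measurable M"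
    by measurable
  then show ?thesis
    by (subst measurable_cong, subst metric_derivative_eq_lim_approach)
      (use T01 measurable_space[OF f] continuous_on_curve in \<open>auto simp: L_def cong: if_cong\<close>)
qed

subsection \<open>Dyadic intervals\<close>

text \<open>Open on the left, so that the intervals of one level partition \<open>{0<..1}\<close>;
  the missing time 0 is Lebesgue-null. The same half-open shape fits distribution functions of
  measures.\<close>

definition dyadic :: "nat \<Rightarrow> nat \<Rightarrow> real set" where
  "dyadic n i = {real i / 2 ^ n <.. real (Suc i) / 2 ^ n}"

abbreviation dyadic_integral :: "(real \<Rightarrow> ennreal) \<Rightarrow> nat \<Rightarrow> nat \<Rightarrow> ennreal" where
  "dyadic_integral u n i \<equiv> (\<integral>\<^sup>+r\<in>dyadic n i. u r \<partial>lborel)"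

abbreviation jump :: "(real \<Rightarrow> real) \<Rightarrow> nat \<Rightarrow> nat \<Rightarrow> real" where
  "jump F n i \<equiv> \<bar>F (real (Suc i) / 2 ^ n) - F (real i / 2 ^ n)\<bar>"

lemma borel_dyadic [measurable]: "dyadic n i \<in> sets borel"
  unfolding dyadic_def by simp

lemma emeasure_dyadic: "emeasure lborel (dyadic n i) = ennreal (1 / 2 ^ n)"
proof -
  have "real (Suc i) / 2 ^ n - real i / 2 ^ n = 1 / 2 ^ n"
    by (simp add: diff_divide_distrib[symmetric])
  then show ?thesis unfolding dyadic_def by (subst emeasure_lborel_Ioc) (simp_all add: divide_right_mono)
qed

text \<open>The index is a ceiling, which turns disjointness and covering into integer
  arithmetic.\<close>

lemma dyadic_iff: "r \<in> dyadic n i \<longleftrightarrow> \<lceil>r * 2 ^ n\<rceil> = int i + 1"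
proof -
  have "r \<in> dyadic n i \<longleftrightarrow> real i < r * 2 ^ n \<and> r * 2 ^ n \<le> real i + 1"
    unfolding dyadic_def by (simp add: pos_divide_less_eq pos_le_divide_eq add.commute)
  also have "\<dots> \<longleftrightarrow> \<lceil>r * 2 ^ n\<rceil> = int i + 1"
    by (simp add: ceiling_eq_iff)
  finally show ?thesis .
qed

lemma dyadic_disjoint: "r \<in> dyadic n i \<Longrightarrow> r \<in> dyadic n j \<Longrightarrow> i = j"
  by (simp add: dyadic_iff)

lemma dyadic_index:
  assumes "r \<in> {0<..1}"
  shows "\<exists>i<2 ^ n. r \<in> dyadic n i"
proof -
  have "0 < r * 2 ^ n" using assms by simp
  moreover have "r * 2 ^ n \<le> 1 * 2 ^ n"
    by (rule mult_right_mono) (use assms in auto)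
  then have "\<lceil>r * 2 ^ n\<rceil> \<le> 2 ^ n" by (simp add: ceiling_le_iff)
  ultimately have "0 < \<lceil>r * 2 ^ n\<rceil>" "\<lceil>r * 2 ^ n\<rceil> \<le> 2 ^ n" by auto
  then have "r \<in> dyadic n (nat (\<lceil>r * 2 ^ n\<rceil> - 1))" "nat (\<lceil>r * 2 ^ n\<rceil> - 1) < 2 ^ n"
    by (auto simp: dyadic_iff nat_less_iff)
  then show ?thesis by blast
qed

lemma dyadic_subset:
  assumes "i < 2 ^ n"
  shows "{real i / 2 ^ n .. real (Suc i) / 2 ^ n} \<subseteq> {0..1}" and "dyadic n i \<subseteq> {0<..1}"
proof -
  have "real (Suc i) \<le> real (2 ^ n)" using assms by (intro of_nat_mono) simp
  then have 1: "real (Suc i) / 2 ^ n \<le> 1" by (simp add: pos_divide_le_eq)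
  have 0: "0 \<le> real i / 2 ^ n" by simp
  show "{real i / 2 ^ n .. real (Suc i) / 2 ^ n} \<subseteq> {0..1}" "dyadic n i \<subseteq> {0<..1}"
    unfolding dyadic_def using order_trans[OF 0] order_trans[OF _ 1] le_less_trans[OF 0]
    by (auto simp del: of_nat_Suc)
qed

lemma UN_dyadic: "(\<Union>i<2 ^ n. dyadic n i) = {0<..1}"
  using dyadic_index[of _ n] dyadic_subset(2)[of _ n] by blast

lemma dyadic_nested:
  assumes "r \<in> dyadic (Suc n) i" "r \<in> dyadic n i'"
  shows "i' = i div 2" and "dyadic (Suc n) i \<subseteq> dyadic n i'"
    and "{real i / 2 ^ Suc n .. real (Suc i) / 2 ^ Suc n} \<subseteq> {real i' / 2 ^ n .. real (Suc i') / 2 ^ n}"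
proof -
  have *: "real i / 2 ^ Suc n = (real i / 2) / 2 ^ n" "real (Suc i) / 2 ^ Suc n = (real (Suc i) / 2) / 2 ^ n"
    by simp_all
  have "real i' < r * 2 ^ n" "r * 2 ^ n \<le> real i' + 1" "real i < r * 2 ^ n * 2" "r * 2 ^ n * 2 \<le> real i + 1"
    using assms unfolding dyadic_def by (simp_all add: pos_divide_less_eq pos_le_divide_eq add.commute mult_ac)
  then have "2 * real i' < real i + 1" "real i < 2 * real i' + 2" by linarith+
  then have i: "2 * i' \<le> i" "i \<le> 2 * i' + 1" by linarith+
  then show "i' = i div 2" by presburger
  have "2 * real i' \<le> real i" "real i \<le> 2 * real i' + 1" using i by linarith+
  then have "real i' \<le> real i / 2" "real (Suc i) / 2 \<le> real (Suc i')" by auto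
  then have "real i' / 2 ^ n \<le> real i / 2 ^ Suc n" "real (Suc i) / 2 ^ Suc n \<le> real (Suc i') / 2 ^ n"
    unfolding * by (intro divide_right_mono; simp del: of_nat_Suc)+
  then show "dyadic (Suc n) i \<subseteq> dyadic n i'"
    "{real i / 2 ^ Suc n .. real (Suc i) / 2 ^ Suc n} \<subseteq> {real i' / 2 ^ n .. real (Suc i') / 2 ^ n}"
    unfolding dyadic_def by (intro subsetI; simp del: of_nat_Suc power_Suc; linarith)+
qed

lemma dyadic_index_mono:
  assumes "r \<in> dyadic n i" "i < 2 ^ n"
  shows "\<exists>i'<2 ^ Suc n. r \<in> dyadic (Suc n) i' \<and> dyadic (Suc n) i' \<subseteq> dyadic n i \<and>
    {real i' / 2 ^ Suc n .. real (Suc i') / 2 ^ Suc n} \<subseteq> {real i / 2 ^ n .. real (Suc i) / 2 ^ n}"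
proof -
  have "r \<in> {0<..1}" using dyadic_subset(2)[OF assms(2)] assms(1) by blast
  then obtain i' where "i' < 2 ^ Suc n" "r \<in> dyadic (Suc n) i'" using dyadic_index by blast
  then show ?thesis using dyadic_nested[OF _ assms(1)] by blast
qed

lemma sum_indicator_dyadic:
  "(\<Sum>i<2 ^ n. indicator (dyadic n i) r :: ennreal) = indicator {0<..1} r"
proof -
  have "disjoint_family_on (dyadic n) {..<2 ^ n}"
    unfolding disjoint_family_on_def using dyadic_disjoint by blast
  then show ?thesis unfolding UN_dyadic[of n, symmetric] by (subst indicator_UN_disjoint) auto
qed

lemma nn_integral_dyadic_sum:
  fixes w :: "real \<Rightarrow> ennreal"
  assumes [measurable]: "w \<in> borel_measurable borel"
  shows "(\<Sum>i<2 ^ n. dyadic_integral w n i) = (\<integral>\<^sup>+r\<in>{0<..1}. w r \<partial>lborel)"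
  by (simp add: nn_integral_sum[symmetric] sum_distrib_left[symmetric] sum_indicator_dyadic)

text \<open>Finite inner approximations of an open set. They serve twice: for estimating a measure
  on open sets, and for gluing two gradients along a curve.\<close>

definition dyadic_inner :: "real set \<Rightarrow> nat \<Rightarrow> nat set" where
  "dyadic_inner U n = {i. i < 2 ^ n \<and> dyadic n i \<subseteq> U}"

lemma dyadic_inner_mono:
  "(\<Union>i\<in>dyadic_inner U n. dyadic n i) \<subseteq> (\<Union>i\<in>dyadic_inner U (Suc n). dyadic (Suc n) i)"
proof
  fix r assume "r \<in> (\<Union>i\<in>dyadic_inner U n. dyadic n i)"
  then obtain i where "i < 2 ^ n" "dyadic n i \<subseteq> U" "r \<in> dyadic n i"
    unfolding dyadic_inner_def by blast
  then show "r \<in> (\<Union>i\<in>dyadic_inner U (Suc n). dyadic (Suc n) i)"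
    using dyadic_index_mono[of r n i] unfolding dyadic_inner_def by blast
qed

lemma UN_dyadic_inner:
  assumes "open U"
  shows "(\<Union>n. \<Union>i\<in>dyadic_inner U n. dyadic n i) = U \<inter> {0<..1}"
proof (intro equalityI subsetI)
  fix r assume r: "r \<in> U \<inter> {0<..1}"
  then obtain e where "e > 0" and e: "\<And>y. \<bar>y - r\<bar> < e \<Longrightarrow> y \<in> U"
    using assms unfolding open_dist dist_real_def by blast
  obtain n where n: "(1/2) ^ n < e" using real_arch_pow_inv[OF \<open>e > 0\<close>, of "1/2"] by auto
  obtain i where i: "i < 2 ^ n" "r \<in> dyadic n i" using dyadic_index r by blast
  have "real (Suc i) / 2 ^ n = real i / 2 ^ n + (1/2) ^ n"
    by (simp add: power_divide add_divide_distrib)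
  then have "\<bar>y - r\<bar> < e" if "y \<in> dyadic n i" for y
    using that i(2) n unfolding dyadic_def by (auto simp del: of_nat_Suc)
  then have "i \<in> dyadic_inner U n" unfolding dyadic_inner_def using i e by blast
  then show "r \<in> (\<Union>n. \<Union>i\<in>dyadic_inner U n. dyadic n i)" using i by blast
next
  fix r assume "r \<in> (\<Union>n. \<Union>i\<in>dyadic_inner U n. dyadic n i)"
  then obtain n i where "i < 2 ^ n" "dyadic n i \<subseteq> U" "r \<in> dyadic n i"
    unfolding dyadic_inner_def by blast
  then show "r \<in> U \<inter> {0<..1}" using dyadic_subset(2)[of i n] by blast
qed

lemma finite_dyadic_inner [simp]: "finite (dyadic_inner U n)"
  unfolding dyadic_inner_def by simp

subsection \<open>Absolutely continuous curves form a Borel set\<close>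

text \<open>
  The image of a test plan under restriction of curves, which is not injective, has to be
  concentrated on \<^const>\<open>AC2\<close> again; for this \<^const>\<open>AC\<close> must be measurable. Uniform
  integrability is phrased as domination by a small constant plus a multiple of the length, so that
  only countably many conditions occur.
\<close>

definition increment :: "(real \<Rightarrow> 'a::metric_space) \<Rightarrow> nat \<Rightarrow> nat \<Rightarrow> real" where
  "increment \<gamma> n i = dist (\<gamma> (real i / 2 ^ n)) (\<gamma> (real (Suc i) / 2 ^ n))"

definition dyadic_AC :: "(real \<Rightarrow> 'a::metric_space) \<Rightarrow> bool" where
  "dyadic_AC \<gamma> \<longleftrightarrow> (\<forall>k::nat. \<exists>j::nat. \<forall>n. \<forall>I\<in>Pow {..<2 ^ n}.
     (\<Sum>i\<in>I. increment \<gamma> n i) \<le> inverse (Suc k) + j * (card I / 2 ^ n))"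

text \<open>This is the uniform integrability of a single integrable density: truncated at height
  \<open>j\<close> it contributes at most \<open>j\<close> times the length, and the excess above
  \<open>j\<close> has integral tending to 0.\<close>

lemma AC_imp_dyadic_AC:
  assumes "\<gamma> \<in> AC"
  shows "dyadic_AC \<gamma>"
  unfolding dyadic_AC_def
proof
  fix k :: nat
  obtain h :: "real \<Rightarrow> real" where h: "set_integrable lborel {0..1} h"
    and le: "\<And>s t. 0 \<le> s \<Longrightarrow> s \<le> t \<Longrightarrow> t \<le> 1 \<Longrightarrow> dist (\<gamma> s) (\<gamma> t) \<le> (LBINT r:{s..t}. h r)"
    using assms unfolding AC_def by blast
  \<comment> \<open>The absolute value makes the majorant nonnegative, as \<open>h\<close> may
    change sign, and the indicator makes it integrable on the whole line.\<close>
  define a where "a r = \<bar>indicator {0..1} r * h r\<bar>" for r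
  have int_a: "integrable lborel a"
    using h unfolding a_def set_integrable_def by simp
  then have [measurable]: "a \<in> borel_measurable borel" by auto
  have a0: "0 \<le> a r" for r by (simp add: a_def)
  have le_a: "ennreal (dist (\<gamma> s) (\<gamma> t)) \<le> (\<integral>\<^sup>+r\<in>{s<..t}. ennreal (a r) \<partial>lborel)"
    if st: "0 \<le> s" "s \<le> t" "t \<le> 1" for s t
  proof -
    have "dist (\<gamma> s) (\<gamma> t) \<le> (LBINT r:{s..t}. h r)" by (rule le[OF st])
    also have "\<dots> \<le> (LINT r|lborel. indicator {s..t} r * a r)"
      unfolding set_lebesgue_integral_def
    proof (rule integral_mono)
      have "set_integrable lborel {s..t} h" by (rule set_integrable_subset[OF h]) (use st in auto)
      then show "integrable lborel (\<lambda>r. indicator {s..t} r *\<^sub>R h r)" unfolding set_integrable_def .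
      show "integrable lborel (\<lambda>r. indicator {s..t} r * a r)"
        using integrable_mult_indicator[OF _ int_a, of "{s..t}"] by simp
      show "indicator {s..t} r *\<^sub>R h r \<le> indicator {s..t} r * a r" for r
        using st by (auto simp: a_def indicator_def)
    qed
    finally have "ennreal (dist (\<gamma> s) (\<gamma> t)) \<le> ennreal (LINT r|lborel. indicator {s..t} r * a r)"
      by (rule ennreal_leI)
    also have "\<dots> = (\<integral>\<^sup>+r. ennreal (indicator {s..t} r * a r) \<partial>lborel)"
      using integrable_mult_indicator[OF _ int_a, of "{s..t}"]
      by (intro nn_integral_eq_integral[symmetric]) (auto simp: a0)
    also have "\<dots> = (\<integral>\<^sup>+r\<in>{s<..t}. ennreal (a r) \<partial>lborel)"
    proof (rule nn_integral_cong_AE)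
      have "AE r in lborel. r \<noteq> s" by (rule AE_lborel_singleton)
      then show "AE r in lborel. ennreal (indicator {s..t} r * a r) = ennreal (a r) * indicator {s<..t} r"
        by eventually_elim (auto simp: indicator_def)
    qed
    finally show ?thesis .
  qed
  define b where "b j r = ennreal (max 0 (a r - real j))" for j r
  have [measurable]: "b j \<in> borel_measurable borel" for j unfolding b_def by measurable
  have fin: "(\<integral>\<^sup>+r. ennreal (a r) \<partial>lborel) < \<infinity>"
    using int_a a0 unfolding integrable_iff_bounded by simp
  have "(INF j. b j r) = 0" for r
  proof -
    obtain j :: nat where "a r \<le> real j" using real_arch_simple by blast
    then have "b j r = 0" unfolding b_def by (simp add: max_def)
    then show ?thesis by (metis INF_lower UNIV_I le_zero_eq)
  qed
  then have "(INF j. \<integral>\<^sup>+r. b j r \<partial>lborel) = 0"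
  proof (subst nn_integral_monotone_convergence_INF_decseq[symmetric, where i=0])
    show "decseq b" by (intro decseq_SucI le_funI) (auto simp: b_def intro!: ennreal_leI)
    show "(\<integral>\<^sup>+r. b 0 r \<partial>lborel) < \<infinity>" using fin a0 unfolding b_def by (simp add: max_absorb2)
  qed auto
  then have "(INF j. \<integral>\<^sup>+r. b j r \<partial>lborel) < ennreal (inverse (Suc k))" by simp
  then obtain j where j: "(\<integral>\<^sup>+r. b j r \<partial>lborel) < ennreal (inverse (Suc k))"
    unfolding INF_less_iff by blast
  have "(\<Sum>i\<in>I. increment \<gamma> n i) \<le> inverse (Suc k) + j * (card I / 2 ^ n)" if I: "I \<in> Pow {..<2 ^ n}" for n I
  proof -
    have [simp]: "finite I" using I finite_subset by blast
    have "ennreal (\<Sum>i\<in>I. increment \<gamma> n i) = (\<Sum>i\<in>I. ennreal (increment \<gamma> n i))"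
      by (simp add: increment_def sum_ennreal)
    also have "\<dots> \<le> (\<Sum>i\<in>I. dyadic_integral (b j) n i + ennreal j * ennreal (1 / 2 ^ n))"
    proof (rule sum_mono)
      fix i assume "i \<in> I"
      then have i: "i < 2 ^ n" using I by auto
      have "ennreal (increment \<gamma> n i) \<le> (\<integral>\<^sup>+r\<in>dyadic n i. ennreal (a r) \<partial>lborel)"
        unfolding increment_def dyadic_def
        by (rule le_a) (use dyadic_subset(1)[OF i] in \<open>auto simp: divide_right_mono\<close>)
      also have "\<dots> \<le> (\<integral>\<^sup>+r. b j r * indicator (dyadic n i) r + ennreal j * indicator (dyadic n i) r \<partial>lborel)"
      proof (rule nn_integral_mono)
        fix r
        have "ennreal (a r) \<le> b j r + ennreal j"
          unfolding b_def by (subst ennreal_plus[symmetric]) (simp_all add: ennreal_leI del: ennreal_max_0 ennreal_plus)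
        then show "ennreal (a r) * indicator (dyadic n i) r
            \<le> b j r * indicator (dyadic n i) r + ennreal j * indicator (dyadic n i) r"
          by (simp add: indicator_def)
      qed
      also have "\<dots> = dyadic_integral (b j) n i + ennreal j * ennreal (1 / 2 ^ n)"
        by (subst nn_integral_add) (simp_all add: nn_integral_cmult_indicator emeasure_dyadic)
      finally show "ennreal (increment \<gamma> n i)
          \<le> dyadic_integral (b j) n i + ennreal j * ennreal (1 / 2 ^ n)" .
    qed
    also have "\<dots> = (\<Sum>i\<in>I. dyadic_integral (b j) n i) + ennreal (j * (card I / 2 ^ n))"
      by (simp add: sum.distrib ennreal_of_nat_eq_real_of_nat ennreal_mult[symmetric] mult_ac)
    also have "\<dots> \<le> (\<Sum>i<2 ^ n. dyadic_integral (b j) n i) + ennreal (j * (card I / 2 ^ n))"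
      using I by (intro add_right_mono sum_mono2) auto
    also have "\<dots> = (\<integral>\<^sup>+r\<in>{0<..1}. b j r \<partial>lborel) + ennreal (j * (card I / 2 ^ n))"
      by (subst nn_integral_dyadic_sum) auto
    also have "\<dots> \<le> (\<integral>\<^sup>+r. b j r \<partial>lborel) + ennreal (j * (card I / 2 ^ n))"
      by (intro add_right_mono nn_integral_mono) (auto simp: indicator_def)
    also have "\<dots> \<le> ennreal (inverse (Suc k)) + ennreal (j * (card I / 2 ^ n))"
      using j by (intro add_right_mono) simp
    also have "\<dots> = ennreal (inverse (Suc k) + j * (card I / 2 ^ n))"
      by (rule ennreal_plus[symmetric]) auto
    finally show ?thesis by (subst (asm) ennreal_le_iff) auto
  qed
  then show "\<exists>j::nat. \<forall>n. \<forall>I\<in>Pow {..<2 ^ n}.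
     (\<Sum>i\<in>I. increment \<gamma> n i) \<le> inverse (Suc k) + j * (card I / 2 ^ n)" by blast
qed

text \<open>
  The converse direction: the dyadic variation of the curve is the distribution function of a
  measure, which the defining estimate of \<^const>\<open>dyadic_AC\<close> makes absolutely continuous; its
  density dominates the increments.
\<close>

context
  fixes \<gamma> :: "real \<Rightarrow> 'a::metric_space"
  assumes cont: "continuous_on {0..1} \<gamma>" and dAC: "dyadic_AC \<gamma>"
begin

text \<open>The number of dyadic intervals of level \<open>n\<close> that lie below
  \<open>t\<close>. Clamping \<open>t\<close> makes \<open>variation\<close> constant outside the
  unit interval, hence a distribution function on the whole line.\<close>

private definition grid :: "nat \<Rightarrow> real \<Rightarrow> nat" where
  "grid n t = nat \<lfloor>max 0 (min 1 t) * 2 ^ n\<rfloor>"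

private definition partial_variation :: "nat \<Rightarrow> real \<Rightarrow> real" where
  "partial_variation n t = (\<Sum>i<grid n t. increment \<gamma> n i)"

private definition variation :: "real \<Rightarrow> real" where
  "variation t = (SUP n. partial_variation n t)"

private lemma grid_le: "grid n t \<le> 2 ^ n"
proof -
  have "max 0 (min 1 t) * 2 ^ n \<le> 1 * 2 ^ n" by (rule mult_right_mono) auto
  then have "max 0 (min 1 t) * 2 ^ n < 2 ^ n + 1" by linarith
  then show ?thesis unfolding grid_def by (simp add: floor_le_iff nat_le_iff)
qed

private lemma grid_bounds:
  "real (grid n t) \<le> max 0 (min 1 t) * 2 ^ n" "max 0 (min 1 t) * 2 ^ n < real (grid n t) + 1"
proof -
  have "0 \<le> max 0 (min 1 t) * 2 ^ n" by simp
  then have "real (grid n t) = of_int \<lfloor>max 0 (min 1 t) * 2 ^ n\<rfloor>" unfolding grid_def by simp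
  then show "real (grid n t) \<le> max 0 (min 1 t) * 2 ^ n" "max 0 (min 1 t) * 2 ^ n < real (grid n t) + 1"
    by linarith+
qed

private lemma grid_mono: "s \<le> t \<Longrightarrow> grid n s \<le> grid n t"
  unfolding grid_def by (intro nat_mono floor_mono mult_right_mono) auto

private lemma grid_double: "2 * grid n t \<le> grid (Suc n) t"
proof -
  have "real (2 * grid n t) < real (grid (Suc n) t + 1)"
    using grid_bounds(1)[of n t] grid_bounds(2)[of t "Suc n"] by simp
  then show ?thesis by linarith
qed

private lemma grid_dyadic:
  assumes "i \<le> 2 ^ p"
  shows "grid (p + q) (real i / 2 ^ p) = i * 2 ^ q"
proof -
  have "real i \<le> real (2 ^ p)" using assms by (rule of_nat_mono)
  then have "max 0 (min 1 (real i / 2 ^ p)) = real i / 2 ^ p"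
    by (simp add: pos_divide_le_eq)
  then have "max 0 (min 1 (real i / 2 ^ p)) * 2 ^ (p + q) = real (i * 2 ^ q)"
    by (simp add: power_add)
  then show ?thesis unfolding grid_def by (metis floor_of_nat nat_int)
qed

private lemma grid_tendsto: "t \<in> {0..1} \<Longrightarrow> (\<lambda>n. real (grid n t) / 2 ^ n) \<longlonglongrightarrow> t"
proof (rule tendsto_sandwich[of "\<lambda>n. t - (1/2) ^ n" _ _ "\<lambda>n. t"])
  assume t: "t \<in> {0..1}"
  then have c: "max 0 (min 1 t) = t" by auto
  have "t - (1 / 2) ^ n \<le> real (grid n t) / 2 ^ n" for n
  proof -
    have "(t * 2 ^ n - 1) / 2 ^ n \<le> real (grid n t) / 2 ^ n"
      using grid_bounds(2)[of t n] unfolding c by (intro divide_right_mono) auto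
    then show ?thesis by (simp add: diff_divide_distrib power_divide)
  qed
  then show "\<forall>\<^sub>F n in sequentially. t - (1 / 2) ^ n \<le> real (grid n t) / 2 ^ n" by simp
  show "\<forall>\<^sub>F n in sequentially. real (grid n t) / 2 ^ n \<le> t"
    using grid_bounds(1)[of _ t] unfolding c by (simp add: pos_divide_le_eq)
  have "(\<lambda>n. t - (1 / 2) ^ n) \<longlonglongrightarrow> t - 0"
    by (intro tendsto_intros LIMSEQ_power_zero) auto
  then show "(\<lambda>n. t - (1 / 2) ^ n) \<longlonglongrightarrow> t" by simp
qed simp

private lemma increment_nonneg: "0 \<le> increment \<gamma> n i"
  unfolding increment_def by simp

private lemma increment_refine:
  "increment \<gamma> n i \<le> increment \<gamma> (Suc n) (2 * i) + increment \<gamma> (Suc n) (Suc (2 * i))"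
proof -
  have *: "real (2 * i) / 2 ^ Suc n = real i / 2 ^ n" "real (Suc (Suc (2 * i))) / 2 ^ Suc n = real (Suc i) / 2 ^ n"
    by (simp_all add: field_simps)
  show ?thesis unfolding increment_def * by (rule dist_triangle)
qed

private lemma sum_refine:
  "(\<Sum>i<a. increment \<gamma> n i) \<le> (\<Sum>i<2 * a. increment \<gamma> (Suc n) i)"
proof (induction a)
  case (Suc a)
  have "2 * Suc a = Suc (Suc (2 * a))" by simp
  then show ?case
    using Suc increment_refine[of n a] by (simp only: sum.lessThan_Suc)
qed simp

text \<open>Halving an interval does not decrease its contribution, by the triangle inequality, and
  at the next level at least twice as many intervals fit below \<open>t\<close>.\<close>

private lemma partial_variation_mono: "partial_variation n t \<le> partial_variation (Suc n) t"
proof -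
  have "partial_variation n t \<le> (\<Sum>i<2 * grid n t. increment \<gamma> (Suc n) i)"
    unfolding partial_variation_def by (rule sum_refine)
  also have "\<dots> \<le> partial_variation (Suc n) t"
    unfolding partial_variation_def using grid_double
    by (intro sum_mono2) (auto simp: increment_nonneg intro: less_le_trans)
  finally show ?thesis .
qed

private lemma sum_le:
  obtains j :: nat where "\<And>n I. I \<subseteq> {..<2 ^ n} \<Longrightarrow>
    (\<Sum>i\<in>I. increment \<gamma> n i) \<le> inverse (Suc k) + real j * (card I / 2 ^ n)"
  using dAC unfolding dyadic_AC_def by (metis PowI)

private lemma partial_variation_tendsto: "(\<lambda>n. partial_variation n t) \<longlonglongrightarrow> variation t"
  unfolding variation_def
proof (rule LIMSEQ_incseq_SUP)
  show "incseq (\<lambda>n. partial_variation n t)" by (rule incseq_SucI) (rule partial_variation_mono)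
  \<comment> \<open>The case \<open>k = 0\<close> is enough here: it bounds all partial variations
    by \<open>1 + real j\<close>.\<close>
  obtain j :: nat where j: "\<And>n I. I \<subseteq> {..<2 ^ n} \<Longrightarrow>
    (\<Sum>i\<in>I. increment \<gamma> n i) \<le> inverse (Suc 0) + real j * (card I / 2 ^ n)" using sum_le[of 0] by blast
  have "partial_variation n t \<le> 1 + real j" for n
  proof -
    have "partial_variation n t \<le> inverse (Suc 0) + real j * (card {..<grid n t} / 2 ^ n)"
      unfolding partial_variation_def by (rule j) (use grid_le[of n t] in auto)
    also have "\<dots> \<le> 1 + real j * 1"
    proof -
      have "real (grid n t) \<le> real (2 ^ n)" using grid_le by (rule of_nat_mono)
      then show ?thesis by (intro add_mono mult_left_mono) (auto simp: pos_divide_le_eq)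
    qed
    finally show ?thesis by simp
  qed
  then show "bdd_above (range (\<lambda>n. partial_variation n t))" by (auto intro!: bdd_aboveI)
qed

private lemma partial_variation_diff:
  assumes "s \<le> t"
  shows "partial_variation n t - partial_variation n s = (\<Sum>i\<in>{grid n s..<grid n t}. increment \<gamma> n i)"
proof -
  have "{..<grid n t} = {..<grid n s} \<union> {grid n s..<grid n t}"
    using grid_mono[OF assms, of n] by auto
  then have "partial_variation n t = partial_variation n s + (\<Sum>i\<in>{grid n s..<grid n t}. increment \<gamma> n i)"
    unfolding partial_variation_def by (metis finite_atLeastLessThan finite_lessThan ivl_disj_int_one(2) sum.union_disjoint)
  then show ?thesis by simp
qed

private lemma variation_diff_tendsto:
  assumes "s \<le> t"
  shows "(\<lambda>n. \<Sum>i\<in>{grid n s..<grid n t}. increment \<gamma> n i) \<longlonglongrightarrow> variation t - variation s"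
  using tendsto_diff[OF partial_variation_tendsto[of t] partial_variation_tendsto[of s]]
  by (simp only: partial_variation_diff[OF assms])

private lemma variation_mono: "s \<le> t \<Longrightarrow> variation s \<le> variation t"
proof -
  assume "s \<le> t"
  then have "0 \<le> variation t - variation s"
    by (intro LIMSEQ_le_const[OF variation_diff_tendsto]) (auto intro!: exI[of _ 0] sum_nonneg increment_nonneg)
  then show ?thesis by simp
qed

text \<open>The number of grid intervals between \<open>s\<close> and \<open>t\<close> is at most
  \<open>(t - s) * 2 ^ n + 1\<close>; the rounding term contributes \<open>j / 2 ^ n\<close> and
  disappears in the limit.\<close>

private lemma variation_modulus:
  obtains j :: nat where "\<And>s t :: real. s \<le> t \<Longrightarrow> variation t - variation s \<le> inverse (Suc k) + real j * (t - s)"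
proof -
  obtain j :: nat where j: "\<And>n I. I \<subseteq> {..<2 ^ n} \<Longrightarrow>
    (\<Sum>i\<in>I. increment \<gamma> n i) \<le> inverse (Suc k) + real j * (card I / 2 ^ n)" using sum_le[of k] by blast
  have "variation t - variation s \<le> inverse (Suc k) + real j * (t - s)" if "s \<le> t" for s t :: real
  proof (rule LIMSEQ_le[OF variation_diff_tendsto[OF that]])
    have "(\<lambda>n. inverse (Suc k) + real j * ((t - s) + (1/2) ^ n)) \<longlonglongrightarrow> inverse (Suc k) + real j * ((t - s) + 0)"
      by (intro tendsto_intros LIMSEQ_power_zero) auto
    then show "(\<lambda>n. inverse (Suc k) + real j * ((t - s) + (1/2) ^ n)) \<longlonglongrightarrow> inverse (Suc k) + real j * (t - s)" by simp
    have "(\<Sum>i\<in>{grid n s..<grid n t}. increment \<gamma> n i) \<le> inverse (Suc k) + real j * ((t - s) + (1/2) ^ n)" for n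
    proof -
      have "(\<Sum>i\<in>{grid n s..<grid n t}. increment \<gamma> n i)
          \<le> inverse (Suc k) + real j * (card {grid n s..<grid n t} / 2 ^ n)"
        by (rule j) (use grid_le[of n t] in auto)
      also have "\<dots> \<le> inverse (Suc k) + real j * ((t - s) + (1/2) ^ n)"
      proof (intro add_left_mono mult_left_mono)
        have "real (card {grid n s..<grid n t}) = real (grid n t) - real (grid n s)"
          using grid_mono[OF that, of n] by (simp add: of_nat_diff)
        also have "\<dots> \<le> (max 0 (min 1 t) - max 0 (min 1 s)) * 2 ^ n + 1"
          using grid_bounds(1)[of n t] grid_bounds(2)[of s n] by (simp add: left_diff_distrib)
        also have "\<dots> \<le> (t - s) * 2 ^ n + 1"
          using that by (intro add_right_mono mult_right_mono) auto
        finally have "real (card {grid n s..<grid n t}) / 2 ^ n \<le> ((t - s) * 2 ^ n + 1) / 2 ^ n"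
          by (rule divide_right_mono) simp
        also have "\<dots> = (t - s) + (1/2) ^ n" by (simp add: add_divide_distrib power_divide)
        finally show "real (card {grid n s..<grid n t}) / 2 ^ n \<le> (t - s) + (1/2) ^ n" .
      qed simp
      finally show ?thesis .
    qed
    then show "\<exists>N. \<forall>n\<ge>N. (\<Sum>i\<in>{grid n s..<grid n t}. increment \<gamma> n i)
        \<le> inverse (Suc k) + real j * ((t - s) + (1/2) ^ n)" by blast
  qed
  then show ?thesis by (rule that)
qed

private lemma variation_right_continuous: "continuous (at_right a) variation"
proof -
  have "\<exists>d>0. \<forall>t>a. t - a < d \<longrightarrow> \<bar>variation t - variation a\<bar> < e" if "e > 0" for e
  proof -
    obtain k where k: "inverse (Suc k) < e / 2" using reals_Archimedean[of "e/2"] \<open>e > 0\<close> by auto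
    obtain j :: nat where j: "\<And>s t :: real. s \<le> t \<Longrightarrow> variation t - variation s \<le> inverse (Suc k) + real j * (t - s)"
      using variation_modulus[of k] by blast
    \<comment> \<open>The \<open>+ 1\<close> in the denominator covers \<open>j = 0\<close>.\<close>
    have "\<bar>variation t - variation a\<bar> < e" if t: "t > a" "t - a < e / (2 * (real j + 1))" for t
    proof -
      have "real j * (t - a) \<le> (real j + 1) * (t - a)" using t(1) by (intro mult_right_mono) auto
      also have "\<dots> < e / 2"
      proof -
        have "(t - a) * (2 * (real j + 1)) < e"
          using t(2) by (subst (asm) pos_less_divide_eq) auto
        then show ?thesis by (simp add: algebra_simps)
      qed
      finally have "variation t - variation a < e" using j[of a t] t(1) k by simp
      then show ?thesis using variation_mono[of a t] t(1) by simp
    qed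
    then show ?thesis using \<open>e > 0\<close> by (intro exI[of _ "e / (2 * (real j + 1))"]) auto
  qed
  then show ?thesis
    unfolding continuous_within tendsto_iff eventually_at dist_real_def
    by (metis abs_of_pos diff_gt_0_iff_gt greaterThan_iff)
qed

text \<open>Grid points approximate \<open>s\<close> and \<open>t\<close> from below, the triangle
  inequality chains the increments between them, and continuity of the curve gives the
  limit.\<close>

private lemma dist_le_variation:
  assumes "0 \<le> s" "s \<le> t" "t \<le> 1"
  shows "dist (\<gamma> s) (\<gamma> t) \<le> variation t - variation s"
proof (rule LIMSEQ_le)
  show "(\<lambda>n. \<Sum>i\<in>{grid n s..<grid n t}. increment \<gamma> n i) \<longlonglongrightarrow> variation t - variation s"
    by (rule variation_diff_tendsto[OF assms(2)])
  have "(\<lambda>n. \<gamma> (real (grid n u) / 2 ^ n)) \<longlonglongrightarrow> \<gamma> u" if "u \<in> {0..1}" for u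
  proof (rule continuous_on_tendsto_compose[OF cont grid_tendsto[OF that] that])
    have "real (grid n u) \<le> real (2 ^ n)" for n using grid_le by (rule of_nat_mono)
    then show "\<forall>\<^sub>F n in sequentially. real (grid n u) / 2 ^ n \<in> {0..1}"
      by (simp add: pos_divide_le_eq)
  qed
  then show "(\<lambda>n. dist (\<gamma> (real (grid n s) / 2 ^ n)) (\<gamma> (real (grid n t) / 2 ^ n))) \<longlonglongrightarrow> dist (\<gamma> s) (\<gamma> t)"
    using assms by (intro tendsto_dist) auto
  have *: "dist (\<gamma> (real a / 2 ^ n)) (\<gamma> (real b / 2 ^ n)) \<le> (\<Sum>i\<in>{a..<b}. increment \<gamma> n i)"
    if "a \<le> b" for a b n
    using that
  proof (induction b rule: dec_induct)
    case (step b)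
    have "dist (\<gamma> (real a / 2 ^ n)) (\<gamma> (real (Suc b) / 2 ^ n))
        \<le> dist (\<gamma> (real a / 2 ^ n)) (\<gamma> (real b / 2 ^ n)) + increment \<gamma> n b"
      unfolding increment_def by (rule dist_triangle)
    also have "\<dots> \<le> (\<Sum>i\<in>{a..<b}. increment \<gamma> n i) + increment \<gamma> n b"
      by (rule add_right_mono[OF step.IH])
    finally show ?case using step(1) by (simp add: sum.atLeastLessThan_Suc del: of_nat_Suc)
  qed simp
  show "\<exists>N. \<forall>n\<ge>N. dist (\<gamma> (real (grid n s) / 2 ^ n)) (\<gamma> (real (grid n t) / 2 ^ n))
      \<le> (\<Sum>i\<in>{grid n s..<grid n t}. increment \<gamma> n i)"
    by (intro exI[of _ 0] allI impI * grid_mono assms)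
qed

text \<open>Refining each interval of level \<open>p\<close> into \<open>2 ^ q\<close> pieces
  multiplies both the number of intervals and \<open>2 ^ p\<close> by \<open>2 ^ q\<close>. The
  bound from \<open>dyadic_AC\<close> is therefore the same at all finer levels and passes to the
  limit in \<open>q\<close>, with \<open>j\<close> independent of \<open>p\<close>.\<close>

private lemma sum_variation_le:
  obtains j :: nat where "\<And>p I. I \<subseteq> {..<2 ^ p} \<Longrightarrow>
    (\<Sum>i\<in>I. variation (real (Suc i) / 2 ^ p) - variation (real i / 2 ^ p)) \<le> inverse (Suc k) + real j * (card I / 2 ^ p)"
proof -
  obtain j :: nat where j: "\<And>n I. I \<subseteq> {..<2 ^ n} \<Longrightarrow>
    (\<Sum>i\<in>I. increment \<gamma> n i) \<le> inverse (Suc k) + real j * (card I / 2 ^ n)" using sum_le[of k] by blast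
  have "(\<Sum>i\<in>I. variation (real (Suc i) / 2 ^ p) - variation (real i / 2 ^ p)) \<le> inverse (Suc k) + real j * (card I / 2 ^ p)"
    if I: "I \<subseteq> {..<2 ^ p}" for p I
  proof (rule LIMSEQ_le_const2)
    define B where "B q i = {i * 2 ^ q..<Suc i * 2 ^ q}" for q i :: nat
    have fin: "finite I" using I finite_subset by blast
    have disj: "B q i \<inter> B q i' = {}" if "i \<noteq> i'" for q i i'
    proof -
      have "x div 2 ^ q = i" if "x \<in> B q i" for x i
        using that unfolding B_def by (intro div_nat_eqI) (auto simp: mult.commute)
      then show ?thesis using that by blast
    qed
    have sub: "(\<Union>i\<in>I. B q i) \<subseteq> {..<2 ^ (p + q)}" for q
    proof
      fix x assume "x \<in> (\<Union>i\<in>I. B q i)"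
      then obtain i where i: "i \<in> I" "x < Suc i * 2 ^ q" unfolding B_def by auto
      have "Suc i \<le> 2 ^ p" using I i by (simp add: Suc_leI subset_iff)
      then have "Suc i * 2 ^ q \<le> 2 ^ p * 2 ^ q" by (rule mult_le_mono1)
      then show "x \<in> {..<2 ^ (p + q)}" using i by (simp add: power_add)
    qed
    have shift: "(\<lambda>q. partial_variation (p + q) t) \<longlonglongrightarrow> variation t" for t
      using LIMSEQ_ignore_initial_segment[OF partial_variation_tendsto[of t], of p] by (simp only: add.commute)
    show "(\<lambda>q. \<Sum>i\<in>I. partial_variation (p + q) (real (Suc i) / 2 ^ p) - partial_variation (p + q) (real i / 2 ^ p))
       \<longlonglongrightarrow> (\<Sum>i\<in>I. variation (real (Suc i) / 2 ^ p) - variation (real i / 2 ^ p))"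
      by (intro tendsto_sum tendsto_diff shift)
    have "(\<Sum>i\<in>I. partial_variation (p + q) (real (Suc i) / 2 ^ p) - partial_variation (p + q) (real i / 2 ^ p))
      \<le> inverse (Suc k) + real j * (card I / 2 ^ p)" for q
    proof -
      have "partial_variation (p + q) (real (Suc i) / 2 ^ p) - partial_variation (p + q) (real i / 2 ^ p)
        = (\<Sum>l\<in>B q i. increment \<gamma> (p + q) l)" if "i \<in> I" for i
      proof -
        have "Suc i \<le> 2 ^ p" "i \<le> 2 ^ p" using that I by (auto simp: Suc_leI subset_iff)
        then show ?thesis unfolding B_def
          by (subst partial_variation_diff) (simp_all add: grid_dyadic divide_right_mono del: of_nat_Suc mult_Suc)
      qed
      then have "(\<Sum>i\<in>I. partial_variation (p + q) (real (Suc i) / 2 ^ p) - partial_variation (p + q) (real i / 2 ^ p))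
        = (\<Sum>i\<in>I. \<Sum>l\<in>B q i. increment \<gamma> (p + q) l)" by (rule sum.cong[OF refl])
      also have "\<dots> = (\<Sum>l\<in>(\<Union>i\<in>I. B q i). increment \<gamma> (p + q) l)"
        using fin disj by (subst sum.UNION_disjoint) (auto simp: B_def)
      also have "\<dots> \<le> inverse (Suc k) + real j * (card (\<Union>i\<in>I. B q i) / 2 ^ (p + q))" by (rule j[OF sub])
      also have "card (\<Union>i\<in>I. B q i) = card I * 2 ^ q"
        using fin disj by (subst card_UN_disjoint) (auto simp: B_def)
      also have "real (card I * 2 ^ q) / 2 ^ (p + q) = card I / 2 ^ p" by (simp add: power_add)
      finally show ?thesis .
    qed
    then show "\<exists>N. \<forall>q\<ge>N. (\<Sum>i\<in>I. partial_variation (p + q) (real (Suc i) / 2 ^ p) - partial_variation (p + q) (real i / 2 ^ p))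
      \<le> inverse (Suc k) + real j * (card I / 2 ^ p)" by blast
  qed
  then show ?thesis by (rule that)
qed

private lemmas emeasure_variation = emeasure_interval_measure_Ioc[of _ _ variation, OF _ variation_mono variation_right_continuous]

text \<open>On a finite union of dyadic intervals of one level, \<open>card I / 2 ^ p\<close> is the
  Lebesgue measure, so there the claim is \<open>sum_variation_le\<close>; such unions exhaust the
  open set.\<close>

private lemma emeasure_variation_open_le:
  obtains j :: nat where "\<And>U. open U \<Longrightarrow>
    emeasure (interval_measure variation) (U \<inter> {0<..1}) \<le> ennreal (inverse (Suc k)) + ennreal j * emeasure lborel U"
proof -
  obtain j :: nat where j: "\<And>p I. I \<subseteq> {..<2 ^ p} \<Longrightarrow>
    (\<Sum>i\<in>I. variation (real (Suc i) / 2 ^ p) - variation (real i / 2 ^ p)) \<le> inverse (Suc k) + real j * (card I / 2 ^ p)"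
    using sum_variation_le[of k] by blast
  have "emeasure (interval_measure variation) (U \<inter> {0<..1}) \<le> ennreal (inverse (Suc k)) + ennreal j * emeasure lborel U"
    if U: "open U" for U
  proof -
    define K where "K n = (\<Union>i\<in>dyadic_inner U n. dyadic n i)" for n
    have [measurable]: "K n \<in> sets borel" for n unfolding K_def by (intro sets.finite_UN) auto
    have disj: "disjoint_family_on (dyadic n) (dyadic_inner U n)" for n
      unfolding disjoint_family_on_def using dyadic_disjoint by blast
    have "(SUP n. emeasure (interval_measure variation) (K n)) = emeasure (interval_measure variation) (U \<inter> {0<..1})"
      unfolding UN_dyadic_inner[OF U, symmetric] K_def[symmetric]
    proof (rule SUP_emeasure_incseq)
      show "incseq K" unfolding K_def by (intro incseq_SucI dyadic_inner_mono)
    qed auto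
    moreover have "emeasure (interval_measure variation) (K n) \<le> ennreal (inverse (Suc k)) + ennreal j * emeasure lborel U" for n
    proof -
      have sub: "dyadic_inner U n \<subseteq> {..<2 ^ n}" unfolding dyadic_inner_def by auto
      have "emeasure (interval_measure variation) (K n) = (\<Sum>i\<in>dyadic_inner U n. emeasure (interval_measure variation) (dyadic n i))"
        unfolding K_def using disj by (subst sum_emeasure) auto
      also have "\<dots> = (\<Sum>i\<in>dyadic_inner U n. ennreal (variation (real (Suc i) / 2 ^ n) - variation (real i / 2 ^ n)))"
        unfolding dyadic_def by (intro sum.cong refl emeasure_variation) (auto intro: divide_right_mono)
      also have "\<dots> = ennreal (\<Sum>i\<in>dyadic_inner U n. variation (real (Suc i) / 2 ^ n) - variation (real i / 2 ^ n))"
        by (rule sum_ennreal) (auto intro!: variation_mono divide_right_mono)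
      also have "\<dots> \<le> ennreal (inverse (Suc k) + real j * (card (dyadic_inner U n) / 2 ^ n))"
        by (rule ennreal_leI[OF j[OF sub]])
      also have "\<dots> = ennreal (inverse (Suc k)) + ennreal j * ennreal (card (dyadic_inner U n) / 2 ^ n)"
        by (simp add: ennreal_mult[symmetric] del: ennreal_of_nat_eq_real_of_nat)
      also have "ennreal (card (dyadic_inner U n) / 2 ^ n) = emeasure lborel (K n)"
        unfolding K_def using disj
        by (subst sum_emeasure[symmetric]) (auto simp: emeasure_dyadic ennreal_of_nat_eq_real_of_nat ennreal_mult[symmetric])
      also have "emeasure lborel (K n) \<le> emeasure lborel U"
        using U by (intro emeasure_mono) (auto simp: K_def dyadic_inner_def)
      finally show ?thesis by (simp add: add_left_mono mult_left_mono)
    qed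
    ultimately show ?thesis by (metis SUP_least)
  qed
  then show ?thesis by (rule that)
qed

lemma dyadic_AC_imp_AC: "\<gamma> \<in> AC"
proof -
  \<comment> \<open>The indicator restricts the measure to the part of the line where the estimate
    for open sets is available.\<close>
  define \<mu> where "\<mu> = density (interval_measure variation) (indicator {0<..1})"
  have sets_mu: "sets \<mu> = sets borel" unfolding \<mu>_def by simp
  have mu: "emeasure \<mu> A = emeasure (interval_measure variation) (A \<inter> {0<..1})" if "A \<in> sets borel" for A
    unfolding \<mu>_def using that by (subst emeasure_density)
      (auto simp: indicator_inter_arith[symmetric] mult.commute Int_commute)
  have "absolutely_continuous lborel \<mu>"
    unfolding absolutely_continuous_def
  proof
    fix N :: "real set" assume "N \<in> null_sets lborel"
    then have N: "N \<in> sets borel" "emeasure lborel N = 0" by auto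
    have "emeasure \<mu> N \<le> ennreal (2 * inverse (Suc k))" for k
    proof -
      obtain j :: nat where j: "\<And>U. open U \<Longrightarrow> emeasure (interval_measure variation) (U \<inter> {0<..1})
          \<le> ennreal (inverse (Suc k)) + ennreal j * emeasure lborel U"
        using emeasure_variation_open_le[of k] by blast
      \<comment> \<open>Chosen so that \<open>j * e \<le> inverse (Suc k)\<close>; taking
        \<open>Suc j\<close> keeps \<open>e\<close> positive when \<open>j = 0\<close>.\<close>
      define e where "e = inverse (real (Suc k)) * inverse (real (Suc j))"
      have "e > 0" unfolding e_def by simp
      obtain U where U: "open U" "N \<subseteq> U" "emeasure lborel (U - N) < e"
        using outer_regular_lborel[OF N(1) \<open>e > 0\<close>] by blast
      have "emeasure lborel U \<le> emeasure lborel (U - N) + emeasure lborel N"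
        using U(1) N(1) by (intro order_trans[OF emeasure_mono emeasure_subadditive]) auto
      then have Ue: "emeasure lborel U \<le> e" using U(3) N(2) by simp
      have "emeasure \<mu> N \<le> emeasure (interval_measure variation) (U \<inter> {0<..1})"
        unfolding mu[OF N(1)] using U by (intro emeasure_mono) auto
      also have "\<dots> \<le> ennreal (inverse (Suc k)) + ennreal j * emeasure lborel U" by (rule j[OF U(1)])
      also have "\<dots> \<le> ennreal (inverse (Suc k)) + ennreal j * ennreal e"
        by (intro add_left_mono mult_left_mono Ue) simp
      also have "\<dots> = ennreal (inverse (Suc k) + j * e)"
        using \<open>e > 0\<close> by (simp add: ennreal_mult[symmetric] del: ennreal_of_nat_eq_real_of_nat)
      also have "\<dots> \<le> ennreal (2 * inverse (Suc k))"
      proof (rule ennreal_leI)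
        have "j * e = inverse (real (Suc k)) * (real j / real (Suc j))" unfolding e_def by (simp add: field_simps)
        also have "\<dots> \<le> inverse (real (Suc k)) * 1" by (intro mult_left_mono) auto
        finally show "inverse (real (Suc k)) + j * e \<le> 2 * inverse (real (Suc k))" by simp
      qed
      finally show ?thesis .
    qed
    moreover have "(\<lambda>k. ennreal (2 * inverse (Suc k))) \<longlonglongrightarrow> ennreal (2 * 0)"
      by (intro tendsto_ennrealI tendsto_intros LIMSEQ_inverse_real_of_nat)
    ultimately have "emeasure \<mu> N \<le> 0"
      using LIMSEQ_le_const[of _ "ennreal (2 * 0)" "emeasure \<mu> N"] by auto
    then show "N \<in> null_sets \<mu>" using N sets_mu by auto
  qed
  then obtain f where f [measurable]: "f \<in> borel_measurable lborel" and fmu: "density lborel f = \<mu>"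
    using sigma_finite_measure.Radon_Nikodym[OF sigma_finite_lborel, of \<mu>] sets_mu by auto
  have int_f: "(\<integral>\<^sup>+r\<in>{s<..t}. f r \<partial>lborel) = ennreal (variation t - variation s)" if "0 \<le> s" "s \<le> t" "t \<le> 1" for s t
  proof -
    have "(\<integral>\<^sup>+r\<in>{s<..t}. f r \<partial>lborel) = emeasure \<mu> {s<..t}"
      unfolding fmu[symmetric] by (subst emeasure_density) auto
    also have "\<dots> = emeasure (interval_measure variation) {s<..t}"
      using that by (subst mu) (auto intro!: arg_cong2[where f=emeasure])
    finally show ?thesis using that by (simp add: emeasure_variation)
  qed
  define h where "h r = enn2real (f r)" for r
  have [measurable]: "h \<in> borel_measurable borel" using f unfolding h_def by simp
  \<comment> \<open>The density has finite integral over \<open>{0<..1}\<close>, namely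
    \<open>variation 1 - variation 0\<close>, so the real-valued \<open>h\<close> represents it
    almost everywhere there.\<close>
  have "AE r in lborel. f r * indicator {0<..1} r \<noteq> \<infinity>"
    by (rule nn_integral_PInf_AE) (use int_f[of 0 1] in auto)
  then have h_eq: "AE r in lborel. r \<in> {0<..1} \<longrightarrow> ennreal (h r) = f r"
    by eventually_elim (auto simp: h_def less_top)
  have h_int: "(\<integral>\<^sup>+r. ennreal (indicator {s..t} r * h r) \<partial>lborel) = ennreal (variation t - variation s)"
    if "0 \<le> s" "s \<le> t" "t \<le> 1" for s t
    unfolding int_f[OF that, symmetric]
  proof (rule nn_integral_cong_AE)
    have "AE r in lborel. r \<noteq> s" by (rule AE_lborel_singleton)
    with h_eq show "AE r in lborel. ennreal (indicator {s..t} r * h r) = f r * indicator {s<..t} r"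
      by eventually_elim (use that in \<open>auto simp: indicator_def\<close>)
  qed
  have integ: "integrable lborel (\<lambda>r. indicator {s..t} r * h r)" if "0 \<le> s" "s \<le> t" "t \<le> 1" for s t
    using h_int[OF that] by (intro integrableI_nonneg) (auto simp: h_def)
  show ?thesis
    unfolding AC_def
  proof (intro CollectI exI[of _ h] conjI allI impI)
    show "set_integrable lborel {0..1} h"
      unfolding set_integrable_def using integ[of 0 1] by simp
    fix s t :: real assume st: "0 \<le> s" "s \<le> t" "t \<le> 1"
    have "ennreal (LBINT r:{s..t}. h r) = ennreal (variation t - variation s)"
      unfolding h_int[OF st, symmetric] set_lebesgue_integral_def using integ[OF st]
      by (subst nn_integral_eq_integral) (auto simp: h_def)
    then have "(LBINT r:{s..t}. h r) = variation t - variation s"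
      using variation_mono[OF st(2)] by (subst (asm) ennreal_inj) (auto simp: set_lebesgue_integral_def h_def)
    then show "dist (\<gamma> s) (\<gamma> t) \<le> (LBINT r:{s..t}. h r)" using dist_le_variation[OF st] by simp
  qed
qed

end

lemma measurable_AC: "Measurable.pred curve_borel (\<lambda>\<gamma> :: real \<Rightarrow> 'a::polish_space. \<gamma> \<in> AC)"
proof -
  have "\<gamma> \<in> AC \<longleftrightarrow> dyadic_AC \<gamma>" if "\<gamma> \<in> space curve_borel" for \<gamma> :: "real \<Rightarrow> 'a"
    using AC_imp_dyadic_AC dyadic_AC_imp_AC continuous_on_curve[OF that] by blast
  moreover have "Measurable.pred curve_borel (\<lambda>\<gamma> :: real \<Rightarrow> 'a. dyadic_AC \<gamma>)"
    unfolding dyadic_AC_def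
  proof (intro pred_intros_countable pred_intros_finite)
    fix k j n :: nat and I :: "nat set" assume I: "I \<in> Pow {..<2 ^ n}"
    have "(\<lambda>\<gamma> :: real \<Rightarrow> 'a. increment \<gamma> n i) \<in> borel_measurable curve_borel" if "i \<in> I" for i
    proof -
      have "i < 2 ^ n" using I that by auto
      then have "real i / 2 ^ n \<in> {0..1}" "real (Suc i) / 2 ^ n \<in> {0..1}"
        using dyadic_subset(1)[of i n] by (auto simp: divide_right_mono subset_iff)
      then show ?thesis
        unfolding increment_def by (intro borel_measurable_dist measurable_evaluation)
    qed
    then have [measurable]: "(\<lambda>\<gamma> :: real \<Rightarrow> 'a. \<Sum>i\<in>I. increment \<gamma> n i) \<in> borel_measurable curve_borel"
      by (rule borel_measurable_sum)
    show "Measurable.pred curve_borel (\<lambda>\<gamma> :: real \<Rightarrow> 'a. (\<Sum>i\<in>I. increment \<gamma> n i)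
        \<le> inverse (Suc k) + real j * (card I / 2 ^ n))"
      by measurable
  qed simp
  ultimately show ?thesis by (subst measurable_cong) auto
qed

subsection \<open>Restriction of curves and of test plans\<close>

definition path_integral :: "('a::metric_space \<Rightarrow> ennreal) \<Rightarrow> (real \<Rightarrow> 'a) \<Rightarrow> real \<Rightarrow> real \<Rightarrow> ennreal" where
  "path_integral G \<gamma> s t = (\<integral>\<^sup>+r\<in>{s..t}. G (\<gamma> r) * ennreal (metric_derivative \<gamma> r) \<partial>lborel)"

text \<open>
  Curves are arbitrary outside the unit interval, so joint measurability needs the time variable
  to be clamped.
\<close>
abbreviation clamp01 :: "real \<Rightarrow> real" where
  "clamp01 r \<equiv> max 0 (min 1 r)"

lemma measurable_clamped_pair:
  fixes f :: "'b \<Rightarrow> real \<Rightarrow> 'a::polish_space"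
  assumes [measurable]: "f \<in> M \<rightarrow>\<^sub>M curve_borel" "T \<in> borel_measurable M"
  shows "(\<lambda>x. f x (clamp01 (T x))) \<in> borel_measurable M"
    and "(\<lambda>x. metric_derivative (f x) (clamp01 (T x))) \<in> borel_measurable M"
  by (rule measurable_evaluation_pair measurable_metric_derivative_pair; simp)+

definition speed_integrand :: "('a::metric_space \<Rightarrow> ennreal) \<Rightarrow> (real \<Rightarrow> 'a) \<Rightarrow> real \<Rightarrow> ennreal" where
  "speed_integrand G \<gamma> r = G (\<gamma> (clamp01 r)) * ennreal (metric_derivative \<gamma> (clamp01 r))"

abbreviation speed_integral :: "('a::metric_space \<Rightarrow> ennreal) \<Rightarrow> (real \<Rightarrow> 'a) \<Rightarrow> real set \<Rightarrow> ennreal" where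
  "speed_integral G \<gamma> A \<equiv> (\<integral>\<^sup>+r\<in>A. speed_integrand G \<gamma> r \<partial>lborel)"

abbreviation upper_gradient_along :: "('a::metric_space \<Rightarrow> real) \<Rightarrow> ('a \<Rightarrow> ennreal) \<Rightarrow> (real \<Rightarrow> 'a) \<Rightarrow> bool" where
  "upper_gradient_along f G \<gamma> \<equiv> ennreal \<bar>f (\<gamma> 1) - f (\<gamma> 0)\<bar> \<le> path_integral G \<gamma> 0 1 \<and> path_integral G \<gamma> 0 1 < \<infinity>"

lemma measurable_speed_integrand_pair:
  fixes f :: "'b \<Rightarrow> real \<Rightarrow> 'a::polish_space"
  assumes f: "f \<in> M \<rightarrow>\<^sub>M curve_borel" and T: "T \<in> borel_measurable M" and [measurable]: "G \<in> borel_measurable borel"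
  shows "(\<lambda>x. speed_integrand G (f x) (T x)) \<in> borel_measurable M"
proof -
  note [measurable] = measurable_clamped_pair[OF f T]
  show ?thesis unfolding speed_integrand_def by measurable
qed

lemma measurable_speed_integrand:
  fixes \<gamma> :: "real \<Rightarrow> 'a::polish_space"
  assumes "\<gamma> \<in> space curve_borel" "G \<in> borel_measurable borel"
  shows "speed_integrand G \<gamma> \<in> borel_measurable borel"
  using measurable_speed_integrand_pair[of "\<lambda>r. \<gamma>" borel "\<lambda>r. r" G] assms by simp

lemma clamp01_id: "r \<in> {0..1} \<Longrightarrow> clamp01 r = r"
  by auto

lemma path_integral_eq:
  assumes "0 \<le> s" "t \<le> 1"
  shows "path_integral G \<gamma> s t = speed_integral G \<gamma> {s..t}"
  unfolding path_integral_def speed_integrand_def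
proof (rule nn_integral_cong)
  fix r
  show "G (\<gamma> r) * ennreal (metric_derivative \<gamma> r) * indicator {s..t} r =
      G (\<gamma> (clamp01 r)) * ennreal (metric_derivative \<gamma> (clamp01 r)) * indicator {s..t} r"
  proof (cases "r \<in> {s..t}")
    case True
    then have "clamp01 r = r" using assms by (intro clamp01_id) auto
    then show ?thesis by (simp only:)
  qed simp
qed

lemma path_integral_Ioc:
  assumes "0 \<le> s" "t \<le> 1"
  shows "path_integral G \<gamma> s t = speed_integral G \<gamma> {s<..t}"
  unfolding path_integral_eq[OF assms]
proof (rule nn_integral_cong_AE)
  have "AE r in lborel. r \<noteq> s" by (rule AE_lborel_singleton)
  then show "AE r in lborel. speed_integrand G \<gamma> r * indicator {s..t} r = speed_integrand G \<gamma> r * indicator {s<..t} r"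
    by eventually_elim (auto simp: indicator_def)
qed

lemma measurable_path_integral:
  fixes G :: "'a::polish_space \<Rightarrow> ennreal"
  assumes [measurable]: "G \<in> borel_measurable borel" and "0 \<le> s" "t \<le> 1"
  shows "(\<lambda>\<gamma>. path_integral G \<gamma> s t) \<in> borel_measurable curve_borel"
proof -
  have [measurable]: "(\<lambda>x. speed_integrand G (fst x) (snd x)) \<in> borel_measurable (curve_borel \<Otimes>\<^sub>M lborel)"
    by (rule measurable_speed_integrand_pair) auto
  show ?thesis
    unfolding path_integral_eq[OF assms(2,3)] by measurable
qed

definition energy :: "(real \<Rightarrow> 'a::metric_space) \<Rightarrow> ennreal" where
  "energy \<gamma> = (\<integral>\<^sup>+t\<in>{0..1}. ennreal ((metric_derivative \<gamma> t)\<^sup>2) \<partial>lborel)"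

lemma energy_eq: "energy \<gamma> = (\<integral>\<^sup>+t\<in>{0..1}. ennreal ((metric_derivative \<gamma> (clamp01 t))\<^sup>2) \<partial>lborel)"
  unfolding energy_def
proof (rule nn_integral_cong)
  fix t
  show "ennreal ((metric_derivative \<gamma> t)\<^sup>2) * indicator {0..1} t =
      ennreal ((metric_derivative \<gamma> (clamp01 t))\<^sup>2) * indicator {0..1} t"
  proof (cases "t \<in> {0..1}")
    case True
    then show ?thesis by (simp only: clamp01_id)
  qed simp
qed

lemma measurable_energy: "(energy :: (real \<Rightarrow> 'a::polish_space) \<Rightarrow> ennreal) \<in> borel_measurable curve_borel"
proof -
  have [measurable]: "(\<lambda>x. metric_derivative (fst x) (clamp01 (snd x)))
      \<in> borel_measurable ((curve_borel :: (real \<Rightarrow> 'a) measure) \<Otimes>\<^sub>M lborel)"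
    by (rule measurable_clamped_pair) auto
  show ?thesis
    unfolding energy_eq[abs_def] by measurable
qed

lemma measurable_AC2: "Measurable.pred curve_borel (\<lambda>\<gamma> :: real \<Rightarrow> 'a::polish_space. \<gamma> \<in> AC2)"
proof -
  note [measurable] = measurable_AC measurable_energy
  have "Measurable.pred curve_borel (\<lambda>\<gamma> :: real \<Rightarrow> 'a. \<gamma> \<in> AC \<and> energy \<gamma> < \<infinity>)" by measurable
  then show ?thesis unfolding AC2_def energy_def by simp
qed

text \<open>The piece of the curve over \<open>{s..t}\<close>, rescaled to unit time.
  \<open>restrict\<close> makes the result extensional, as membership in the space of curves
  demands.\<close>

definition subcurve :: "real \<Rightarrow> real \<Rightarrow> (real \<Rightarrow> 'a::metric_space) \<Rightarrow> real \<Rightarrow> 'a" where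
  "subcurve s t \<gamma> = restrict (\<lambda>r. \<gamma> (s + (t - s) * r)) {0..1}"

lemma affine_in_Icc:
  fixes s t :: real
  assumes "0 \<le> s" "s < t" "t \<le> 1"
  shows "s + (t - s) * r \<in> {s..t} \<longleftrightarrow> r \<in> {0..1}"
proof -
  have "(t - s) * r \<le> (t - s) * 1 \<longleftrightarrow> r \<le> 1" using assms by (subst mult_le_cancel_left_pos) auto
  moreover have "0 \<le> (t - s) * r \<longleftrightarrow> 0 \<le> r" using assms by (simp add: zero_le_mult_iff)
  ultimately show ?thesis by auto
qed

lemma subcurve_in_space:
  assumes "\<gamma> \<in> mspace curve_metric" "0 \<le> s" "s < t" "t \<le> 1"
  shows "subcurve s t \<gamma> \<in> mspace curve_metric"
proof -
  have "s + (t - s) * r \<in> {0..1}" if "r \<in> {0..1}" for r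
    using affine_in_Icc[OF assms(2-4), of r] that assms by auto
  then have img: "(\<lambda>r. s + (t - s) * r) ` {0..1} \<subseteq> {0..1}" by blast
  have "continuous_on {0..1} \<gamma>" using assms(1) unfolding mspace_curve_metric by blast
  then have "continuous_on {0..1} (\<gamma> \<circ> (\<lambda>r. s + (t - s) * r))"
    by (intro continuous_on_compose continuous_intros) (rule continuous_on_subset[OF _ img])
  then have "continuous_on {0..1} (restrict (\<lambda>r. \<gamma> (s + (t - s) * r)) {0..1})"
    by (rule continuous_on_eq) simp
  then show ?thesis
    unfolding mspace_curve_metric subcurve_def by simp
qed

lemma measurable_subcurve:
  assumes "0 \<le> s" "s < t" "t \<le> 1"
  shows "subcurve s t \<in> curve_borel \<rightarrow>\<^sub>M curve_borel"
proof (rule measurable_nonexpansive)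
  fix \<gamma> \<eta> :: "real \<Rightarrow> 'a" and r :: real
  assume c: "\<gamma> \<in> mspace curve_metric" "\<eta> \<in> mspace curve_metric" and r: "r \<in> {0..1}"
  have "s + (t - s) * r \<in> {0..1}" using affine_in_Icc[OF assms, of r] assms r by auto
  then show "dist (subcurve s t \<gamma> r) (subcurve s t \<eta> r) \<le> mdist curve_metric \<gamma> \<eta>"
    using mdist_curve_metric_le[OF c, of "mdist curve_metric \<gamma> \<eta>"] r unfolding subcurve_def by auto
qed (rule subcurve_in_space[OF _ assms])

lemma difference_quotient_affine:
  fixes \<gamma> \<eta> :: "real \<Rightarrow> 'a::metric_space"
  assumes "0 < a" and ev: "\<forall>\<^sub>F r' in at r. \<eta> r' = \<gamma> (s + a * r')" and r: "\<eta> r = \<gamma> (s + a * r)"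
    and lim: "((\<lambda>u. dist (\<gamma> u) (\<gamma> (s + a * r)) / \<bar>u - (s + a * r)\<bar>) \<longlongrightarrow> l) (at (s + a * r))"
  shows "((\<lambda>u. dist (\<eta> u) (\<eta> r) / \<bar>u - r\<bar>) \<longlongrightarrow> a * l) (at r)"
proof -
  have "filterlim (\<lambda>r'. s + a * r') (at (s + a * r)) (at r)"
    unfolding filterlim_at
  proof
    show "\<forall>\<^sub>F x in at r. s + a * x \<in> UNIV \<and> s + a * x \<noteq> s + a * r"
      using \<open>0 < a\<close> by (auto simp: eventually_at intro!: exI[of _ 1])
    show "((\<lambda>r'. s + a * r') \<longlongrightarrow> s + a * r) (at r)" by (intro tendsto_intros)
  qed
  from filterlim_compose[OF lim this]
  have "((\<lambda>u. a * (dist (\<gamma> (s + a * u)) (\<gamma> (s + a * r)) / \<bar>(s + a * u) - (s + a * r)\<bar>)) \<longlongrightarrow> a * l) (at r)"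
    by (rule tendsto_mult_left)
  moreover have "\<forall>\<^sub>F u in at r. a * (dist (\<gamma> (s + a * u)) (\<gamma> (s + a * r)) / \<bar>(s + a * u) - (s + a * r)\<bar>)
      = dist (\<eta> u) (\<eta> r) / \<bar>u - r\<bar>"
    using ev
  proof eventually_elim
    case (elim u)
    have "\<bar>(s + a * u) - (s + a * r)\<bar> = a * \<bar>u - r\<bar>"
      using \<open>0 < a\<close> by (simp add: abs_mult right_diff_distrib[symmetric])
    then show ?case using \<open>0 < a\<close> elim r by simp
  qed
  ultimately show ?thesis by (rule Lim_transform_eventually)
qed

lemma metric_derivative_interior:
  assumes "0 < r" "r < 1"
  shows "((\<lambda>u. dist (\<gamma> u) (\<gamma> r) / \<bar>u - r\<bar>) \<longlongrightarrow> l) (at r) \<Longrightarrow> metric_derivative \<gamma> r = l"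
    and "\<not> (\<exists>l. ((\<lambda>u. dist (\<gamma> u) (\<gamma> r) / \<bar>u - r\<bar>) \<longlongrightarrow> l) (at r)) \<Longrightarrow> metric_derivative \<gamma> r = 0"
proof -
  let ?Q = "\<lambda>u. dist (\<gamma> u) (\<gamma> r) / \<bar>u - r\<bar>"
  have *: "at r within {0..1} = at r" using assms by (rule at_within_Icc_at)
  show "metric_derivative \<gamma> r = l" if l: "(?Q \<longlongrightarrow> l) (at r)"
  proof -
    have ex: "\<exists>l. (?Q \<longlongrightarrow> l) (at r)" using l by (rule exI)
    show ?thesis
      unfolding metric_derivative_def * if_P[OF ex] using l by (intro tendsto_Lim) auto
  qed
  show "metric_derivative \<gamma> r = 0" if "\<not> (\<exists>l. (?Q \<longlongrightarrow> l) (at r))"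
    unfolding metric_derivative_def * using that by (rule if_not_P)
qed

text \<open>The default value 0 has to be matched as well, so existence of the limit must transfer
  in both directions. The second direction is the same affine lemma applied to the inverse change of
  parameter. At interior times the limit is two-sided; the end points are null for the integrals to
  come.\<close>

lemma metric_derivative_subcurve:
  assumes "0 \<le> s" "s < t" "t \<le> 1" "0 < r" "r < 1"
  shows "metric_derivative (subcurve s t \<gamma>) r = (t - s) * metric_derivative \<gamma> (s + (t - s) * r)"
proof -
  let ?a = "t - s" and ?\<eta> = "subcurve s t \<gamma>"
  let ?x = "s + ?a * r"
  have a: "0 < ?a" using assms by simp
  have "?a * r < ?a * 1" using assms by (intro mult_strict_left_mono) auto
  moreover have "0 < ?a * r" using assms by (intro mult_pos_pos) auto
  ultimately have x: "s < ?x" "?x < t" by simp_all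
  have r: "?\<eta> r = \<gamma> ?x" using assms by (simp add: subcurve_def)
  have "\<forall>\<^sub>F r' in at r. r' \<in> {0<..<1}" using assms by (intro eventually_at_in_open') auto
  then have ev: "\<forall>\<^sub>F r' in at r. ?\<eta> r' = \<gamma> (s + ?a * r')"
    by eventually_elim (simp add: subcurve_def)
  have inv: "- s / ?a + 1 / ?a * u = (u - s) / ?a" for u by (simp add: diff_divide_distrib)
  have "\<forall>\<^sub>F u in at ?x. u \<in> {s<..<t}" using x by (intro eventually_at_in_open') auto
  then have ev': "\<forall>\<^sub>F u in at ?x. \<gamma> u = ?\<eta> (- s / ?a + 1 / ?a * u)"
  proof eventually_elim
    case (elim u)
    then have "(u - s) / ?a \<in> {0..1}" using a by (simp add: pos_divide_le_eq)
    then show ?case unfolding inv using a by (simp add: subcurve_def)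
  qed
  have xr: "- s / ?a + 1 / ?a * ?x = r" unfolding inv using a by simp
  let ?Q = "\<lambda>u. dist (\<gamma> u) (\<gamma> ?x) / \<bar>u - ?x\<bar>" and ?R = "\<lambda>u. dist (?\<eta> u) (?\<eta> r) / \<bar>u - r\<bar>"
  have 1: "(?R \<longlongrightarrow> ?a * l) (at r)" if "(?Q \<longlongrightarrow> l) (at ?x)" for l
    by (rule difference_quotient_affine[OF a ev r that])
  have 2: "(?Q \<longlongrightarrow> 1 / ?a * l) (at ?x)" if "(?R \<longlongrightarrow> l) (at r)" for l
    by (rule difference_quotient_affine[where \<gamma>="?\<eta>" and \<eta>=\<gamma> and s="- s / ?a" and a="1 / ?a" and r="?x",
            unfolded xr, OF _ ev' _ that])
      (use a r in simp_all)
  have x01: "0 < ?x" "?x < 1" using x assms by linarith+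
  show ?thesis
  proof (cases "\<exists>l. (?Q \<longlongrightarrow> l) (at ?x)")
    case True
    then obtain l where l: "(?Q \<longlongrightarrow> l) (at ?x)" by (rule exE)
    show ?thesis
      unfolding metric_derivative_interior(1)[OF x01 l] by (rule metric_derivative_interior(1)[OF assms(4,5) 1[OF l]])
  next
    case False
    then have "\<not> (\<exists>l. (?R \<longlongrightarrow> l) (at r))" using 2 by (blast intro: exI)
    then show ?thesis
      unfolding metric_derivative_interior(2)[OF x01 False] mult_zero_right
      by (rule metric_derivative_interior(2)[OF assms(4,5)])
  qed
qed

lemma nn_integral_affine_Icc:
  fixes s t :: real
  assumes st: "0 \<le> s" "s < t" "t \<le> 1" and w: "w \<in> borel_measurable borel"
  shows "(\<integral>\<^sup>+r\<in>{s..t}. w r \<partial>lborel) = ennreal (t - s) * (\<integral>\<^sup>+r\<in>{0..1}. w (s + (t - s) * r) \<partial>lborel)"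
proof -
  have "(\<integral>\<^sup>+r\<in>{s..t}. w r \<partial>lborel)
      = ennreal \<bar>t - s\<bar> * (\<integral>\<^sup>+r. w (s + (t - s) * r) * indicator {s..t} (s + (t - s) * r) \<partial>lborel)"
    using st w by (intro nn_integral_real_affine) auto
  also have "(\<lambda>r. indicator {s..t} (s + (t - s) * r)) = (indicator {0..1} :: real \<Rightarrow> ennreal)"
    using affine_in_Icc[OF st] by (intro ext) (auto simp: indicator_def)
  then have "(\<integral>\<^sup>+r. w (s + (t - s) * r) * indicator {s..t} (s + (t - s) * r) \<partial>lborel)
      = (\<integral>\<^sup>+r\<in>{0..1}. w (s + (t - s) * r) \<partial>lborel)" by (simp add: fun_eq_iff)
  finally show ?thesis using st by simp
qed

lemma AE_interior_Icc: "AE r in lborel. r \<in> {0..1} \<longrightarrow> (0::real) < r \<and> r < 1"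
proof -
  have "AE r in lborel. r \<noteq> (0::real)" "AE r in lborel. r \<noteq> (1::real)" by (rule AE_lborel_singleton)+
  then show ?thesis by eventually_elim auto
qed

lemma clamp01_affine:
  assumes "0 \<le> s" "s < t" "t \<le> 1" "r \<in> {0..1}"
  shows "clamp01 (s + (t - s) * r) = s + (t - s) * r"
  using affine_in_Icc[OF assms(1-3), of r] assms by auto

text \<open>The speed of the rescaled curve carries a factor \<open>t - s\<close>, which is the
  Jacobian of the affine substitution; the integrands agree off the end points.\<close>

lemma path_integral_subcurve:
  fixes \<gamma> :: "real \<Rightarrow> 'a::polish_space"
  assumes \<gamma>: "\<gamma> \<in> space curve_borel" and st: "0 \<le> s" "s < t" "t \<le> 1" and G: "G \<in> borel_measurable borel"
  shows "path_integral G (subcurve s t \<gamma>) 0 1 = path_integral G \<gamma> s t"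
proof -
  have "path_integral G \<gamma> s t = speed_integral G \<gamma> {s..t}"
    using st by (intro path_integral_eq) auto
  also have "\<dots> = ennreal (t - s) * (\<integral>\<^sup>+r\<in>{0..1}. speed_integrand G \<gamma> (s + (t - s) * r) \<partial>lborel)"
    by (rule nn_integral_affine_Icc[OF st measurable_speed_integrand[OF \<gamma> G]])
  also have "\<dots> = (\<integral>\<^sup>+r. ennreal (t - s) * (speed_integrand G \<gamma> (s + (t - s) * r) * indicator {0..1} r) \<partial>lborel)"
  proof (rule nn_integral_cmult[symmetric])
    note [measurable] = measurable_speed_integrand[OF \<gamma> G]
    show "(\<lambda>r. speed_integrand G \<gamma> (s + (t - s) * r) * indicator {0..1} r) \<in> borel_measurable lborel"
      by measurable
  qed
  also have "\<dots> = path_integral G (subcurve s t \<gamma>) 0 1"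
    unfolding path_integral_def
  proof (rule nn_integral_cong_AE)
    from AE_interior_Icc show "AE r in lborel. ennreal (t - s) * (speed_integrand G \<gamma> (s + (t - s) * r) * indicator {0..1} r)
      = G (subcurve s t \<gamma> r) * ennreal (metric_derivative (subcurve s t \<gamma>) r) * indicator {0..1} r"
    proof eventually_elim
      case (elim r)
      show ?case
      proof (cases "r \<in> {0..1}")
        case True
        then have "metric_derivative (subcurve s t \<gamma>) r = (t - s) * metric_derivative \<gamma> (s + (t - s) * r)"
          using elim st by (intro metric_derivative_subcurve) auto
        moreover have "subcurve s t \<gamma> r = \<gamma> (s + (t - s) * r)" using True by (simp add: subcurve_def)
        ultimately show ?thesis
          unfolding speed_integrand_def clamp01_affine[OF st True]
          using st by (simp add: ennreal_mult' mult_ac)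
      qed simp
    qed
  qed
  finally show ?thesis ..
qed

text \<open>The squared speed carries the square of \<open>t - s\<close>; the substitution absorbs
  one factor, and the other is at most 1.\<close>

lemma energy_subcurve:
  fixes \<gamma> :: "real \<Rightarrow> 'a::polish_space"
  assumes \<gamma>: "\<gamma> \<in> space curve_borel" and st: "0 \<le> s" "s < t" "t \<le> 1"
  shows "energy (subcurve s t \<gamma>) \<le> energy \<gamma>"
proof -
  let ?w = "\<lambda>r. ennreal ((metric_derivative \<gamma> (clamp01 r))\<^sup>2)"
  have [measurable]: "(\<lambda>r. metric_derivative \<gamma> (clamp01 r)) \<in> borel_measurable borel"
    using measurable_clamped_pair(2)[of "\<lambda>r. \<gamma>" borel "\<lambda>r. r"] \<gamma> by simp
  have "energy (subcurve s t \<gamma>) \<le> (\<integral>\<^sup>+r. ennreal (t - s) * (?w (s + (t - s) * r) * indicator {0..1} r) \<partial>lborel)"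
    unfolding energy_def
  proof (rule nn_integral_mono_AE)
    from AE_interior_Icc show "AE r in lborel. ennreal ((metric_derivative (subcurve s t \<gamma>) r)\<^sup>2) * indicator {0..1} r
      \<le> ennreal (t - s) * (?w (s + (t - s) * r) * indicator {0..1} r)"
    proof eventually_elim
      case (elim r)
      show ?case
      proof (cases "r \<in> {0..1}")
        case True
        then have md: "metric_derivative (subcurve s t \<gamma>) r = (t - s) * metric_derivative \<gamma> (s + (t - s) * r)"
          using elim st by (intro metric_derivative_subcurve) auto
        have "(t - s)\<^sup>2 \<le> (t - s)" using st by (simp add: power2_eq_square mult_left_le)
        then have "(metric_derivative (subcurve s t \<gamma>) r)\<^sup>2 \<le> (t - s) * (metric_derivative \<gamma> (s + (t - s) * r))\<^sup>2"
          unfolding md power_mult_distrib by (rule mult_right_mono) simp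
        then show ?thesis
          unfolding clamp01_affine[OF st True] using True st
          by (simp add: ennreal_mult'[symmetric] ennreal_leI)
      qed simp
    qed
  qed
  also have "\<dots> = ennreal (t - s) * (\<integral>\<^sup>+r\<in>{0..1}. ?w (s + (t - s) * r) \<partial>lborel)"
    by (rule nn_integral_cmult) measurable
  also have "\<dots> = (\<integral>\<^sup>+r\<in>{s..t}. ?w r \<partial>lborel)"
    by (rule nn_integral_affine_Icc[OF st, symmetric]) measurable
  also have "\<dots> \<le> energy \<gamma>"
    unfolding energy_eq using st by (intro nn_integral_mono) (auto simp: indicator_def)
  finally show ?thesis .
qed

lemma AC_subcurve:
  assumes "\<gamma> \<in> AC" and st: "0 \<le> s" "s < t" "t \<le> 1"
  shows "subcurve s t \<gamma> \<in> AC"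
proof -
  obtain h :: "real \<Rightarrow> real" where h: "set_integrable lborel {0..1} h"
    and le: "\<And>s t. 0 \<le> s \<Longrightarrow> s \<le> t \<Longrightarrow> t \<le> 1 \<Longrightarrow> dist (\<gamma> s) (\<gamma> t) \<le> (LBINT r:{s..t}. h r)"
    using assms(1) unfolding AC_def by blast
  let ?a = "t - s"
  have a: "?a > 0" using st by simp
  have int: "integrable lborel (\<lambda>r. indicator {s..t} r * h r)"
    using set_integrable_subset[OF h, of "{s..t}"] st unfolding set_integrable_def by auto
  have ind: "indicator {s + ?a * p..s + ?a * q} (s + ?a * r) = (indicator {p..q} r :: real)" for p q r
    using a by (simp add: indicator_def)
  show ?thesis
    unfolding AC_def
  proof (intro CollectI exI[of _ "\<lambda>r. ?a * h (s + ?a * r)"] conjI allI impI)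
    have "integrable lborel (\<lambda>r. ?a * (indicator {s..t} (s + ?a * r) * h (s + ?a * r)))"
      using lborel_integrable_real_affine[OF int, of ?a s] a by (intro integrable_mult_right) auto
    then show "set_integrable lborel {0..1} (\<lambda>r. ?a * h (s + ?a * r))"
      unfolding set_integrable_def using ind[of 0 1] by (simp add: mult_ac)
    fix p q :: real assume pq: "0 \<le> p" "p \<le> q" "q \<le> 1"
    have 1: "s + ?a * p \<le> s + ?a * q" using pq a by simp
    have 2: "s + ?a * p \<in> {s..t}" "s + ?a * q \<in> {s..t}" using pq affine_in_Icc[OF st] by auto
    have "dist (subcurve s t \<gamma> p) (subcurve s t \<gamma> q) = dist (\<gamma> (s + ?a * p)) (\<gamma> (s + ?a * q))"
      using pq by (simp add: subcurve_def)
    also have "\<dots> \<le> (LBINT r:{s + ?a * p..s + ?a * q}. h r)"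
      using 2 st by (intro le 1) auto
    also have "\<dots> = \<bar>?a\<bar> *\<^sub>R (LINT r|lborel. indicator {s + ?a * p..s + ?a * q} (s + ?a * r) *\<^sub>R h (s + ?a * r))"
      unfolding set_lebesgue_integral_def using a by (intro lborel_integral_real_affine) auto
    also have "\<dots> = (LBINT r:{p..q}. ?a * h (s + ?a * r))"
      unfolding set_lebesgue_integral_def ind using a by (simp add: mult.left_commute)
    finally show "dist (subcurve s t \<gamma> p) (subcurve s t \<gamma> q) \<le> (LBINT r:{p..q}. ?a * h (s + ?a * r))" .
  qed
qed

section \<open>Test plans, conditioned on a set of curves and restricted to a subinterval\<close>

lemma test_plan2D:
  assumes "test_plan2 n \<pi>"
  shows "prob_space \<pi>" "sets \<pi> = sets curve_borel" "space \<pi> = space curve_borel" "AE \<gamma> in \<pi>. \<gamma> \<in> AC2"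
    "(\<integral>\<^sup>+\<gamma>. energy \<gamma> \<partial>\<pi>) < \<infinity>"
  using assms unfolding test_plan2_def energy_def by auto

lemma emeasure_evaluation:
  assumes "sets \<pi> = sets curve_borel" "t \<in> {0..1}" "A \<in> sets borel"
  shows "emeasure (distr \<pi> borel (\<lambda>\<gamma>. \<gamma> t)) A = emeasure \<pi> {\<gamma> \<in> space \<pi>. \<gamma> t \<in> A}"
proof -
  have "(\<lambda>\<gamma>. \<gamma> t) \<in> \<pi> \<rightarrow>\<^sub>M borel"
    using measurable_evaluation[OF assms(2)] measurable_cong_sets[OF assms(1) refl] by blast
  then show ?thesis using assms(3) by (subst emeasure_distr) (auto intro!: arg_cong2[where f=emeasure])
qed

lemma test_plan2_bound:
  assumes "test_plan2 n \<pi>"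
  obtains C where "C \<ge> 0" "\<And>t A. t \<in> {0..1} \<Longrightarrow> A \<in> sets borel \<Longrightarrow>
    emeasure \<pi> {\<gamma> \<in> space \<pi>. \<gamma> t \<in> A} \<le> ennreal C * emeasure n A"
proof -
  obtain C where "C \<ge> 0" and C: "\<And>t A. t \<in> {0..1} \<Longrightarrow> A \<in> sets borel \<Longrightarrow>
      emeasure (distr \<pi> borel (\<lambda>\<gamma>. \<gamma> t)) A \<le> ennreal C * emeasure n A"
    using assms unfolding test_plan2_def by blast
  show ?thesis
  proof (rule that[OF \<open>C \<ge> 0\<close>])
    fix t :: real and A :: "'a set" assume tA: "t \<in> {0..1}" "A \<in> sets borel"
    show "emeasure \<pi> {\<gamma> \<in> space \<pi>. \<gamma> t \<in> A} \<le> ennreal C * emeasure n A"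
      using C[OF tA] unfolding emeasure_evaluation[OF test_plan2D(2)[OF assms] tA] .
  qed
qed

text \<open>The plan is conditioned on \<open>E\<close> and its curves are cut down to
  \<open>{s..t}\<close>. Conditioning divides by the mass of \<open>E\<close>, which enters the
  constant. Since only curves in \<open>E\<close> at times in \<open>{s..t}\<close> matter, the
  bound may be taken with respect to another measure \<open>n'\<close>; this is how plans relative
  to \<open>m\<close> turn into plans relative to \<rho>.\<close>

lemma test_plan2_subplan:
  fixes \<pi> :: "(real \<Rightarrow> 'a::polish_space) measure"
  assumes \<pi>: "test_plan2 n \<pi>" and E: "emeasure \<pi> E \<noteq> 0" and st: "0 \<le> s" "s < t" "t \<le> 1"
    and C: "C \<ge> 0" "\<And>r A. r \<in> {s..t} \<Longrightarrow> A \<in> sets borel \<Longrightarrow> emeasure \<pi> {\<gamma> \<in> E. \<gamma> r \<in> A} \<le> ennreal C * emeasure n' A"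
  shows "test_plan2 n' (distr (uniform_measure \<pi> E) curve_borel (subcurve s t))"
proof -
  note D = test_plan2D[OF \<pi>]
  interpret prob_space \<pi> by (rule D)
  \<comment> \<open>Sets outside the \<sigma>-algebra have \<open>emeasure\<close> 0, so nonzero
    mass already implies measurability.\<close>
  have E_sets: "E \<in> sets \<pi>" using E by (metis emeasure_notin_sets)
  define \<pi>' where "\<pi>' = uniform_measure \<pi> E"
  have prob': "prob_space \<pi>'" unfolding \<pi>'_def using E by (intro prob_space_uniform_measure) auto
  have sets': "sets \<pi>' = sets curve_borel" unfolding \<pi>'_def using D by simp
  have space': "space \<pi>' = space curve_borel" unfolding \<pi>'_def using D by simp
  have R [measurable]: "subcurve s t \<in> \<pi>' \<rightarrow>\<^sub>M curve_borel"
    using measurable_subcurve[OF st] measurable_cong_sets[OF sets' refl] by blast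
  note [measurable] = measurable_energy measurable_AC2
  let ?\<sigma> = "distr \<pi>' curve_borel (subcurve s t)"
  have AE': "AE \<gamma> in \<pi>'. P \<gamma>" if "AE \<gamma> in \<pi>. P \<gamma>" for P
    unfolding \<pi>'_def by (rule AE_uniform_measureI[OF E_sets]) (use that in auto)
  show ?thesis
    unfolding test_plan2_def \<pi>'_def[symmetric] energy_def[symmetric]
  proof (intro conjI)
    show "prob_space ?\<sigma>" by (rule prob_space.prob_space_distr[OF prob' R])
    have "AE \<gamma> in \<pi>'. subcurve s t \<gamma> \<in> AC2"
      using AE'[OF D(4)] AE_space
    proof eventually_elim
      case (elim \<gamma>)
      have "energy (subcurve s t \<gamma>) \<le> energy \<gamma>"
        using elim space' by (intro energy_subcurve[OF _ st]) auto
      then show ?case using elim(1) AC_subcurve[OF _ st] unfolding AC2_def energy_def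
        by (auto intro: le_less_trans)
    qed
    \<comment> \<open>The transfer to the image measure uses that \<open>AC2\<close> is a Borel set
      of curves.\<close>
    then show "AE \<gamma> in ?\<sigma>. \<gamma> \<in> AC2" by (subst AE_distr_iff[OF R]) auto
    have "(\<integral>\<^sup>+\<gamma>. energy \<gamma> \<partial>?\<sigma>) = (\<integral>\<^sup>+\<gamma>. energy (subcurve s t \<gamma>) \<partial>\<pi>')"
      by (rule nn_integral_distr) auto
    also have "\<dots> \<le> (\<integral>\<^sup>+\<gamma>. energy \<gamma> \<partial>\<pi>')"
      using space' by (intro nn_integral_mono energy_subcurve[OF _ st]) auto
    also have "\<dots> = (\<integral>\<^sup>+\<gamma>\<in>E. energy \<gamma> \<partial>\<pi>) / emeasure \<pi> E"
      unfolding \<pi>'_def using E_sets measurable_energy measurable_cong_sets[OF D(2) refl]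
      by (intro nn_integral_uniform_measure) blast+
    also have "\<dots> < \<infinity>"
    proof -
      have "(\<integral>\<^sup>+\<gamma>\<in>E. energy \<gamma> \<partial>\<pi>) \<le> (\<integral>\<^sup>+\<gamma>. energy \<gamma> \<partial>\<pi>)"
        by (rule nn_integral_mono) (auto simp: indicator_def)
      then have "(\<integral>\<^sup>+\<gamma>\<in>E. energy \<gamma> \<partial>\<pi>) < \<infinity>" using D(5) by (rule le_less_trans)
      then show ?thesis using E by (simp add: ennreal_divide_eq_top_iff less_top[symmetric])
    qed
    finally show "(\<integral>\<^sup>+\<gamma>. energy \<gamma> \<partial>?\<sigma>) < \<infinity>" .
    have fin: "1 / emeasure \<pi> E < \<infinity>" using E by (simp add: ennreal_divide_eq_top_iff less_top[symmetric])
    define C' where "C' = enn2real (1 / emeasure \<pi> E) * C"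
    show "\<exists>C\<ge>0. \<forall>r\<in>{0..1}. \<forall>A\<in>sets borel. emeasure (distr ?\<sigma> borel (\<lambda>\<gamma>. \<gamma> r)) A \<le> ennreal C * emeasure n' A"
    proof (intro exI[of _ C'] conjI ballI)
      show "C' \<ge> 0" unfolding C'_def using C by simp
      fix r :: real and A :: "'a set" assume r: "r \<in> {0..1}" and A: "A \<in> sets borel"
      let ?x = "s + (t - s) * r"
      have x: "?x \<in> {s..t}" using affine_in_Icc[OF st] r by blast
      have m: "{\<gamma> \<in> space curve_borel. \<gamma> u \<in> A} \<in> sets curve_borel" if "u \<in> {0..1}" for u
        using measurable_sets[OF measurable_evaluation[OF that] A] by (simp add: vimage_def Int_def conj_commute)
      have "emeasure (distr ?\<sigma> borel (\<lambda>\<gamma>. \<gamma> r)) A = emeasure ?\<sigma> {\<gamma> \<in> space curve_borel. \<gamma> r \<in> A}"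
        using emeasure_evaluation[of ?\<sigma> r A] r A by simp
      also have "\<dots> = emeasure \<pi>' {\<gamma> \<in> space curve_borel. subcurve s t \<gamma> r \<in> A}"
        using m[OF r] measurable_space[OF R] space'
        by (subst emeasure_distr[OF R]) (auto intro!: arg_cong2[where f=emeasure])
      also have "\<dots> = emeasure \<pi>' {\<gamma> \<in> space curve_borel. \<gamma> ?x \<in> A}"
        using r by (simp add: subcurve_def)
      also have "\<dots> = emeasure \<pi> (E \<inter> {\<gamma> \<in> space curve_borel. \<gamma> ?x \<in> A}) / emeasure \<pi> E"
        unfolding \<pi>'_def using E_sets m[of ?x] x st D(2) by (intro emeasure_uniform_measure) auto
      also have "E \<inter> {\<gamma> \<in> space curve_borel. \<gamma> ?x \<in> A} = {\<gamma> \<in> E. \<gamma> ?x \<in> A}"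
        using sets.sets_into_space[OF E_sets] D(3) by auto
      also have "emeasure \<pi> {\<gamma> \<in> E. \<gamma> ?x \<in> A} / emeasure \<pi> E \<le> ennreal C * emeasure n' A / emeasure \<pi> E"
        by (rule divide_right_mono_ennreal[OF C(2)[OF x A]])
      also have "\<dots> = (1 / emeasure \<pi> E) * (ennreal C * emeasure n' A)"
        by (simp add: divide_ennreal_def mult_ac)
      also have "\<dots> = ennreal C' * emeasure n' A"
        unfolding C'_def using fin C(1) by (simp add: ennreal_mult mult_ac less_top)
      finally show "emeasure (distr ?\<sigma> borel (\<lambda>\<gamma>. \<gamma> r)) A \<le> ennreal C' * emeasure n' A" .
    qed
  qed (auto)
qed

lemma weak_upper_gradient2D:
  assumes "weak_upper_gradient2 n f G"
  shows "f \<in> borel_measurable borel" "G \<in> borel_measurable borel"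
    and "test_plan2 n \<pi> \<Longrightarrow> AE \<gamma> in \<pi>. upper_gradient_along f G \<gamma>"
  using assms unfolding weak_upper_gradient2_def path_integral_def by auto

lemma weak_upper_gradient2I:
  assumes "f \<in> borel_measurable borel" "G \<in> borel_measurable borel"
    and "\<And>\<pi>. test_plan2 n \<pi> \<Longrightarrow> AE \<gamma> in \<pi>. upper_gradient_along f G \<gamma>"
  shows "weak_upper_gradient2 n f G"
  using assms unfolding weak_upper_gradient2_def path_integral_def by auto

text \<open>The definition tests only the end points of curves; applied to the restricted plan it
  tests \<open>s\<close> and \<open>t\<close>. If \<open>E\<close> is null there is nothing to
  prove, otherwise conditioning is possible.\<close>

lemma weak_upper_gradient2_increment_on:
  fixes f :: "'a::polish_space \<Rightarrow> real"
  assumes wug: "weak_upper_gradient2 n' f G" and \<pi>: "test_plan2 n \<pi>" and E_sets: "E \<in> sets \<pi>"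
    and st: "0 \<le> s" "s < t" "t \<le> 1"
    and C: "C \<ge> 0" "\<And>r A. r \<in> {s..t} \<Longrightarrow> A \<in> sets borel \<Longrightarrow> emeasure \<pi> {\<gamma> \<in> E. \<gamma> r \<in> A} \<le> ennreal C * emeasure n' A"
  shows "AE \<gamma> in \<pi>. \<gamma> \<in> E \<longrightarrow> ennreal \<bar>f (\<gamma> t) - f (\<gamma> s)\<bar> \<le> path_integral G \<gamma> s t"
proof (cases "emeasure \<pi> E = 0")
  case True
  then have "AE \<gamma> in \<pi>. \<gamma> \<notin> E" using E_sets by (intro AE_not_in) auto
  then show ?thesis by eventually_elim auto
next
  case False
  note D = test_plan2D[OF \<pi>] and W = weak_upper_gradient2D[OF wug]
  interpret prob_space \<pi> by (rule D)
  have R: "subcurve s t \<in> uniform_measure \<pi> E \<rightarrow>\<^sub>M curve_borel"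
    by (subst measurable_cong_sets[OF _ refl, of _ curve_borel])
      (use D(2) measurable_subcurve[OF st] in auto)
  note [measurable] = W(1,2) measurable_evaluation[of 0, simplified] measurable_evaluation[of 1, simplified]
    measurable_path_integral[OF W(2), of 0 1, simplified]
  have plan: "test_plan2 n' (distr (uniform_measure \<pi> E) curve_borel (subcurve s t))"
    by (rule test_plan2_subplan[OF \<pi> False st C(1)]) (rule C(2))
  have "AE \<gamma> in distr (uniform_measure \<pi> E) curve_borel (subcurve s t).
      ennreal \<bar>f (\<gamma> 1) - f (\<gamma> 0)\<bar> \<le> path_integral G \<gamma> 0 1"
    using W(3)[OF plan] by eventually_elim auto
  then have "AE \<gamma> in uniform_measure \<pi> E. ennreal \<bar>f (subcurve s t \<gamma> 1) - f (subcurve s t \<gamma> 0)\<bar>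
      \<le> path_integral G (subcurve s t \<gamma>) 0 1"
    by (subst (asm) AE_distr_iff[OF R]) measurable
  then have "AE \<gamma> in \<pi>. \<gamma> \<in> E \<longrightarrow> ennreal \<bar>f (subcurve s t \<gamma> 1) - f (subcurve s t \<gamma> 0)\<bar>
      \<le> path_integral G (subcurve s t \<gamma>) 0 1"
  proof (subst (asm) AE_uniform_measure)
    show "emeasure \<pi> E < \<infinity>" using emeasure_finite[of E] by (simp add: less_top[symmetric])
  qed (rule False)
  then show ?thesis
    using AE_space
  proof eventually_elim
    case (elim \<gamma>)
    then have "path_integral G (subcurve s t \<gamma>) 0 1 = path_integral G \<gamma> s t"
      using D(3) by (intro path_integral_subcurve[OF _ st W(2)]) auto
    with elim show ?case by (simp add: subcurve_def)
  qed
qed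

lemma weak_upper_gradient2_increment:
  fixes f :: "'a::polish_space \<Rightarrow> real"
  assumes wug: "weak_upper_gradient2 n f G" and \<pi>: "test_plan2 n \<pi>" and st: "0 \<le> s" "s < t" "t \<le> 1"
  shows "AE \<gamma> in \<pi>. ennreal \<bar>f (\<gamma> t) - f (\<gamma> s)\<bar> \<le> path_integral G \<gamma> s t"
proof -
  obtain C where C: "C \<ge> 0" "\<And>t A. t \<in> {0..1} \<Longrightarrow> A \<in> sets borel \<Longrightarrow>
    emeasure \<pi> {\<gamma> \<in> space \<pi>. \<gamma> t \<in> A} \<le> ennreal C * emeasure n A"
    using test_plan2_bound[OF \<pi>] by blast
  have "AE \<gamma> in \<pi>. \<gamma> \<in> space \<pi> \<longrightarrow> ennreal \<bar>f (\<gamma> t) - f (\<gamma> s)\<bar> \<le> path_integral G \<gamma> s t"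
    by (rule weak_upper_gradient2_increment_on[OF wug \<pi> sets.top st C(1)]) (use C(2) st in auto)
  then show ?thesis using AE_space by eventually_elim auto
qed

subsection \<open>Increments along dyadic subdivisions\<close>

lemma dyadic_telescope:
  fixes F :: "real \<Rightarrow> real"
  shows "ennreal \<bar>F 1 - F 0\<bar> \<le> (\<Sum>i<2 ^ n. ennreal (jump F n i))"
proof -
  have "F 1 - F 0 = (\<Sum>i<2 ^ n. F (real (Suc i) / 2 ^ n) - F (real i / 2 ^ n))"
    using sum_lessThan_telescope[of "\<lambda>i. F (real i / 2 ^ n)" "2 ^ n"] by simp
  also have "\<bar>\<dots>\<bar> \<le> (\<Sum>i<2 ^ n. jump F n i)"
    by (rule sum_abs)
  finally show ?thesis by (subst sum_ennreal) (auto intro: ennreal_leI)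
qed

text \<open>At level \<open>n\<close>, the increments are bounded by \<open>v\<close> on the pieces
  in \<open>A n\<close> and by \<open>u\<close> on the others. The accepted pieces grow with
  \<open>n\<close>, so the region where \<open>u\<close> is used shrinks to the complement of their
  union.\<close>

lemma dyadic_gluing:
  fixes F :: "real \<Rightarrow> real" and u v :: "real \<Rightarrow> ennreal"
  assumes [measurable]: "u \<in> borel_measurable borel" "v \<in> borel_measurable borel"
    and inc_u: "\<And>n i. i < 2 ^ n \<Longrightarrow> ennreal (jump F n i) \<le> dyadic_integral u n i"
    and inc_v: "\<And>n i. i \<in> A n \<Longrightarrow> ennreal (jump F n i) \<le> dyadic_integral v n i"
    and mono: "\<And>n. (\<Union>i\<in>A n. dyadic n i) \<subseteq> (\<Union>i\<in>A (Suc n). dyadic (Suc n) i)"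
    and fin: "(\<integral>\<^sup>+r\<in>{0<..1}. u r \<partial>lborel) < \<infinity>"
  shows "ennreal \<bar>F 1 - F 0\<bar> \<le> (\<integral>\<^sup>+r\<in>{0<..1}. (if r \<in> (\<Union>n. \<Union>i\<in>A n. dyadic n i) then v r else u r) \<partial>lborel)"
proof -
  define K where "K n = (\<Union>i\<in>A n. dyadic n i)" for n
  have [measurable]: "K n \<in> sets borel" for n
    unfolding K_def by (intro sets.countable_UN'' countableI_type) simp
  have K_mono: "K n \<subseteq> K (Suc n)" for n unfolding K_def by (rule mono)
  \<comment> \<open>\<open>a\<close> takes the full union at once, for every \<open>n\<close>. Only
    the \<open>u\<close>-part \<open>b n\<close> depends on \<open>n\<close>; it decreases, and its
    integrals converge because \<open>u\<close> has finite integral.\<close>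
  define a where "a r = v r * indicator (\<Union>n. K n) r * indicator {0<..1} r" for r
  define b where "b n r = u r * indicator (- K n) r * indicator {0<..1} r" for n r
  have [measurable]: "a \<in> borel_measurable borel" "b n \<in> borel_measurable borel" for n
    unfolding a_def b_def by measurable
  have step: "ennreal \<bar>F 1 - F 0\<bar> \<le> (\<integral>\<^sup>+r. a r \<partial>lborel) + (\<integral>\<^sup>+r. b n r \<partial>lborel)" for n
  proof -
    define w where "w r = (if r \<in> K n then v r else u r)" for r
    have [measurable]: "w \<in> borel_measurable borel" unfolding w_def by measurable
    have "ennreal \<bar>F 1 - F 0\<bar> \<le> (\<Sum>i<2 ^ n. ennreal (jump F n i))"
      by (rule dyadic_telescope)
    also have "\<dots> \<le> (\<Sum>i<2 ^ n. dyadic_integral w n i)"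
    proof (rule sum_mono)
      fix i assume i: "i \<in> {..<2 ^ n :: nat}"
      show "ennreal (jump F n i) \<le> dyadic_integral w n i"
      proof (cases "i \<in> A n")
        case True
        then have "dyadic_integral w n i = dyadic_integral v n i"
          unfolding w_def K_def by (intro nn_integral_cong) (auto simp: indicator_def)
        then show ?thesis using inc_v[OF True] by simp
      next
        case False
        then have "r \<notin> K n" if "r \<in> dyadic n i" for r
          using dyadic_disjoint[OF that] unfolding K_def by blast
        then have "dyadic_integral w n i = dyadic_integral u n i"
          unfolding w_def by (intro nn_integral_cong) (auto simp: indicator_def)
        then show ?thesis using inc_u[of i n] i by simp
      qed
    qed
    also have "\<dots> = (\<integral>\<^sup>+r\<in>{0<..1}. w r \<partial>lborel)" by (rule nn_integral_dyadic_sum) simp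
    also have "\<dots> \<le> (\<integral>\<^sup>+r. a r + b n r \<partial>lborel)"
      by (rule nn_integral_mono) (auto simp: w_def a_def b_def indicator_def)
    also have "\<dots> = (\<integral>\<^sup>+r. a r \<partial>lborel) + (\<integral>\<^sup>+r. b n r \<partial>lborel)"
      by (rule nn_integral_add) auto
    finally show ?thesis .
  qed
  have "ennreal \<bar>F 1 - F 0\<bar> \<le> (INF n. (\<integral>\<^sup>+r. a r \<partial>lborel) + (\<integral>\<^sup>+r. b n r \<partial>lborel))"
    by (rule INF_greatest) (rule step)
  also have "\<dots> = (\<integral>\<^sup>+r. a r \<partial>lborel) + (INF n. \<integral>\<^sup>+r. b n r \<partial>lborel)" by (rule INF_ennreal_const_add)
  also have "(INF n. \<integral>\<^sup>+r. b n r \<partial>lborel) = (\<integral>\<^sup>+r. (INF n. b n r) \<partial>lborel)"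
  proof (rule nn_integral_monotone_convergence_INF_decseq[symmetric])
    show "decseq b"
      using K_mono by (intro decseq_SucI le_funI) (auto simp: b_def indicator_def)
    have "(\<integral>\<^sup>+r. b 0 r \<partial>lborel) \<le> (\<integral>\<^sup>+r\<in>{0<..1}. u r \<partial>lborel)"
      by (rule nn_integral_mono) (auto simp: b_def indicator_def)
    then show "(\<integral>\<^sup>+r. b 0 r \<partial>lborel) < \<infinity>" using fin by (rule le_less_trans)
  qed simp
  also have "(\<integral>\<^sup>+r. a r \<partial>lborel) + (\<integral>\<^sup>+r. (INF n. b n r) \<partial>lborel) = (\<integral>\<^sup>+r. a r + (INF n. b n r) \<partial>lborel)"
    by (rule nn_integral_add[symmetric]) auto
  also have "\<dots> \<le> (\<integral>\<^sup>+r\<in>{0<..1}. (if r \<in> (\<Union>n. K n) then v r else u r) \<partial>lborel)"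
  proof (rule nn_integral_mono)
    fix r
    show "a r + (INF n. b n r) \<le> (if r \<in> (\<Union>n. K n) then v r else u r) * indicator {0<..1} r"
    proof (cases "r \<in> (\<Union>n. K n)")
      case True
      then obtain n where "r \<in> K n" by blast
      then have "b n r = 0" by (simp add: b_def)
      then have "(INF n. b n r) = 0" by (metis INF_lower UNIV_I le_zero_eq)
      then show ?thesis using True by (simp add: a_def)
    next
      case False
      have "(INF n. b n r) \<le> b 0 r" by (rule INF_lower) simp
      moreover have "b 0 r \<le> u r * indicator {0<..1} r" by (auto simp: b_def indicator_def)
      moreover have "a r = 0" using False by (simp add: a_def)
      ultimately show ?thesis unfolding if_not_P[OF False] by simp
    qed
  qed
  finally show ?thesis unfolding K_def .
qed

text \<open>Where \<open>v\<close> is the smaller function, on \<open>B\<close>, one wants to use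
  \<open>v\<close>, and \<open>u\<close> elsewhere. As \<open>B\<close> is only a Borel set, it is
  enlarged to an open \<open>U\<close>, which dyadic intervals exhaust; outer regularity of the
  finite measure with density \<open>v\<close> makes the cost of \<open>U - B\<close> at most
  \<open>e\<close>.\<close>

lemma dyadic_min:
  fixes F :: "real \<Rightarrow> real" and u v :: "real \<Rightarrow> ennreal"
  assumes [measurable]: "u \<in> borel_measurable borel" "v \<in> borel_measurable borel"
    and inc_u: "\<And>n i. i < 2 ^ n \<Longrightarrow> ennreal (jump F n i) \<le> dyadic_integral u n i"
    and inc_v: "\<And>n i. i < 2 ^ n \<Longrightarrow> ennreal (jump F n i) \<le> dyadic_integral v n i"
    and fin_u: "(\<integral>\<^sup>+r\<in>{0<..1}. u r \<partial>lborel) < \<infinity>"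
    and fin_v: "(\<integral>\<^sup>+r\<in>{0<..1}. v r \<partial>lborel) < \<infinity>"
  shows "ennreal \<bar>F 1 - F 0\<bar> \<le> (\<integral>\<^sup>+r\<in>{0<..1}. min (u r) (v r) \<partial>lborel)"
proof (rule ennreal_le_epsilon)
  fix e :: real assume "e > 0"
  define B where "B = {r \<in> {0<..1}. v r < u r}"
  have [measurable]: "B \<in> sets borel" unfolding B_def by measurable
  define \<nu> where "\<nu> = density lborel (\<lambda>r. v r * indicator {0<..1} r)"
  have sets_nu: "sets \<nu> = sets borel" unfolding \<nu>_def by simp
  have nu: "emeasure \<nu> S = (\<integral>\<^sup>+r\<in>S. v r * indicator {0<..1} r \<partial>lborel)" if "S \<in> sets borel" for S
    unfolding \<nu>_def using that by (subst emeasure_density) auto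
  have fin_nu: "emeasure \<nu> S \<noteq> \<infinity>" if "S \<in> sets borel" for S
  proof -
    have "emeasure \<nu> S \<le> (\<integral>\<^sup>+r\<in>{0<..1}. v r \<partial>lborel)"
      unfolding nu[OF that] by (intro nn_integral_mono) (auto simp: indicator_def)
    then show ?thesis using fin_v by auto
  qed
  have "emeasure \<nu> B = (INF U \<in> {U. B \<subseteq> U \<and> open U}. emeasure \<nu> U)"
    using fin_nu[of UNIV] by (intro outer_regular sets_nu) (auto simp: \<nu>_def)
  moreover have "emeasure \<nu> B < emeasure \<nu> B + ennreal e"
    using \<open>e > 0\<close> fin_nu[of B] by (simp add: less_top ennreal_add_left_cancel_less)
  ultimately have "(INF U \<in> {U. B \<subseteq> U \<and> open U}. emeasure \<nu> U) < emeasure \<nu> B + ennreal e" by simp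
  then obtain U where U: "B \<subseteq> U" "open U" "emeasure \<nu> U < emeasure \<nu> B + ennreal e"
    unfolding INF_less_iff by blast
  have [measurable]: "U \<in> sets borel" using U(2) by simp
  have "emeasure \<nu> U = emeasure \<nu> B + emeasure \<nu> (U - B)"
    using U(1) by (subst plus_emeasure) (auto simp: sets_nu Un_absorb1)
  then have UB: "emeasure \<nu> (U - B) \<le> ennreal e"
    using U(3) fin_nu[of B] by (simp add: less_top ennreal_add_left_cancel_less less_imp_le)
  have "ennreal \<bar>F 1 - F 0\<bar> \<le> (\<integral>\<^sup>+r\<in>{0<..1}. (if r \<in> (\<Union>n. \<Union>i\<in>dyadic_inner U n. dyadic n i) then v r else u r) \<partial>lborel)"
    by (rule dyadic_gluing[OF _ _ inc_u inc_v dyadic_inner_mono fin_u]) (auto simp: dyadic_inner_def)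
  also have "\<dots> \<le> (\<integral>\<^sup>+r. min (u r) (v r) * indicator {0<..1} r + v r * indicator {0<..1} r * indicator (U - B) r \<partial>lborel)"
    unfolding UN_dyadic_inner[OF U(2)]
  proof (rule nn_integral_mono)
    fix r
    show "(if r \<in> U \<inter> {0<..1} then v r else u r) * indicator {0<..1} r
      \<le> min (u r) (v r) * indicator {0<..1} r + v r * indicator {0<..1} r * indicator (U - B) r"
    proof (cases "r \<in> {0<..1}")
      case True
      then show ?thesis using U(1) by (cases "r \<in> B"; cases "r \<in> U") (auto simp: B_def min_def)
    qed simp
  qed
  also have "\<dots> = (\<integral>\<^sup>+r\<in>{0<..1}. min (u r) (v r) \<partial>lborel) + emeasure \<nu> (U - B)"
    by (subst nn_integral_add) (auto simp: nu)
  also have "\<dots> \<le> (\<integral>\<^sup>+r\<in>{0<..1}. min (u r) (v r) \<partial>lborel) + ennreal e"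
    by (rule add_left_mono[OF UB])
  finally show "ennreal \<bar>F 1 - F 0\<bar> \<le> (\<integral>\<^sup>+r\<in>{0<..1}. min (u r) (v r) \<partial>lborel) + ennreal e" .
qed

section \<open>Dyadic neighbours of a time and the chain rule along a curve\<close>

definition dyadic_lower :: "nat \<Rightarrow> real \<Rightarrow> real" where
  "dyadic_lower n r = (of_int \<lceil>r * 2 ^ n\<rceil> - 1) / 2 ^ n"

definition dyadic_upper :: "nat \<Rightarrow> real \<Rightarrow> real" where
  "dyadic_upper n r = of_int \<lceil>r * 2 ^ n\<rceil> / 2 ^ n"

abbreviation dyadic_hull :: "nat \<Rightarrow> real \<Rightarrow> real set" where
  "dyadic_hull n r \<equiv> {dyadic_lower n r..dyadic_upper n r}"

lemma measurable_dyadic_lower [measurable]: "dyadic_lower n \<in> borel_measurable borel"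
  unfolding dyadic_lower_def by measurable

lemma measurable_dyadic_upper [measurable]: "dyadic_upper n \<in> borel_measurable borel"
  unfolding dyadic_upper_def by measurable

lemma dyadic_lower_upper_eq:
  assumes "r \<in> dyadic n i"
  shows "dyadic_lower n r = real i / 2 ^ n" "dyadic_upper n r = real (Suc i) / 2 ^ n"
  using assms unfolding dyadic_lower_def dyadic_upper_def dyadic_iff by (simp_all add: add.commute)

lemma dyadic_lower_upper:
  "dyadic_lower n r < r" "r \<le> dyadic_upper n r" "dyadic_upper n r - dyadic_lower n r = (1 / 2) ^ n"
  "dyadic_lower n r \<in> \<rat>" "dyadic_upper n r \<in> \<rat>"
proof -
  have "of_int \<lceil>r * 2 ^ n\<rceil> - 1 < r * 2 ^ n" "r * 2 ^ n \<le> of_int \<lceil>r * 2 ^ n\<rceil>" by linarith+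
  then show "dyadic_lower n r < r" "r \<le> dyadic_upper n r"
    unfolding dyadic_lower_def dyadic_upper_def by (auto simp: pos_divide_less_eq pos_le_divide_eq)
  show "dyadic_upper n r - dyadic_lower n r = (1 / 2) ^ n"
    unfolding dyadic_lower_def dyadic_upper_def by (simp add: diff_divide_distrib power_divide)
  show "dyadic_lower n r \<in> \<rat>" "dyadic_upper n r \<in> \<rat>"
    unfolding dyadic_lower_def dyadic_upper_def by auto
qed

lemma dyadic_lower_upper_in:
  assumes "r \<in> {0<..1}"
  shows "dyadic_lower n r \<in> {0..1}" "dyadic_upper n r \<in> {0..1}"
proof -
  obtain i where i: "i < 2 ^ n" "r \<in> dyadic n i" using dyadic_index[OF assms] by blast
  have "real i / 2 ^ n \<le> real (Suc i) / 2 ^ n" by (intro divide_right_mono) auto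
  then show "dyadic_lower n r \<in> {0..1}" "dyadic_upper n r \<in> {0..1}"
    using dyadic_subset(1)[OF i(1)] unfolding dyadic_lower_upper_eq[OF i(2)] by (auto simp del: of_nat_Suc)
qed

text \<open>On each dyadic interval the Lipschitz bound of \<open>\<phi>\<close> is the larger of
  the two end-point values of \<open>\<psi>\<close>. Telescoping gives an integral against the step
  function \<open>m n\<close>, which is at most \<open>c\<close> and converges to
  \<open>\<psi> (F r)\<close>, because the values at the dyadic neighbours of almost every time
  converge. In the applications \<open>\<psi>\<close> is on \<open>S\<close> the derivative of
  \<open>\<phi>\<close>, and monotone there.\<close>

lemma dyadic_chain:
  fixes F :: "real \<Rightarrow> real" and u :: "real \<Rightarrow> ennreal" and \<phi> \<psi> :: "real \<Rightarrow> real"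
  assumes [measurable]: "u \<in> borel_measurable borel" "F \<in> borel_measurable borel" "\<psi> \<in> borel_measurable borel"
    and inc_u: "\<And>n i. i < 2 ^ n \<Longrightarrow> ennreal (jump F n i) \<le> dyadic_integral u n i"
    and fin: "(\<integral>\<^sup>+r\<in>{0<..1}. u r \<partial>lborel) < \<infinity>"
    and S: "\<And>r. r \<in> \<rat> \<inter> {0..1} \<Longrightarrow> F r \<in> S" "AE r in lborel. r \<in> {0<..1} \<longrightarrow> F r \<in> S"
    and \<phi>: "\<And>a b. a \<in> S \<Longrightarrow> b \<in> S \<Longrightarrow> \<bar>\<phi> a - \<phi> b\<bar> \<le> max (\<psi> a) (\<psi> b) * \<bar>a - b\<bar>"
    and \<psi>: "continuous_on S \<psi>" "\<And>a. a \<in> S \<Longrightarrow> 0 \<le> \<psi> a" "\<And>a. a \<in> S \<Longrightarrow> \<psi> a \<le> c"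
    and lim: "AE r in lborel. r \<in> {0<..1} \<longrightarrow>
      (\<lambda>n. F (dyadic_lower n r)) \<longlonglongrightarrow> F r \<and> (\<lambda>n. F (dyadic_upper n r)) \<longlonglongrightarrow> F r"
  shows "ennreal \<bar>\<phi> (F 1) - \<phi> (F 0)\<bar> \<le> (\<integral>\<^sup>+r\<in>{0<..1}. ennreal (\<psi> (F r)) * u r \<partial>lborel)"
proof -
  define m where "m n r = max (\<psi> (F (dyadic_lower n r))) (\<psi> (F (dyadic_upper n r)))" for n r
  have [measurable]: "m n \<in> borel_measurable borel" for n unfolding m_def by measurable
  have lu: "F (dyadic_lower n r) \<in> S" "F (dyadic_upper n r) \<in> S" if "r \<in> {0<..1}" for n r
    using dyadic_lower_upper_in[OF that] dyadic_lower_upper by (auto intro!: S(1))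
  have step: "ennreal \<bar>\<phi> (F 1) - \<phi> (F 0)\<bar> \<le> (\<integral>\<^sup>+r\<in>{0<..1}. ennreal (m n r) * u r \<partial>lborel)" for n
  proof -
    have "ennreal \<bar>\<phi> (F 1) - \<phi> (F 0)\<bar> \<le> (\<Sum>i<2 ^ n. ennreal (jump (\<lambda>r. \<phi> (F r)) n i))"
      by (rule dyadic_telescope[of "\<lambda>r. \<phi> (F r)"])
    also have "\<dots> \<le> (\<Sum>i<2 ^ n. \<integral>\<^sup>+r\<in>dyadic n i. ennreal (m n r) * u r \<partial>lborel)"
    proof (rule sum_mono)
      fix i assume "i \<in> {..<2 ^ n :: nat}"
      then have i: "i < 2 ^ n" by simp
      let ?a = "real i / 2 ^ n" and ?b = "real (Suc i) / 2 ^ n"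
      have "?a \<le> ?b" by (intro divide_right_mono) auto
      then have ab: "?a \<in> \<rat> \<inter> {0..1}" "?b \<in> \<rat> \<inter> {0..1}"
        using dyadic_subset(1)[OF i] by (auto simp del: of_nat_Suc)
      let ?M = "max (\<psi> (F ?b)) (\<psi> (F ?a))"
      have M: "0 \<le> ?M" using \<psi>(2)[OF S(1)[OF ab(1)]] by simp
      have "ennreal \<bar>\<phi> (F ?b) - \<phi> (F ?a)\<bar> \<le> ennreal (?M * \<bar>F ?b - F ?a\<bar>)"
        by (intro ennreal_leI \<phi> S(1) ab)
      also have "\<dots> = ennreal ?M * ennreal \<bar>F ?b - F ?a\<bar>" using M by (rule ennreal_mult) simp
      also have "\<dots> \<le> ennreal ?M * dyadic_integral u n i"
        by (rule mult_left_mono[OF inc_u[OF i]]) simp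
      also have "\<dots> = (\<integral>\<^sup>+r. ennreal ?M * (u r * indicator (dyadic n i) r) \<partial>lborel)"
        by (rule nn_integral_cmult[symmetric]) simp
      also have "\<dots> = (\<integral>\<^sup>+r\<in>dyadic n i. ennreal (m n r) * u r \<partial>lborel)"
      proof (rule nn_integral_cong)
        fix r
        show "ennreal ?M * (u r * indicator (dyadic n i) r) = ennreal (m n r) * u r * indicator (dyadic n i) r"
        proof (cases "r \<in> dyadic n i")
          case True
          then show ?thesis unfolding m_def dyadic_lower_upper_eq[OF True] by (simp add: max.commute)
        qed simp
      qed
      finally show "ennreal \<bar>\<phi> (F ?b) - \<phi> (F ?a)\<bar> \<le> (\<integral>\<^sup>+r\<in>dyadic n i. ennreal (m n r) * u r \<partial>lborel)" .
    qed
    also have "\<dots> = (\<integral>\<^sup>+r\<in>{0<..1}. ennreal (m n r) * u r \<partial>lborel)"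
      by (rule nn_integral_dyadic_sum) simp
    finally show ?thesis .
  qed
  have "(\<lambda>n. \<integral>\<^sup>+r\<in>{0<..1}. ennreal (m n r) * u r \<partial>lborel) \<longlonglongrightarrow> (\<integral>\<^sup>+r\<in>{0<..1}. ennreal (\<psi> (F r)) * u r \<partial>lborel)"
  proof (rule nn_integral_dominated_convergence)
    show "AE r in lborel. ennreal (m n r) * u r * indicator {0<..1} r \<le> ennreal c * (u r * indicator {0<..1} r)" for n
    proof (rule AE_I2)
      fix r
      show "ennreal (m n r) * u r * indicator {0<..1} r \<le> ennreal c * (u r * indicator {0<..1} r)"
      proof (cases "r \<in> {0<..1}")
        case True
        have "m n r \<le> c" using \<psi>(3)[OF lu(1)[OF True]] \<psi>(3)[OF lu(2)[OF True]] unfolding m_def by simp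
        then show ?thesis using True by (simp add: mult_right_mono ennreal_leI)
      qed simp
    qed
    have "(\<integral>\<^sup>+r. ennreal c * (u r * indicator {0<..1} r) \<partial>lborel) = ennreal c * (\<integral>\<^sup>+r\<in>{0<..1}. u r \<partial>lborel)"
      by (rule nn_integral_cmult) simp
    then show "(\<integral>\<^sup>+r. ennreal c * (u r * indicator {0<..1} r) \<partial>lborel) < \<infinity>"
      using fin by (simp add: ennreal_mult_less_top)
    have "AE r in lborel. u r * indicator {0<..1} r \<noteq> \<infinity>"
      by (rule nn_integral_PInf_AE) (use fin in auto)
    with lim S(2) show "AE r in lborel. (\<lambda>n. ennreal (m n r) * u r * indicator {0<..1} r)
        \<longlonglongrightarrow> ennreal (\<psi> (F r)) * u r * indicator {0<..1} r"
    proof eventually_elim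
      case (elim r)
      show ?case
      proof (cases "r \<in> {0<..1}")
        case True
        then have FS: "F r \<in> S" and l1: "(\<lambda>n. F (dyadic_lower n r)) \<longlonglongrightarrow> F r"
          and l2: "(\<lambda>n. F (dyadic_upper n r)) \<longlonglongrightarrow> F r" using elim by auto
        have "(\<lambda>n. m n r) \<longlonglongrightarrow> max (\<psi> (F r)) (\<psi> (F r))"
          unfolding m_def using lu[OF True]
          by (intro tendsto_max continuous_on_tendsto_compose[OF \<psi>(1) l1 FS] continuous_on_tendsto_compose[OF \<psi>(1) l2 FS]) auto
        then have "(\<lambda>n. u r * ennreal (m n r)) \<longlonglongrightarrow> u r * ennreal (\<psi> (F r))"
          using elim(3) True by (intro ennreal_tendsto_cmult tendsto_ennrealI) (auto simp: less_top)
        then show ?thesis using True by (simp add: mult.commute)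
      qed simp
    qed
  qed auto
  then show ?thesis
    by (rule LIMSEQ_le_const) (use step in blast)
qed

text \<open>The hulls shrink to the single point \<open>r\<close>, a null set, and \<open>u\<close>
  is an integrable majorant.\<close>

lemma oscillation_tendsto_0:
  fixes u :: "real \<Rightarrow> ennreal"
  assumes [measurable]: "u \<in> borel_measurable borel" and fin: "(\<integral>\<^sup>+r\<in>{0..1}. u r \<partial>lborel) < \<infinity>"
    and r: "r \<in> {0<..1}"
  shows "(\<lambda>n. \<integral>\<^sup>+x\<in>dyadic_hull n r. u x \<partial>lborel) \<longlonglongrightarrow> 0"
proof -
  have "(\<lambda>n. \<integral>\<^sup>+x\<in>dyadic_hull n r. u x \<partial>lborel) \<longlonglongrightarrow> (\<integral>\<^sup>+(x::real). 0 \<partial>lborel)"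
  proof (rule nn_integral_dominated_convergence[where u'="\<lambda>_. 0" and w="\<lambda>x. u x * indicator {0..1} x"])
    show "AE x in lborel. u x * indicator (dyadic_hull n r) x \<le> u x * indicator {0..1} x" for n
      using dyadic_lower_upper_in[OF r, of n] by (intro AE_I2) (auto simp: indicator_def)
    have "AE x in lborel. x \<noteq> r" by (rule AE_lborel_singleton)
    then show "AE x in lborel. (\<lambda>n. u x * indicator (dyadic_hull n r) x) \<longlonglongrightarrow> 0"
    proof eventually_elim
      case (elim x)
      then obtain N where N: "(1/2) ^ N < \<bar>x - r\<bar>" using real_arch_pow_inv[of "\<bar>x - r\<bar>" "1/2"] by auto
      have "x \<notin> (dyadic_hull n r)" if "n \<ge> N" for n
      proof -
        have "(1/2 :: real) ^ n \<le> (1/2) ^ N" using that by (intro power_decreasing) auto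
        then have "(1/2) ^ n < \<bar>x - r\<bar>" using N by linarith
        then show ?thesis
          using dyadic_lower_upper(1)[of n r] dyadic_lower_upper(2)[of r n] dyadic_lower_upper(3)[of n r]
          unfolding atLeastAtMost_iff by linarith
      qed
      then have "\<forall>\<^sub>F n in sequentially. 0 = u x * indicator (dyadic_hull n r) x"
        unfolding eventually_sequentially by (intro exI[of _ N] allI impI) simp
      then show ?case by (rule Lim_transform_eventually[OF tendsto_const])
    qed
  qed (use fin in auto)
  then show ?thesis by simp
qed

subsection \<open>Almost every curve of a test plan\<close>

lemma measurable_plan:
  assumes "test_plan2 n \<pi>" "f \<in> curve_borel \<rightarrow>\<^sub>M N"
  shows "f \<in> \<pi> \<rightarrow>\<^sub>M N"
  using measurable_cong_sets[OF test_plan2D(2)[OF assms(1)] refl] assms(2) by blast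

lemma measurable_plan_id: "test_plan2 n \<pi> \<Longrightarrow> (\<lambda>\<gamma>. \<gamma>) \<in> \<pi> \<rightarrow>\<^sub>M curve_borel"
  by (rule measurable_plan) auto

lemma AE_plan_commute:
  assumes \<pi>: "test_plan2 n \<pi>"
    and P: "Measurable.pred (\<pi> \<Otimes>\<^sub>M lborel) (\<lambda>x. P (fst x) (snd x :: real))"
    and AE: "\<And>r. AE \<gamma> in \<pi>. P \<gamma> r"
  shows "AE \<gamma> in \<pi>. AE r in lborel. P \<gamma> r"
proof -
  interpret prob_space \<pi> by (rule test_plan2D(1)[OF \<pi>])
  interpret pair_sigma_finite \<pi> lborel ..
  have "{x \<in> space (\<pi> \<Otimes>\<^sub>M lborel). P (fst x) (snd x)} \<in> sets (\<pi> \<Otimes>\<^sub>M lborel)" using P by (rule predE)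
  from AE_commute[OF this] show ?thesis using AE by simp
qed

lemma null_set_plan:
  assumes \<pi>: "test_plan2 n \<pi>" and n: "sets n = sets borel" and N: "N \<in> null_sets n" and t: "t \<in> {0..1}"
  shows "AE \<gamma> in \<pi>. \<gamma> t \<notin> N"
proof -
  obtain C where C: "\<And>t A. t \<in> {0..1} \<Longrightarrow> A \<in> sets borel \<Longrightarrow>
    emeasure \<pi> {\<gamma> \<in> space \<pi>. \<gamma> t \<in> A} \<le> ennreal C * emeasure n A"
    using test_plan2_bound[OF \<pi>] by blast
  have "N \<in> sets borel" "emeasure n N = 0" using N n by auto
  then have "emeasure \<pi> {\<gamma> \<in> space \<pi>. \<gamma> t \<in> N} = 0" using C[OF t, of N] by simp
  moreover have "{\<gamma> \<in> space \<pi>. \<gamma> t \<in> N} \<in> sets \<pi>"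
    using measurable_sets[OF measurable_plan[OF \<pi> measurable_evaluation[OF t]] \<open>N \<in> sets borel\<close>]
    by (simp add: vimage_def Int_def conj_commute)
  ultimately have "{\<gamma> \<in> space \<pi>. \<gamma> t \<in> N} \<in> null_sets \<pi>" by auto
  then show ?thesis by (rule AE_I') auto
qed

lemma AE_plan_at:
  assumes "test_plan2 n \<pi>" "sets n = sets borel" "AE x in n. P x" "t \<in> {0..1}"
  shows "AE \<gamma> in \<pi>. P (\<gamma> t)"
proof -
  obtain N where N: "N \<in> null_sets n" "{x \<in> space n. \<not> P x} \<subseteq> N"
    using assms(3) unfolding eventually_ae_filter by blast
  have sp: "space n = UNIV" using sets_eq_imp_space_eq[OF assms(2)] by simp
  from null_set_plan[OF assms(1,2) N(1) assms(4)] show ?thesis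
  proof eventually_elim
    case (elim \<gamma>)
    then show ?case using N(2) unfolding sp by blast
  qed
qed

lemma AE_plan_time:
  fixes n :: "'a::polish_space measure"
  assumes \<pi>: "test_plan2 n \<pi>" and n: "sets n = sets borel" and P: "AE x in n. P x"
  shows "AE \<gamma> in \<pi>. AE r in lborel. r \<in> {0..1} \<longrightarrow> P (\<gamma> r)"
proof -
  obtain N where N: "N \<in> null_sets n" "{x \<in> space n. \<not> P x} \<subseteq> N"
    using P unfolding eventually_ae_filter by blast
  have sp: "space n = UNIV" using sets_eq_imp_space_eq[OF n] by simp
  have [measurable]: "N \<in> sets borel" using N n by auto
  note [measurable] = measurable_plan_id[OF \<pi>]
  have [measurable]: "(\<lambda>x. (fst x) (clamp01 (snd x))) \<in> borel_measurable (\<pi> \<Otimes>\<^sub>M lborel)"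
    by (rule measurable_clamped_pair) measurable
  have "AE \<gamma> in \<pi>. AE r in lborel. \<gamma> (clamp01 r) \<notin> N"
  proof (rule AE_plan_commute[OF \<pi>])
    show "AE \<gamma> in \<pi>. \<gamma> (clamp01 r) \<notin> N" for r
      by (rule null_set_plan[OF \<pi> n N(1)]) simp
  qed measurable
  then show ?thesis
  proof eventually_elim
    case (elim \<gamma>)
    then show ?case
    proof eventually_elim
      case (elim r)
      show ?case
      proof
        assume "r \<in> {0..1}"
        then have "\<gamma> r \<notin> N" using elim by (simp only: clamp01_id simp_thms)
        then show "P (\<gamma> r)" using N(2) unfolding sp by blast
      qed
    qed
  qed
qed

lemma AE_increments:
  fixes f :: "'a::polish_space \<Rightarrow> real"
  assumes wug: "weak_upper_gradient2 n f G" and \<pi>: "test_plan2 n \<pi>"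
  shows "AE \<gamma> in \<pi>. \<forall>k. \<forall>i\<in>{..<2 ^ k}. ennreal (jump (\<lambda>r. f (\<gamma> r)) k i)
    \<le> speed_integral G \<gamma> (dyadic k i)"
proof -
  have "AE \<gamma> in \<pi>. ennreal (jump (\<lambda>r. f (\<gamma> r)) k i)
    \<le> speed_integral G \<gamma> (dyadic k i)" if "i \<in> {..<2 ^ k}" for i k
  proof -
    have "real i / 2 ^ k < real (Suc i) / 2 ^ k" by (intro divide_strict_right_mono) auto
    then have st: "0 \<le> real i / 2 ^ k" "real i / 2 ^ k < real (Suc i) / 2 ^ k" "real (Suc i) / 2 ^ k \<le> 1"
      using dyadic_subset(1)[of i k] that by (auto simp del: of_nat_Suc)
    show ?thesis
      using weak_upper_gradient2_increment[OF wug \<pi> st] unfolding path_integral_Ioc[OF st(1,3)] dyadic_def .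
  qed
  then have "AE \<gamma> in \<pi>. \<forall>i\<in>{..<2 ^ k}. ennreal (jump (\<lambda>r. f (\<gamma> r)) k i)
    \<le> speed_integral G \<gamma> (dyadic k i)" for k
    by (subst AE_ball_countable) auto
  then show ?thesis by (subst AE_all_countable) auto
qed

lemma AE_path_integral_finite:
  assumes "weak_upper_gradient2 n f G" "test_plan2 n \<pi>"
  shows "AE \<gamma> in \<pi>. path_integral G \<gamma> 0 1 < \<infinity>"
  using weak_upper_gradient2D(3)[OF assms] by eventually_elim auto

text \<open>
  A Borel function with a weak upper gradient need not be continuous along any curve, but at every
  fixed time almost every curve is regular in the following sense; by Fubini's theorem almost every
  curve is then regular at almost every time.
\<close>
definition regular_at :: "('a::metric_space \<Rightarrow> real) \<Rightarrow> ('a \<Rightarrow> ennreal) \<Rightarrow> (real \<Rightarrow> 'a) \<Rightarrow> real \<Rightarrow> bool" where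
  "regular_at f G \<gamma> r \<longleftrightarrow> path_integral G \<gamma> 0 1 < \<infinity> \<and>
    (\<forall>q\<in>\<rat> \<inter> {0..1}. ennreal \<bar>f (\<gamma> q) - f (\<gamma> r)\<bar> \<le> path_integral G \<gamma> (min q r) (max q r))"

text \<open>For fixed \<open>r\<close> there are countably many rational \<open>q\<close>, and each
  pair spans a subinterval to which the increment estimate applies.\<close>

lemma AE_regular_at:
  fixes f :: "'a::polish_space \<Rightarrow> real"
  assumes wug: "weak_upper_gradient2 n f G" and \<pi>: "test_plan2 n \<pi>" and r: "r \<in> {0..1}"
  shows "AE \<gamma> in \<pi>. regular_at f G \<gamma> r"
proof -
  have "AE \<gamma> in \<pi>. ennreal \<bar>f (\<gamma> q) - f (\<gamma> r)\<bar> \<le> path_integral G \<gamma> (min q r) (max q r)"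
    if q: "q \<in> \<rat> \<inter> {0..1}" for q
  proof (cases q r rule: linorder_cases)
    case less
    then show ?thesis
      using weak_upper_gradient2_increment[OF wug \<pi>, of q r] q r by (simp add: abs_minus_commute)
  next
    case greater
    then show ?thesis
      using weak_upper_gradient2_increment[OF wug \<pi>, of r q] q r by simp
  qed simp
  then have "AE \<gamma> in \<pi>. \<forall>q\<in>\<rat> \<inter> {0..1}. ennreal \<bar>f (\<gamma> q) - f (\<gamma> r)\<bar> \<le> path_integral G \<gamma> (min q r) (max q r)"
    by (subst AE_ball_countable) (auto intro: countable_Int1 countable_rat)
  with AE_path_integral_finite[OF wug \<pi>] show ?thesis
    unfolding regular_at_def by eventually_elim auto
qed

lemma regular_at_oscillation:
  assumes reg: "regular_at f G \<gamma> r" and r: "r \<in> {0<..1}"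
    and q: "q \<in> \<rat>" "q \<in> dyadic_hull k r"
  shows "ennreal \<bar>f (\<gamma> q) - f (\<gamma> r)\<bar> \<le> speed_integral G \<gamma> (dyadic_hull k r)"
proof -
  have q01: "q \<in> {0..1}" using q(2) dyadic_lower_upper_in[OF r, of k] by auto
  have "ennreal \<bar>f (\<gamma> q) - f (\<gamma> r)\<bar> \<le> path_integral G \<gamma> (min q r) (max q r)"
    using reg q(1) q01 unfolding regular_at_def by blast
  also have "\<dots> = speed_integral G \<gamma> {min q r..max q r}"
    by (rule path_integral_eq) (use q01 r in auto)
  also have "\<dots> \<le> speed_integral G \<gamma> (dyadic_hull k r)"
  proof (rule nn_integral_mono)
    fix x
    have "{min q r..max q r} \<subseteq> dyadic_hull k r"
      using q(2) dyadic_lower_upper(1)[of k r] dyadic_lower_upper(2)[of r k] by auto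
    then show "speed_integrand G \<gamma> x * indicator {min q r..max q r} x
        \<le> speed_integrand G \<gamma> x * indicator (dyadic_hull k r) x"
      by (intro mult_left_mono indicator_leI) auto
  qed
  finally show ?thesis .
qed

lemma regular_at_oscillation_tendsto:
  fixes \<gamma> :: "real \<Rightarrow> 'a::polish_space"
  assumes \<gamma>: "\<gamma> \<in> space curve_borel" and G: "G \<in> borel_measurable borel"
    and reg: "regular_at f G \<gamma> r" and r: "r \<in> {0<..1}"
  shows "(\<lambda>k. speed_integral G \<gamma> (dyadic_hull k r)) \<longlonglongrightarrow> 0"
proof (rule oscillation_tendsto_0[OF measurable_speed_integrand[OF \<gamma> G] _ r])
  show "speed_integral G \<gamma> {0..1} < \<infinity>"
    using reg unfolding regular_at_def by (simp add: path_integral_eq)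
qed

lemma regular_at_tendsto:
  fixes \<gamma> :: "real \<Rightarrow> 'a::polish_space"
  assumes \<gamma>: "\<gamma> \<in> space curve_borel" and G: "G \<in> borel_measurable borel"
    and reg: "regular_at f G \<gamma> r" and r: "r \<in> {0<..1}"
    and q: "\<And>k. q k \<in> \<rat>" "\<And>k. q k \<in> dyadic_hull k r"
  shows "(\<lambda>k. f (\<gamma> (q k))) \<longlonglongrightarrow> f (\<gamma> r)"
proof -
  have "(\<lambda>k. ennreal \<bar>f (\<gamma> (q k)) - f (\<gamma> r)\<bar>) \<longlonglongrightarrow> ennreal 0"
    unfolding ennreal_0
    by (rule tendsto_sandwich[OF _ _ tendsto_const regular_at_oscillation_tendsto[OF \<gamma> G reg r]])
      (use regular_at_oscillation[OF reg r q] in auto)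
  then have "(\<lambda>k. \<bar>f (\<gamma> (q k)) - f (\<gamma> r)\<bar>) \<longlonglongrightarrow> 0" by (subst (asm) tendsto_ennreal_iff) auto
  then show ?thesis by (subst (asm) tendsto_rabs_zero_iff) (rule LIM_zero_cancel)
qed

text \<open>At a fixed time the limits follow from regularity there; Fubini's theorem exchanges the
  quantifiers. For this purpose convergence is rewritten as the countable condition
  \<open>P\<close>, and times are clamped, so that the predicate is jointly measurable.\<close>

lemma AE_dyadic_limits:
  fixes f :: "'a::polish_space \<Rightarrow> real"
  assumes wug: "weak_upper_gradient2 n f G" and \<pi>: "test_plan2 n \<pi>"
  shows "AE \<gamma> in \<pi>. AE r in lborel. r \<in> {0<..1} \<longrightarrow>
    (\<lambda>k. f (\<gamma> (dyadic_lower k r))) \<longlonglongrightarrow> f (\<gamma> r) \<and> (\<lambda>k. f (\<gamma> (dyadic_upper k r))) \<longlonglongrightarrow> f (\<gamma> r)"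
proof -
  note W = weak_upper_gradient2D[OF wug] and [measurable] = measurable_plan_id[OF \<pi>]
  note [measurable] = W(1)
  define X where "X q \<gamma> r k = f (\<gamma> (clamp01 (q k r)))" for q :: "nat \<Rightarrow> real \<Rightarrow> real" and \<gamma> r k
  define X' where "X' \<gamma> r = f (\<gamma> (clamp01 r))" for \<gamma> r
  define P where "P q \<gamma> r \<longleftrightarrow> (\<forall>m::nat. \<exists>N. \<forall>k\<ge>N. \<bar>X q \<gamma> r k - X' \<gamma> r\<bar> < inverse (Suc m))" for q \<gamma> r
  have lim: "(\<lambda>k. f (\<gamma> (q k r))) \<longlonglongrightarrow> f (\<gamma> r) \<longleftrightarrow> P q \<gamma> r"
    if "\<And>k. q k r \<in> {0..1}" "r \<in> {0..1}" for q \<gamma> r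
  proof -
    have "X q \<gamma> r = (\<lambda>k. f (\<gamma> (q k r)))" "X' \<gamma> r = f (\<gamma> r)"
      unfolding X_def X'_def using that by (simp_all only: clamp01_id)
    moreover have "X q \<gamma> r \<longlonglongrightarrow> X' \<gamma> r \<longleftrightarrow> P q \<gamma> r"
    proof
      assume "X q \<gamma> r \<longlonglongrightarrow> X' \<gamma> r"
      then show "P q \<gamma> r" unfolding P_def LIMSEQ_def dist_real_def
        by (meson inverse_positive_iff_positive of_nat_0_less_iff zero_less_Suc)
    next
      assume P: "P q \<gamma> r"
      show "X q \<gamma> r \<longlonglongrightarrow> X' \<gamma> r"
        unfolding LIMSEQ_def dist_real_def
      proof (intro allI impI)
        fix e :: real assume "e > 0"
        then obtain m where "inverse (Suc m) < e" using reals_Archimedean by blast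
        then show "\<exists>N. \<forall>k\<ge>N. \<bar>X q \<gamma> r k - X' \<gamma> r\<bar> < e" using P unfolding P_def by (meson less_trans)
      qed
    qed
    ultimately show ?thesis by simp
  qed
  have m: "(\<lambda>x. X q (fst x) (snd x) k) \<in> borel_measurable (\<pi> \<Otimes>\<^sub>M lborel)" "(\<lambda>x. X' (fst x) (snd x)) \<in> borel_measurable (\<pi> \<Otimes>\<^sub>M lborel)"
    if [measurable]: "\<And>k. q k \<in> borel_measurable borel" for q k
    unfolding X_def X'_def
    by (rule measurable_compose[OF measurable_clamped_pair(1) W(1)]; measurable)+
  have pred: "Measurable.pred (\<pi> \<Otimes>\<^sub>M lborel) (\<lambda>x. P q (fst x) (snd x))"
    if q [measurable]: "\<And>k. q k \<in> borel_measurable borel" for q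
  proof -
    note [measurable] = m[of q, OF q]
    show ?thesis unfolding P_def by measurable
  qed
  note [measurable] = pred[of dyadic_lower] pred[of dyadic_upper]
  have "AE \<gamma> in \<pi>. AE r in lborel. r \<in> {0<..1} \<longrightarrow> P dyadic_lower \<gamma> r \<and> P dyadic_upper \<gamma> r"
  proof (rule AE_plan_commute[OF \<pi>])
    show "AE \<gamma> in \<pi>. r \<in> {0<..1} \<longrightarrow> P dyadic_lower \<gamma> r \<and> P dyadic_upper \<gamma> r" for r
    proof (cases "r \<in> {0<..1}")
      case True
      then have r: "r \<in> {0..1}" by auto
      from AE_regular_at[OF wug \<pi> r] AE_space show ?thesis
      proof eventually_elim
        case (elim \<gamma>)
        have \<gamma>: "\<gamma> \<in> space curve_borel" using elim(2) test_plan2D(3)[OF \<pi>] by simp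
        have ord: "dyadic_lower k r \<le> dyadic_upper k r" for k
          using dyadic_lower_upper(1)[of k r] dyadic_lower_upper(2)[of r k] by simp
        have "(\<lambda>k. f (\<gamma> (dyadic_lower k r))) \<longlonglongrightarrow> f (\<gamma> r)" "(\<lambda>k. f (\<gamma> (dyadic_upper k r))) \<longlonglongrightarrow> f (\<gamma> r)"
          using ord dyadic_lower_upper(4,5)
          by (intro regular_at_tendsto[OF \<gamma> W(2) elim(1) True]; simp)+
        then show ?case using lim dyadic_lower_upper_in[OF True] r by blast
      qed
    next
      case False
      then show ?thesis by (intro AE_I2 impI) (rule notE)
    qed
  qed measurable
  then show ?thesis
  proof eventually_elim
    case (elim \<gamma>)
    then show ?case
    proof eventually_elim
      case (elim r)
      show ?case
      proof
        assume r: "r \<in> {0<..1}"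
        then have "r \<in> {0..1}" by auto
        then show "(\<lambda>k. f (\<gamma> (dyadic_lower k r))) \<longlonglongrightarrow> f (\<gamma> r) \<and> (\<lambda>k. f (\<gamma> (dyadic_upper k r))) \<longlonglongrightarrow> f (\<gamma> r)"
          using elim r lim dyadic_lower_upper_in[OF r] by blast
      qed
    qed
  qed
qed

section \<open>Lattice property and chain rule for weak upper gradients\<close>

lemma speed_integrand_mono: "(\<And>x. G x \<le> H x) \<Longrightarrow> speed_integrand G \<gamma> r \<le> speed_integrand H \<gamma> r"
  unfolding speed_integrand_def by (rule mult_right_mono) auto

lemma path_integral_mono: "(\<And>x. G x \<le> H x) \<Longrightarrow> path_integral G \<gamma> s t \<le> path_integral H \<gamma> s t"
  unfolding path_integral_def by (intro nn_integral_mono mult_right_mono) auto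

text \<open>Almost every curve has all its dyadic increments bounded by both gradients, so the claim
  reduces to \<open>dyadic_min\<close> on a single curve. This lattice property yields both the
  existence of minimal gradients and their comparison with arbitrary ones.\<close>

lemma weak_upper_gradient2_min:
  fixes f :: "'a::polish_space \<Rightarrow> real"
  assumes G: "weak_upper_gradient2 n f G" and H: "weak_upper_gradient2 n f H"
  shows "weak_upper_gradient2 n f (\<lambda>x. min (G x) (H x))"
proof (rule weak_upper_gradient2I)
  note WG = weak_upper_gradient2D[OF G] and WH = weak_upper_gradient2D[OF H]
  note [measurable] = WG(1,2) WH(2)
  show "f \<in> borel_measurable borel" "(\<lambda>x. min (G x) (H x)) \<in> borel_measurable borel" by measurable
  fix \<pi> assume \<pi>: "test_plan2 n \<pi>"
  show "AE \<gamma> in \<pi>. upper_gradient_along f (\<lambda>x. min (G x) (H x)) \<gamma>"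
    using AE_increments[OF G \<pi>] AE_increments[OF H \<pi>] AE_path_integral_finite[OF G \<pi>]
      AE_path_integral_finite[OF H \<pi>] AE_space
  proof eventually_elim
    case (elim \<gamma>)
    have \<gamma>: "\<gamma> \<in> space curve_borel" using elim(5) test_plan2D(3)[OF \<pi>] by simp
    have min: "speed_integrand (\<lambda>x. min (G x) (H x)) \<gamma> r = min (speed_integrand G \<gamma> r) (speed_integrand H \<gamma> r)" for r
    proof (cases "G (\<gamma> (clamp01 r)) \<le> H (\<gamma> (clamp01 r))")
      case True
      then have "speed_integrand G \<gamma> r \<le> speed_integrand H \<gamma> r"
        unfolding speed_integrand_def by (rule mult_right_mono) simp
      then show ?thesis using True by (simp add: speed_integrand_def min_absorb1)
    next
      case False
      then have le: "H (\<gamma> (clamp01 r)) \<le> G (\<gamma> (clamp01 r))" by simp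
      then have "speed_integrand H \<gamma> r \<le> speed_integrand G \<gamma> r"
        unfolding speed_integrand_def by (rule mult_right_mono) simp
      then show ?thesis using le by (simp add: speed_integrand_def min_absorb2)
    qed
    have "ennreal \<bar>f (\<gamma> 1) - f (\<gamma> 0)\<bar> \<le> (\<integral>\<^sup>+r\<in>{0<..1}. min (speed_integrand G \<gamma> r) (speed_integrand H \<gamma> r) \<partial>lborel)"
      by (rule dyadic_min[where F="\<lambda>r. f (\<gamma> r)", OF measurable_speed_integrand[OF \<gamma> WG(2)] measurable_speed_integrand[OF \<gamma> WH(2)]])
        (use elim in \<open>auto simp: path_integral_Ioc\<close>)
    then have "ennreal \<bar>f (\<gamma> 1) - f (\<gamma> 0)\<bar> \<le> path_integral (\<lambda>x. min (G x) (H x)) \<gamma> 0 1"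
      by (simp add: path_integral_Ioc min)
    moreover have "path_integral (\<lambda>x. min (G x) (H x)) \<gamma> 0 1 \<le> path_integral G \<gamma> 0 1"
      by (rule path_integral_mono) simp
    ultimately show ?case using elim(3) by (auto intro: le_less_trans)
  qed
qed

text \<open>Values in \<open>S\<close> almost everywhere suffice, because the dyadic argument sees
  rational times, which are countably many, and otherwise almost every time. The bound
  \<open>c\<close> on \<open>\<psi>\<close> makes the new path integrals finite.\<close>

lemma weak_upper_gradient2_chain:
  fixes f :: "'a::polish_space \<Rightarrow> real" and \<phi> \<psi> :: "real \<Rightarrow> real"
  assumes n: "sets n = sets borel" and G: "weak_upper_gradient2 n f G"
    and S: "AE x in n. f x \<in> S"
    and [measurable]: "\<phi> \<in> borel_measurable borel" "\<psi> \<in> borel_measurable borel"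
    and \<phi>: "\<And>a b. a \<in> S \<Longrightarrow> b \<in> S \<Longrightarrow> \<bar>\<phi> a - \<phi> b\<bar> \<le> max (\<psi> a) (\<psi> b) * \<bar>a - b\<bar>"
    and \<psi>: "continuous_on S \<psi>" "\<And>a. a \<in> S \<Longrightarrow> 0 \<le> \<psi> a" "\<And>a. a \<in> S \<Longrightarrow> \<psi> a \<le> c"
  shows "weak_upper_gradient2 n (\<lambda>x. \<phi> (f x)) (\<lambda>x. ennreal (\<psi> (f x)) * G x)"
proof (rule weak_upper_gradient2I)
  note WG = weak_upper_gradient2D[OF G]
  note [measurable] = WG(1,2)
  show "(\<lambda>x. \<phi> (f x)) \<in> borel_measurable borel" "(\<lambda>x. ennreal (\<psi> (f x)) * G x) \<in> borel_measurable borel"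
    by measurable
  fix \<pi> assume \<pi>: "test_plan2 n \<pi>"
  let ?H = "\<lambda>x. ennreal (\<psi> (f x)) * G x"
  have "AE \<gamma> in \<pi>. f (\<gamma> q) \<in> S" if "q \<in> \<rat> \<inter> {0..1}" for q
    using that by (intro AE_plan_at[OF \<pi> n S]) auto
  then have "AE \<gamma> in \<pi>. \<forall>q\<in>\<rat> \<inter> {0..1}. f (\<gamma> q) \<in> S"
    by (subst AE_ball_countable) (auto intro: countable_Int1 countable_rat)
  then show "AE \<gamma> in \<pi>. ennreal \<bar>\<phi> (f (\<gamma> 1)) - \<phi> (f (\<gamma> 0))\<bar> \<le> path_integral ?H \<gamma> 0 1 \<and> path_integral ?H \<gamma> 0 1 < \<infinity>"
    using AE_plan_time[OF \<pi> n S] AE_dyadic_limits[OF G \<pi>] AE_increments[OF G \<pi>] AE_path_integral_finite[OF G \<pi>] AE_space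
  proof eventually_elim
    case (elim \<gamma>)
    have \<gamma>: "\<gamma> \<in> space curve_borel" using elim(6) test_plan2D(3)[OF \<pi>] by simp
    note [measurable] = measurable_speed_integrand[OF \<gamma> WG(2)]
    define F where "F r = f (\<gamma> (clamp01 r))" for r
    have F: "F r = f (\<gamma> r)" if "r \<in> {0..1}" for r unfolding F_def using that by (simp only: clamp01_id)
    have [measurable]: "F \<in> borel_measurable borel"
      unfolding F_def by (rule measurable_compose[OF measurable_clamped_pair(1) WG(1)]) (use \<gamma> in auto)
    have FS: "AE r in lborel. r \<in> {0<..1} \<longrightarrow> F r \<in> S"
      using elim(2) by eventually_elim (auto simp: F)
    have eq: "ennreal (\<psi> (F r)) * speed_integrand G \<gamma> r = speed_integrand ?H \<gamma> r" for r
      unfolding F_def speed_integrand_def by (simp add: mult.assoc)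
    have "ennreal \<bar>\<phi> (F 1) - \<phi> (F 0)\<bar> \<le> (\<integral>\<^sup>+r\<in>{0<..1}. ennreal (\<psi> (F r)) * speed_integrand G \<gamma> r \<partial>lborel)"
    proof (rule dyadic_chain[where S=S and c=c])
      fix k i :: nat assume i: "i < 2 ^ k"
      have "real i / 2 ^ k \<le> real (Suc i) / 2 ^ k" by (intro divide_right_mono) auto
      then have "real i / 2 ^ k \<in> {0..1}" "real (Suc i) / 2 ^ k \<in> {0..1}"
        using dyadic_subset(1)[OF i] by (auto simp del: of_nat_Suc)
      then show "ennreal (jump F k i) \<le> speed_integral G \<gamma> (dyadic k i)"
        using elim(4) i by (simp add: F del: of_nat_Suc)
    next
      show "speed_integral G \<gamma> {0<..1} < \<infinity>" using elim(5) by (simp add: path_integral_Ioc)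
      show "F r \<in> S" if "r \<in> \<rat> \<inter> {0..1}" for r using elim(1) that by (simp add: F)
      show "AE r in lborel. r \<in> {0<..1} \<longrightarrow> (\<lambda>k. F (dyadic_lower k r)) \<longlonglongrightarrow> F r \<and> (\<lambda>k. F (dyadic_upper k r)) \<longlonglongrightarrow> F r"
        using elim(3)
      proof eventually_elim
        case (elim r)
        show ?case
        proof
          assume r: "r \<in> {0<..1}"
          then have "r \<in> {0..1}" by auto
          then show "(\<lambda>k. F (dyadic_lower k r)) \<longlonglongrightarrow> F r \<and> (\<lambda>k. F (dyadic_upper k r)) \<longlonglongrightarrow> F r"
            using elim r by (simp only: F dyadic_lower_upper_in[OF r])
        qed
      qed
    qed (use FS \<phi> \<psi> in \<open>auto\<close>)
    then have 1: "ennreal \<bar>\<phi> (f (\<gamma> 1)) - \<phi> (f (\<gamma> 0))\<bar> \<le> path_integral ?H \<gamma> 0 1"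
      unfolding eq by (simp add: path_integral_Ioc F)
    have "path_integral ?H \<gamma> 0 1 \<le> (\<integral>\<^sup>+r. ennreal c * (speed_integrand G \<gamma> r * indicator {0<..1} r) \<partial>lborel)"
      unfolding path_integral_Ioc[OF order_refl order_refl] eq[symmetric]
    proof (rule nn_integral_mono_AE)
      from FS show "AE r in lborel. ennreal (\<psi> (F r)) * speed_integrand G \<gamma> r * indicator {0<..1} r
          \<le> ennreal c * (speed_integrand G \<gamma> r * indicator {0<..1} r)"
      proof eventually_elim
        case (elim r)
        show ?case
        proof (cases "r \<in> {0<..1}")
          case True
          then have "ennreal (\<psi> (F r)) \<le> ennreal c" using elim \<psi>(3) by (auto intro: ennreal_leI)
          then show ?thesis using True by (simp add: mult_right_mono)
        qed simp
      qed
    qed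
    also have "\<dots> = ennreal c * path_integral G \<gamma> 0 1"
      by (subst nn_integral_cmult) (auto simp: path_integral_Ioc)
    also have "\<dots> < \<infinity>" using elim(5) by (simp add: ennreal_mult_less_top)
    finally show ?case using 1 by simp
  qed
qed

subsection \<open>Change of the reference measure\<close>

lemma emeasure_density_le:
  assumes [measurable]: "g \<in> borel_measurable borel" and m: "sets m = sets borel"
    and c: "AE x in m. g x \<le> c" and A: "A \<in> sets borel"
  shows "emeasure (density m (\<lambda>x. ennreal (g x))) A \<le> ennreal c * emeasure m A"
proof -
  have [measurable_cong]: "sets m = sets borel" by (rule m)
  have "emeasure (density m (\<lambda>x. ennreal (g x))) A = (\<integral>\<^sup>+x\<in>A. ennreal (g x) \<partial>m)"
    using A by (intro emeasure_density) (auto simp: m)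
  also have "\<dots> \<le> (\<integral>\<^sup>+x\<in>A. ennreal c \<partial>m)"
  proof (rule nn_integral_mono_AE)
    from c show "AE x in m. ennreal (g x) * indicator A x \<le> ennreal c * indicator A x"
      by eventually_elim (intro mult_right_mono ennreal_leI, auto)
  qed
  also have "\<dots> = ennreal c * emeasure m A"
    using A by (intro nn_integral_cmult_indicator) (simp add: m)
  finally show ?thesis .
qed

text \<open>Markov's inequality localised to \<open>A\<close>. The density dominates
  \<open>m\<close> where \<open>g\<close> stays away from 0, with a constant that blows up like
  \<open>1 / \<kappa>\<close>.\<close>

lemma emeasure_density_ge:
  assumes [measurable]: "g \<in> borel_measurable borel" and m: "sets m = sets borel"
    and A: "A \<in> sets borel" and \<kappa>: "\<kappa> > 0"
  shows "emeasure m (A \<inter> {x. \<kappa> \<le> g x}) \<le> ennreal (1 / \<kappa>) * emeasure (density m (\<lambda>x. ennreal (g x))) A"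
proof -
  have [measurable_cong]: "sets m = sets borel" by (rule m)
  have B: "A \<inter> {x. \<kappa> \<le> g x} \<in> sets borel" using A by measurable
  have "ennreal \<kappa> * emeasure m (A \<inter> {x. \<kappa> \<le> g x}) = (\<integral>\<^sup>+x\<in>A \<inter> {x. \<kappa> \<le> g x}. ennreal \<kappa> \<partial>m)"
    using B by (intro nn_integral_cmult_indicator[symmetric]) (simp add: m)
  also have "\<dots> \<le> (\<integral>\<^sup>+x\<in>A. ennreal (g x) \<partial>m)"
    by (rule nn_integral_mono) (auto simp: indicator_def intro: ennreal_leI)
  also have "\<dots> = emeasure (density m (\<lambda>x. ennreal (g x))) A"
    using A by (intro emeasure_density[symmetric]) (auto simp: m)
  finally have "ennreal (1 / \<kappa>) * (ennreal \<kappa> * emeasure m (A \<inter> {x. \<kappa> \<le> g x}))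
      \<le> ennreal (1 / \<kappa>) * emeasure (density m (\<lambda>x. ennreal (g x))) A"
    by (rule mult_left_mono) simp
  moreover have "ennreal (1 / \<kappa>) * (ennreal \<kappa> * emeasure m (A \<inter> {x. \<kappa> \<le> g x})) = emeasure m (A \<inter> {x. \<kappa> \<le> g x})"
    using \<kappa> by (simp add: mult.assoc[symmetric] ennreal_mult[symmetric])
  ultimately show ?thesis by simp
qed

lemma test_plan2_mono:
  assumes \<pi>: "test_plan2 n' \<pi>" and "c \<ge> 0"
    and le: "\<And>A. A \<in> sets borel \<Longrightarrow> emeasure n' A \<le> ennreal c * emeasure n A"
  shows "test_plan2 n \<pi>"
proof -
  obtain C where C: "C \<ge> 0" "\<And>t A. t \<in> {0..1} \<Longrightarrow> A \<in> sets borel \<Longrightarrow>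
      emeasure (distr \<pi> borel (\<lambda>\<gamma>. \<gamma> t)) A \<le> ennreal C * emeasure n' A"
    using \<pi> unfolding test_plan2_def by blast
  have "emeasure (distr \<pi> borel (\<lambda>\<gamma>. \<gamma> t)) A \<le> ennreal (C * c) * emeasure n A"
    if "t \<in> {0..1}" "A \<in> sets borel" for t A
  proof -
    have "emeasure (distr \<pi> borel (\<lambda>\<gamma>. \<gamma> t)) A \<le> ennreal C * (ennreal c * emeasure n A)"
      by (rule order_trans[OF C(2)[OF that] mult_left_mono[OF le[OF that(2)]]]) simp
    then show ?thesis using C(1) \<open>c \<ge> 0\<close> by (simp add: ennreal_mult mult.assoc)
  qed
  moreover have "0 \<le> C * c" using C(1) \<open>c \<ge> 0\<close> by simp
  ultimately show ?thesis using \<pi> unfolding test_plan2_def by blast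
qed

text \<open>Every test plan relative to \<open>n'\<close> is one relative to \<open>n\<close>, so
  fewer curves have to be tested.\<close>

lemma weak_upper_gradient2_mono:
  assumes G: "weak_upper_gradient2 n f G" and "c \<ge> 0"
    and le: "\<And>A. A \<in> sets borel \<Longrightarrow> emeasure n' A \<le> ennreal c * emeasure n A"
  shows "weak_upper_gradient2 n' f G"
  using weak_upper_gradient2D[OF G] test_plan2_mono[OF _ \<open>c \<ge> 0\<close> le]
  by (intro weak_upper_gradient2I) auto

text \<open>Functions enter only through end-point values, whose laws under a test plan are
  absolutely continuous with respect to \<open>n\<close>.\<close>

lemma weak_upper_gradient2_cong_AE:
  assumes G: "weak_upper_gradient2 n f G" and n: "sets n = sets borel"
    and f': "f' \<in> borel_measurable borel" and eq: "AE x in n. f x = f' x"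
  shows "weak_upper_gradient2 n f' G"
proof (rule weak_upper_gradient2I[OF f' weak_upper_gradient2D(2)[OF G]])
  fix \<pi> assume \<pi>: "test_plan2 n \<pi>"
  have "AE \<gamma> in \<pi>. f (\<gamma> 0) = f' (\<gamma> 0)" "AE \<gamma> in \<pi>. f (\<gamma> 1) = f' (\<gamma> 1)"
    by (rule AE_plan_at[OF \<pi> n eq], simp)+
  with weak_upper_gradient2D(3)[OF G \<pi>]
  show "AE \<gamma> in \<pi>. ennreal \<bar>f' (\<gamma> 1) - f' (\<gamma> 0)\<bar> \<le> path_integral G \<gamma> 0 1 \<and> path_integral G \<gamma> 0 1 < \<infinity>"
    by eventually_elim simp
qed

text \<open>Dyadic left neighbours of \<open>r\<close> are rational and eventually lie in
  \<open>{s..t}\<close>, and \<open>g\<close> converges along them by regularity. At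
  \<open>r = s\<close> they fall outside, which is why \<open>s\<close> is taken rational: the bound
  then holds there directly.\<close>

lemma regular_at_lower_bound:
  fixes \<gamma> :: "real \<Rightarrow> 'a::polish_space"
  assumes \<gamma>: "\<gamma> \<in> space curve_borel" and G: "G \<in> borel_measurable borel"
    and reg: "regular_at g G \<gamma> r" and st: "s \<in> \<rat>" "0 \<le> s" "t \<le> 1" and r: "r \<in> {s..t}"
    and bound: "\<And>q. q \<in> \<rat> \<inter> {s..t} \<Longrightarrow> \<kappa> \<le> g (\<gamma> q)"
  shows "\<kappa> \<le> g (\<gamma> r)"
proof (cases "r = s")
  case True
  then show ?thesis using bound st r by auto
next
  case False
  then have "s < r" and r01: "r \<in> {0<..1}" using r st by auto
  have "(\<lambda>k. r - (1/2) ^ k) \<longlonglongrightarrow> r - 0" by (intro tendsto_intros LIMSEQ_power_zero) auto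
  then have "\<forall>\<^sub>F k in sequentially. s < r - (1/2) ^ k" using \<open>s < r\<close> by (intro order_tendstoD) auto
  then have "\<forall>\<^sub>F k in sequentially. \<kappa> \<le> g (\<gamma> (dyadic_lower k r))"
  proof eventually_elim
    case (elim k)
    then have "dyadic_lower k r \<in> {s..t}"
      using dyadic_lower_upper(1)[of k r] dyadic_lower_upper(2)[of r k] dyadic_lower_upper(3)[of k r] r by auto
    then show ?case using bound dyadic_lower_upper(4) by blast
  qed
  moreover have "(\<lambda>k. g (\<gamma> (dyadic_lower k r))) \<longlonglongrightarrow> g (\<gamma> r)"
    using dyadic_lower_upper(4) order_trans[OF less_imp_le[OF dyadic_lower_upper(1)] dyadic_lower_upper(2)]
    by (intro regular_at_tendsto[OF \<gamma> G reg r01]) auto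
  ultimately show ?thesis by (intro tendsto_lowerbound) auto
qed

text \<open>
  Where \<open>g\<close> is positive along a curve, the curve splits into dyadic pieces on which \<open>g\<close> is bounded
  below. The plans obtained by restriction to such pieces are test plans relative to \<open>\<rho>\<close>, so the
  \<open>\<rho>\<close>-gradient controls \<open>f\<close> there.
\<close>
lemma weak_upper_gradient2_glue:
  fixes m :: "'a::polish_space measure" and f g :: "'a \<Rightarrow> real"
  assumes m: "sets m = sets borel" and g: "weak_upper_gradient2 m g K"
    and G: "weak_upper_gradient2 m f G"
    and H: "weak_upper_gradient2 (density m (\<lambda>x. ennreal (g x))) f H" and HG: "\<And>x. H x \<le> G x"
  shows "weak_upper_gradient2 m f (\<lambda>x. if 0 < g x then H x else G x)"
proof (rule weak_upper_gradient2I)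
  let ?W = "\<lambda>x. if 0 < g x then H x else G x"
  let ?\<rho> = "density m (\<lambda>x. ennreal (g x))"
  note Wg = weak_upper_gradient2D[OF g] and WG = weak_upper_gradient2D[OF G] and WH = weak_upper_gradient2D[OF H]
  note [measurable] = Wg(1) WG(1,2) WH(2)
  show "f \<in> borel_measurable borel" "?W \<in> borel_measurable borel" by measurable
  fix \<pi> assume \<pi>: "test_plan2 m \<pi>"
  note D = test_plan2D[OF \<pi>] and [measurable] = measurable_plan_id[OF \<pi>]
  let ?s = "\<lambda>n i. real i / 2 ^ n" and ?t = "\<lambda>n i. real (Suc i) / 2 ^ n"
  \<comment> \<open>Testing rational times only makes the event measurable; the intersection with
    \<open>{0..1}\<close> keeps the times in the domain for every index, including
    \<open>i \<ge> 2 ^ n\<close>. Letting \<open>k\<close> vary covers all positive lower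
    bounds.\<close>
  define E where "E n i k = {\<gamma> \<in> space \<pi>. \<forall>q\<in>\<rat> \<inter> {?s n i..?t n i} \<inter> {0..1}. inverse (Suc k) \<le> g (\<gamma> q)}" for n i k :: nat
  have E_sets: "E n i k \<in> sets \<pi>" for n i k
  proof -
    have "countable (\<rat> \<inter> {?s n i..?t n i} \<inter> {0..1})" by (intro countable_Int1 countable_rat)
    moreover have "Measurable.pred \<pi> (\<lambda>\<gamma>. inverse (Suc k) \<le> g (\<gamma> q))" if "q \<in> \<rat> \<inter> {?s n i..?t n i} \<inter> {0..1}" for q
    proof -
      have [measurable]: "(\<lambda>\<gamma>. \<gamma> q) \<in> \<pi> \<rightarrow>\<^sub>M borel"
        using that by (intro measurable_plan[OF \<pi> measurable_evaluation]) auto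
      show ?thesis by measurable
    qed
    ultimately have "Measurable.pred \<pi> (\<lambda>\<gamma>. \<forall>q\<in>\<rat> \<inter> {?s n i..?t n i} \<inter> {0..1}. inverse (Suc k) \<le> g (\<gamma> q))"
      by (rule measurable_pred_countable(1))
    then show ?thesis unfolding E_def by (rule predE)
  qed
  have st: "0 \<le> ?s n i" "?s n i < ?t n i" "?t n i \<le> 1" if "i < 2 ^ n" for n i
  proof -
    show "?s n i < ?t n i" by (intro divide_strict_right_mono) auto
    then show "0 \<le> ?s n i" "?t n i \<le> 1" using dyadic_subset(1)[OF that] by (auto simp del: of_nat_Suc)
  qed
  have lower: "inverse (Suc k) \<le> g (\<gamma> r)"
    if "\<gamma> \<in> E n i k" "i < 2 ^ n" "r \<in> {?s n i..?t n i}" "regular_at g K \<gamma> r" for \<gamma> r n i k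
  proof (rule regular_at_lower_bound[OF _ Wg(2) that(4) _ st(1,3)[OF that(2)] that(3)])
    show "\<gamma> \<in> space curve_borel" using that(1) D(3) by (auto simp: E_def)
    show "?s n i \<in> \<rat>" by auto
    fix q assume "q \<in> \<rat> \<inter> {?s n i..?t n i}"
    then have "q \<in> \<rat> \<inter> {?s n i..?t n i} \<inter> {0..1}" using dyadic_subset(1)[OF that(2)] by blast
    then show "inverse (Suc k) \<le> g (\<gamma> q)" using that(1) unfolding E_def by blast
  qed
  have inc_H: "AE \<gamma> in \<pi>. \<gamma> \<in> E n i k \<longrightarrow> ennreal \<bar>f (\<gamma> (?t n i)) - f (\<gamma> (?s n i))\<bar>
      \<le> speed_integral H \<gamma> (dyadic n i)" if i: "i \<in> {..<2 ^ n}" for n i k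
  proof -
    have i: "i < 2 ^ n" using i by simp
    obtain C where C: "C \<ge> 0" "\<And>t A. t \<in> {0..1} \<Longrightarrow> A \<in> sets borel \<Longrightarrow>
        emeasure \<pi> {\<gamma> \<in> space \<pi>. \<gamma> t \<in> A} \<le> ennreal C * emeasure m A"
      using test_plan2_bound[OF \<pi>] by blast
    \<comment> \<open>By regularity at the fixed time \<open>r\<close>, almost all curves in
      \<open>E n i k\<close> satisfy \<open>inverse (Suc k) \<le> g (\<gamma> r)\<close>. Hence the
      constant: \<open>C\<close> from the plan times \<open>Suc k\<close> from
      \<open>emeasure_density_ge\<close>.\<close>
    have "emeasure \<pi> {\<gamma> \<in> E n i k. \<gamma> r \<in> A} \<le> ennreal (C * real (Suc k)) * emeasure ?\<rho> A"
      if r: "r \<in> {?s n i..?t n i}" and A: "A \<in> sets borel" for r A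
    proof -
      have r01: "r \<in> {0..1}" using r dyadic_subset(1)[OF i] by blast
      let ?B = "A \<inter> {x. inverse (Suc k) \<le> g x}"
      have B: "?B \<in> sets borel" using A by measurable
      have "emeasure \<pi> {\<gamma> \<in> E n i k. \<gamma> r \<in> A} \<le> emeasure \<pi> {\<gamma> \<in> space \<pi>. \<gamma> r \<in> ?B}"
      proof (rule emeasure_mono_AE)
        from AE_regular_at[OF g \<pi> r01]
        show "AE \<gamma> in \<pi>. \<gamma> \<in> {\<gamma> \<in> E n i k. \<gamma> r \<in> A} \<longrightarrow> \<gamma> \<in> {\<gamma> \<in> space \<pi>. \<gamma> r \<in> ?B}"
        proof eventually_elim
          case (elim \<gamma>)
          then show ?case using lower[OF _ i r elim] by (auto simp: E_def)
        qed
        have [measurable]: "(\<lambda>\<gamma>. \<gamma> r) \<in> \<pi> \<rightarrow>\<^sub>M borel"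
          by (rule measurable_plan[OF \<pi> measurable_evaluation[OF r01]])
        show "{\<gamma> \<in> space \<pi>. \<gamma> r \<in> ?B} \<in> sets \<pi>" using B by measurable
      qed
      also have "\<dots> \<le> ennreal C * emeasure m ?B" by (rule C(2)[OF r01 B])
      also have "\<dots> \<le> ennreal C * (ennreal (1 / inverse (Suc k)) * emeasure ?\<rho> A)"
        by (intro mult_left_mono emeasure_density_ge[OF Wg(1) m A]) auto
      also have "\<dots> = ennreal (C * real (Suc k)) * emeasure ?\<rho> A"
        using C(1) by (simp add: ennreal_mult mult.assoc divide_inverse del: of_nat_Suc)
      finally show ?thesis .
    qed
    then show ?thesis
      using weak_upper_gradient2_increment_on[OF H \<pi> E_sets st[OF i], of "C * real (Suc k)" n i k] C(1)
      unfolding path_integral_Ioc[OF st(1,3)[OF i]] dyadic_def by simp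
  qed
  \<comment> \<open>The accepted intervals depend on the curve; the predicate \<open>P\<close>
    expresses that they exhaust the times with positive \<open>g\<close>.\<close>
  define A where "A \<gamma> n = {i. i < 2 ^ n \<and> (\<exists>k. \<gamma> \<in> E n i k)}" for \<gamma> n
  define P where "P \<gamma> r \<longleftrightarrow> (r \<in> (\<Union>n. \<Union>i\<in>A \<gamma> n. dyadic n i) \<longleftrightarrow> 0 < g (\<gamma> (clamp01 r)))" for \<gamma> r
  have "AE \<gamma> in \<pi>. AE r in lborel. r \<in> {0<..1} \<longrightarrow> P \<gamma> r"
  proof (rule AE_plan_commute[OF \<pi>])
    have [measurable]: "(\<lambda>x. g ((fst x) (clamp01 (snd x)))) \<in> borel_measurable (\<pi> \<Otimes>\<^sub>M lborel)"
      by (rule measurable_compose[OF measurable_clamped_pair(1) Wg(1)]) measurable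
    note [measurable] = E_sets
    have "(r \<in> (\<Union>n. \<Union>i\<in>A \<gamma> n. dyadic n i)) \<longleftrightarrow> (\<exists>n. \<exists>i. i < 2 ^ n \<and> (\<exists>k. \<gamma> \<in> E n i k) \<and> r \<in> dyadic n i)" for \<gamma> r
      unfolding A_def by blast
    moreover have "Measurable.pred (\<pi> \<Otimes>\<^sub>M lborel) (\<lambda>x. (\<exists>n. \<exists>i. i < 2 ^ n \<and> (\<exists>k. fst x \<in> E n i k) \<and> snd x \<in> dyadic n i)
        \<longleftrightarrow> 0 < g ((fst x) (clamp01 (snd x))))"
      by measurable
    ultimately have [measurable]: "Measurable.pred (\<pi> \<Otimes>\<^sub>M lborel) (\<lambda>x. P (fst x) (snd x))"
      unfolding P_def by simp
    show "Measurable.pred (\<pi> \<Otimes>\<^sub>M lborel) (\<lambda>x. snd x \<in> {0<..1} \<longrightarrow> P (fst x) (snd x))"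
      by measurable
    fix r
    show "AE \<gamma> in \<pi>. r \<in> {0<..1} \<longrightarrow> P \<gamma> r"
    proof (cases "r \<in> {0<..1}")
      case True
      then have r01: "r \<in> {0..1}" by auto
      from AE_regular_at[OF g \<pi> r01] AE_space show ?thesis
      proof eventually_elim
        case (elim \<gamma>)
        have \<gamma>: "\<gamma> \<in> space curve_borel" using elim(2) D(3) by simp
        have "0 < g (\<gamma> r)" if rA: "r \<in> (\<Union>n. \<Union>i\<in>A \<gamma> n. dyadic n i)"
        proof -
          obtain n i k where i: "i < 2 ^ n" "\<gamma> \<in> E n i k" "r \<in> dyadic n i" using rA unfolding A_def by blast
          have "inverse (Suc k) \<le> g (\<gamma> r)"
            by (rule lower[OF i(2,1) _ elim(1)]) (use i(3) in \<open>auto simp: dyadic_def\<close>)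
          then show ?thesis by (rule less_le_trans[rotated]) simp
        qed
        \<comment> \<open>The deviation of \<open>g\<close> from \<open>g (\<gamma> r)\<close> over
          the dyadic hull is eventually below \<open>g (\<gamma> r) / 2\<close>. This leaves
          \<open>g\<close> above \<open>g (\<gamma> r) / 2\<close>, and thus above some
          \<open>inverse (Suc k)\<close>, at all rational times of the interval.\<close>
        moreover have "r \<in> (\<Union>n. \<Union>i\<in>A \<gamma> n. dyadic n i)" if pos: "0 < g (\<gamma> r)"
        proof -
          have "\<forall>\<^sub>F n in sequentially. speed_integral K \<gamma> (dyadic_hull n r) < ennreal (g (\<gamma> r) / 2)"
            by (rule order_tendstoD(2)[OF regular_at_oscillation_tendsto[OF \<gamma> Wg(2) elim(1) True]]) (use pos in simp)
          then obtain n where n: "speed_integral K \<gamma> (dyadic_hull n r) < ennreal (g (\<gamma> r) / 2)"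
            unfolding eventually_sequentially by blast
          obtain i where i: "i < 2 ^ n" "r \<in> dyadic n i" using dyadic_index[OF True] by blast
          obtain k where k: "inverse (Suc k) < g (\<gamma> r) / 2" using reals_Archimedean[of "g (\<gamma> r) / 2"] pos by auto
          have "inverse (Suc k) \<le> g (\<gamma> q)" if q: "q \<in> \<rat> \<inter> {?s n i..?t n i} \<inter> {0..1}" for q
          proof -
            have "ennreal \<bar>g (\<gamma> q) - g (\<gamma> r)\<bar> \<le> speed_integral K \<gamma> (dyadic_hull n r)"
              by (rule regular_at_oscillation[OF elim(1) True]) (use q dyadic_lower_upper_eq[OF i(2)] in auto)
            then have "ennreal \<bar>g (\<gamma> q) - g (\<gamma> r)\<bar> < ennreal (g (\<gamma> r) / 2)" using n by (rule le_less_trans)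
            then have "\<bar>g (\<gamma> q) - g (\<gamma> r)\<bar> < g (\<gamma> r) / 2" using pos by (subst (asm) ennreal_less_iff) auto
            then show ?thesis using k by linarith
          qed
          then have "\<gamma> \<in> E n i k" using elim(2) unfolding E_def by blast
          then show ?thesis using i unfolding A_def by blast
        qed
        ultimately show ?case unfolding P_def by (simp only: clamp01_id[OF r01]) blast
      qed
    next
      case False
      then show ?thesis by (intro AE_I2 impI) (rule notE)
    qed
  qed
  moreover have "AE \<gamma> in \<pi>. \<forall>n. \<forall>i\<in>{..<2 ^ n}. \<forall>k. \<gamma> \<in> E n i k \<longrightarrow> ennreal \<bar>f (\<gamma> (?t n i)) - f (\<gamma> (?s n i))\<bar>
      \<le> speed_integral H \<gamma> (dyadic n i)"
    using inc_H by (simp only: AE_all_countable AE_ball_countable countable_finite finite_lessThan) blast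
  ultimately show "AE \<gamma> in \<pi>. upper_gradient_along f ?W \<gamma>"
    using AE_increments[OF G \<pi>] AE_path_integral_finite[OF G \<pi>] AE_space
  proof eventually_elim
    case (elim \<gamma>)
    have \<gamma>: "\<gamma> \<in> space curve_borel" using elim(5) D(3) by simp
    have "ennreal \<bar>f (\<gamma> 1) - f (\<gamma> 0)\<bar> \<le> (\<integral>\<^sup>+r\<in>{0<..1}. (if r \<in> (\<Union>n. \<Union>i\<in>A \<gamma> n. dyadic n i)
        then speed_integrand H \<gamma> r else speed_integrand G \<gamma> r) \<partial>lborel)"
    proof (rule dyadic_gluing[where F="\<lambda>r. f (\<gamma> r)", OF measurable_speed_integrand[OF \<gamma> WG(2)] measurable_speed_integrand[OF \<gamma> WH(2)]])
      show "(\<Union>i\<in>A \<gamma> n. dyadic n i) \<subseteq> (\<Union>i\<in>A \<gamma> (Suc n). dyadic (Suc n) i)" for n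
      proof
        fix r assume "r \<in> (\<Union>i\<in>A \<gamma> n. dyadic n i)"
        then obtain i k where i: "i < 2 ^ n" "\<gamma> \<in> E n i k" "r \<in> dyadic n i" unfolding A_def by blast
        obtain i' where i': "i' < 2 ^ Suc n" "r \<in> dyadic (Suc n) i'" "{?s (Suc n) i'..?t (Suc n) i'} \<subseteq> {?s n i..?t n i}"
          using dyadic_index_mono[OF i(3,1)] by blast
        \<comment> \<open>A lower bound on an interval is inherited by its halves with the same
          \<open>k\<close>.\<close>
        have "\<gamma> \<in> E (Suc n) i' k" using i(2) i'(3) unfolding E_def by blast
        then show "r \<in> (\<Union>i\<in>A \<gamma> (Suc n). dyadic (Suc n) i)" using i' unfolding A_def by blast
      qed
    qed (use elim in \<open>auto simp: A_def path_integral_Ioc\<close>)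
    also have "\<dots> = path_integral ?W \<gamma> 0 1"
      unfolding path_integral_Ioc[OF order_refl order_refl]
    proof (rule nn_integral_cong_AE)
      from elim(1) show "AE r in lborel. (if r \<in> (\<Union>n. \<Union>i\<in>A \<gamma> n. dyadic n i)
        then speed_integrand H \<gamma> r else speed_integrand G \<gamma> r) * indicator {0<..1} r = speed_integrand ?W \<gamma> r * indicator {0<..1} r"
        by eventually_elim (auto simp: P_def speed_integrand_def indicator_def)
    qed
    finally have "ennreal \<bar>f (\<gamma> 1) - f (\<gamma> 0)\<bar> \<le> path_integral ?W \<gamma> 0 1" .
    moreover have "path_integral ?W \<gamma> 0 1 \<le> path_integral G \<gamma> 0 1"
      by (rule path_integral_mono) (simp add: HG)
    ultimately show ?case using elim(4) by (auto intro: le_less_trans)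
  qed
qed

subsection \<open>Minimal weak upper gradients\<close>

text \<open>Dominated convergence along almost every curve, with the integrand of \<open>M 0\<close>
  as majorant; countably many exceptional sets of curves are discarded.\<close>

lemma weak_upper_gradient2_INF:
  fixes f :: "'a::polish_space \<Rightarrow> real" and M :: "nat \<Rightarrow> 'a \<Rightarrow> ennreal"
  assumes M: "\<And>k. weak_upper_gradient2 n f (M k)" and dec: "\<And>k x. M (Suc k) x \<le> M k x"
  shows "weak_upper_gradient2 n f (\<lambda>x. INF k. M k x)"
proof (rule weak_upper_gradient2I)
  let ?I = "\<lambda>x. INF k. M k x"
  note W = weak_upper_gradient2D[OF M]
  note [measurable] = W(1,2)
  show "f \<in> borel_measurable borel" "?I \<in> borel_measurable borel" by measurable
  fix \<pi> assume \<pi>: "test_plan2 n \<pi>"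
  have "AE \<gamma> in \<pi>. \<forall>k. ennreal \<bar>f (\<gamma> 1) - f (\<gamma> 0)\<bar> \<le> path_integral (M k) \<gamma> 0 1 \<and> path_integral (M k) \<gamma> 0 1 < \<infinity>"
    using W(3)[OF \<pi>] by (subst AE_all_countable) blast
  then show "AE \<gamma> in \<pi>. upper_gradient_along f ?I \<gamma>"
    using AE_space
  proof eventually_elim
    case (elim \<gamma>)
    have \<gamma>: "\<gamma> \<in> space curve_borel" using elim(2) test_plan2D(3)[OF \<pi>] by simp
    have mono: "M k x \<le> M 0 x" for k x
      using lift_Suc_antimono_le[of "\<lambda>k. M k x" 0 k] dec by blast
    note [measurable] = measurable_speed_integrand[OF \<gamma> W(2)] measurable_speed_integrand[OF \<gamma>, of ?I]
    have "(\<lambda>k. speed_integral (M k) \<gamma> {0<..1}) \<longlonglongrightarrow> speed_integral ?I \<gamma> {0<..1}"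
    proof (rule nn_integral_dominated_convergence)
      show "AE r in lborel. speed_integrand (M k) \<gamma> r * indicator {0<..1} r \<le> speed_integrand (M 0) \<gamma> r * indicator {0<..1} r" for k
        by (intro AE_I2 mult_right_mono speed_integrand_mono mono) auto
      show "speed_integral (M 0) \<gamma> {0<..1} < \<infinity>"
        using elim(1) by (simp add: path_integral_Ioc)
      have "(\<lambda>k. M k x) \<longlonglongrightarrow> ?I x" for x
        by (intro LIMSEQ_INF decseq_SucI dec)
      then have "(\<lambda>k. speed_integrand (M k) \<gamma> r) \<longlonglongrightarrow> speed_integrand ?I \<gamma> r" for r
        unfolding speed_integrand_def by (subst (1 2) mult.commute) (intro ennreal_tendsto_cmult; simp)
      then show "AE r in lborel. (\<lambda>k. speed_integrand (M k) \<gamma> r * indicator {0<..1} r) \<longlonglongrightarrow> speed_integrand ?I \<gamma> r * indicator {0<..1} r"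
        by (intro AE_I2) (auto simp: indicator_def)
    qed measurable
    then have lim: "(\<lambda>k. path_integral (M k) \<gamma> 0 1) \<longlonglongrightarrow> path_integral ?I \<gamma> 0 1"
      by (simp add: path_integral_Ioc)
    have "ennreal \<bar>f (\<gamma> 1) - f (\<gamma> 0)\<bar> \<le> path_integral ?I \<gamma> 0 1"
      by (rule LIMSEQ_le_const[OF lim]) (use elim(1) in blast)
    moreover have "path_integral ?I \<gamma> 0 1 \<le> path_integral (M 0) \<gamma> 0 1"
      by (intro path_integral_mono INF_lower) simp
    ultimately show ?case using elim(1) by (auto intro: le_less_trans)
  qed
qed

text \<open>
  No weak compactness is needed: by \<open>weak_upper_gradient2_min\<close> a minimizing sequence can be
  taken decreasing.
\<close>
lemma minimal_weak_upper_gradient_weak_gradient: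
  fixes f :: "'a::polish_space \<Rightarrow> real"
  assumes "f \<in> S2 n"
  shows "minimal_weak_upper_gradient n f (weak_gradient n f)"
proof -
  let ?N = "\<lambda>G. \<integral>\<^sup>+x. (G x)\<^sup>2 \<partial>n"
  define I where "I = (INF G\<in>{G. weak_upper_gradient2 n f G}. ?N G)"
  obtain G0 where G0: "weak_upper_gradient2 n f G0" "?N G0 < \<infinity>" using assms unfolding S2_def by blast
  then have I_fin: "I < \<infinity>" unfolding I_def by (auto intro: INF_lower2 le_less_trans)
  have I_le: "I \<le> ?N H" if "weak_upper_gradient2 n f H" for H
    unfolding I_def using that by (intro INF_lower) auto
  have "\<exists>G. weak_upper_gradient2 n f G \<and> ?N G < I + ennreal (inverse (Suc k))" for k
  proof -
    have "I < I + ennreal (inverse (Suc k))"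
      using I_fin ennreal_add_left_cancel_less[of I 0 "ennreal (inverse (Suc k))"] by (simp add: less_top)
    then show ?thesis unfolding I_def INF_less_iff by blast
  qed
  then obtain G where G: "\<And>k. weak_upper_gradient2 n f (G k)" "\<And>k. ?N (G k) < I + ennreal (inverse (Suc k))"
    by metis
  define M where "M = rec_nat (G 0) (\<lambda>k M x. min (M x) (G (Suc k) x))"
  have M0: "M 0 = G 0" and MS: "M (Suc k) = (\<lambda>x. min (M k x) (G (Suc k) x))" for k
    unfolding M_def by simp_all
  have M: "weak_upper_gradient2 n f (M k)" for k
    by (induction k) (auto simp: M0 MS G intro: weak_upper_gradient2_min)
  have MG: "M k x \<le> G k x" for k x by (cases k) (auto simp: M0 MS)
  define J where "J x = (INF k. M k x)" for x
  have J: "weak_upper_gradient2 n f J"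
    unfolding J_def[abs_def] by (rule weak_upper_gradient2_INF[OF M]) (simp add: MS)
  have "?N J \<le> I + ennreal (inverse (Suc k))" for k
  proof -
    have "?N J \<le> ?N (G k)"
      by (intro nn_integral_mono power_mono) (auto simp: J_def intro: INF_lower2[of k] MG)
    then show ?thesis using G(2)[of k] by simp
  qed
  moreover have "(\<lambda>k. I + ennreal (inverse (Suc k))) \<longlonglongrightarrow> I + ennreal 0"
    by (intro tendsto_add tendsto_const tendsto_ennrealI LIMSEQ_inverse_real_of_nat)
  ultimately have "?N J \<le> I + ennreal 0" by (intro LIMSEQ_le_const[of _ "I + ennreal 0" "?N J"]) auto
  then have "?N J \<le> I" by simp
  then have "minimal_weak_upper_gradient n f J"
    unfolding minimal_weak_upper_gradient_def using J I_fin I_le by (auto intro: le_less_trans order_trans)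
  then show ?thesis unfolding weak_gradient_def by (rule someI[where P="minimal_weak_upper_gradient n f"])
qed

text \<open>The pointwise minimum of \<open>G\<close> and \<open>H\<close> is again a weak upper
  gradient and at most \<open>G\<close>; minimality forces equal L^2 norms, and as these are finite
  the squares agree almost everywhere. In particular two minimal gradients agree almost everywhere,
  so the choice made by \<open>weak_gradient\<close> is immaterial.\<close>

lemma minimal_weak_upper_gradient_le_AE:
  fixes f :: "'a::polish_space \<Rightarrow> real"
  assumes n: "sets n = sets borel" and G: "minimal_weak_upper_gradient n f G" and H: "weak_upper_gradient2 n f H"
  shows "AE x in n. G x \<le> H x"
proof -
  have wug: "weak_upper_gradient2 n f G" and fin: "(\<integral>\<^sup>+x. (G x)\<^sup>2 \<partial>n) < \<infinity>"
    using G unfolding minimal_weak_upper_gradient_def by auto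
  have [measurable_cong]: "sets n = sets borel" by (rule n)
  note [measurable] = weak_upper_gradient2D(2)[OF wug] weak_upper_gradient2D(2)[OF H]
  let ?m = "\<lambda>x. min (G x) (H x)"
  have le: "(\<integral>\<^sup>+x. (G x)\<^sup>2 \<partial>n) \<le> (\<integral>\<^sup>+x. (?m x)\<^sup>2 \<partial>n)"
    using G weak_upper_gradient2_min[OF wug H] unfolding minimal_weak_upper_gradient_def by blast
  have m_le: "(?m x)\<^sup>2 \<le> (G x)\<^sup>2" for x by (rule power_mono) auto
  have "(\<integral>\<^sup>+x. (?m x)\<^sup>2 \<partial>n) \<le> (\<integral>\<^sup>+x. (G x)\<^sup>2 \<partial>n)" by (rule nn_integral_mono) (rule m_le)
  then have "(\<integral>\<^sup>+x. (G x)\<^sup>2 - (?m x)\<^sup>2 \<partial>n) = (\<integral>\<^sup>+x. (G x)\<^sup>2 \<partial>n) - (\<integral>\<^sup>+x. (?m x)\<^sup>2 \<partial>n)"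
    using fin by (intro nn_integral_diff) (auto simp: m_le)
  also have "\<dots> = 0" using le fin by (simp add: diff_eq_0_iff_ennreal)
  finally have "AE x in n. (G x)\<^sup>2 - (?m x)\<^sup>2 = 0" by (subst (asm) nn_integral_0_iff_AE) auto
  moreover have "AE x in n. (G x)\<^sup>2 \<noteq> \<infinity>" by (rule nn_integral_PInf_AE) (use fin in auto)
  ultimately show ?thesis
  proof eventually_elim
    case (elim x)
    show ?case
    proof (rule ccontr)
      assume "\<not> G x \<le> H x"
      then have lt: "H x < G x" by simp
      obtain a where a: "G x = ennreal a" "0 \<le> a"
        using elim(2) by (cases "G x") auto
      obtain b where b: "H x = ennreal b" "0 \<le> b"
        using lt a by (cases "H x") auto
      have "b < a" using lt a b by (simp add: ennreal_less_iff)
      then have "b\<^sup>2 < a\<^sup>2" using b by (intro power_strict_mono) auto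
      moreover have "?m x = H x" using lt by (simp add: min_absorb2 less_imp_le)
      then have "ennreal (a\<^sup>2) - ennreal (b\<^sup>2) = 0" using elim(1) a b by (simp add: ennreal_power)
      ultimately show False by (simp add: ennreal_minus[symmetric] diff_eq_0_iff_ennreal)
    qed
  qed
qed

text \<open>The integrand is at most the square of \<open>Q\<close> plus the squared speed. The
  second summand is the energy; the first is integrable over the plan by Fubini's theorem, since the
  time marginals are bounded by \<open>C\<close> times \<open>n\<close>. This supplies the
  finiteness in the definition of a weak upper gradient when no larger gradient is at hand.\<close>

lemma AE_path_integral_finite_L2:
  fixes Q :: "'a::polish_space \<Rightarrow> ennreal"
  assumes n: "sets n = sets borel" and \<pi>: "test_plan2 n \<pi>" and Q [measurable]: "Q \<in> borel_measurable borel"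
    and fin: "(\<integral>\<^sup>+x. (Q x)\<^sup>2 \<partial>n) < \<infinity>"
  shows "AE \<gamma> in \<pi>. path_integral Q \<gamma> 0 1 < \<infinity>"
proof -
  note D = test_plan2D[OF \<pi>]
  interpret prob_space \<pi> by (rule D)
  have Q2: "(\<lambda>x. (Q x)\<^sup>2) \<in> borel_measurable borel" by measurable
  note [measurable] = measurable_plan_id[OF \<pi>]
  interpret pair_sigma_finite \<pi> lborel ..
  obtain C where C: "C \<ge> 0" "\<And>t A. t \<in> {0..1} \<Longrightarrow> A \<in> sets borel \<Longrightarrow>
      emeasure (distr \<pi> borel (\<lambda>\<gamma>. \<gamma> t)) A \<le> ennreal C * emeasure n A"
    using \<pi> unfolding test_plan2_def by blast
  have [measurable]: "(\<lambda>x. (fst x) (clamp01 (snd x))) \<in> borel_measurable (\<pi> \<Otimes>\<^sub>M lborel)"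
    by (rule measurable_clamped_pair) measurable
  let ?q = "\<lambda>\<gamma> r. (Q (\<gamma> (clamp01 r)))\<^sup>2 * indicator {0..1} r"
  have q_le: "(\<integral>\<^sup>+\<gamma>. ?q \<gamma> r \<partial>\<pi>) \<le> ennreal C * (\<integral>\<^sup>+x. (Q x)\<^sup>2 \<partial>n) * indicator {0..1} r" for r
  proof (cases "r \<in> {0..1}")
    case True
    have ev: "(\<lambda>\<gamma>. \<gamma> r) \<in> \<pi> \<rightarrow>\<^sub>M borel"
      by (rule measurable_plan[OF \<pi> measurable_evaluation[OF True]])
    have "(\<integral>\<^sup>+\<gamma>. (Q (\<gamma> r))\<^sup>2 \<partial>\<pi>) = (\<integral>\<^sup>+x. (Q x)\<^sup>2 \<partial>distr \<pi> borel (\<lambda>\<gamma>. \<gamma> r))"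
      by (rule nn_integral_distr[OF ev, symmetric]) (simp add: Q2)
    also have "\<dots> \<le> (\<integral>\<^sup>+x. (Q x)\<^sup>2 \<partial>scale_measure (ennreal C) n)"
    proof (rule nn_integral_mono_measure)
      show "sets (distr \<pi> borel (\<lambda>\<gamma>. \<gamma> r)) = sets (scale_measure (ennreal C) n)" using n by simp
      then show "distr \<pi> borel (\<lambda>\<gamma>. \<gamma> r) \<le> scale_measure (ennreal C) n"
        using C(2)[OF True] by (subst le_measure) (auto simp: le_fun_def)
    qed
    also have "\<dots> = ennreal C * (\<integral>\<^sup>+x. (Q x)\<^sup>2 \<partial>n)"
      by (rule nn_integral_scale_measure) (simp add: measurable_cong_sets[OF n refl])
    finally show ?thesis using True unfolding clamp01_id[OF True] by simp
  qed simp
  have "(\<integral>\<^sup>+\<gamma>. (\<integral>\<^sup>+r. ?q \<gamma> r \<partial>lborel) \<partial>\<pi>) = (\<integral>\<^sup>+r. (\<integral>\<^sup>+\<gamma>. ?q \<gamma> r \<partial>\<pi>) \<partial>lborel)"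
    by (rule Fubini'[symmetric]) (simp add: split_beta')
  also have "\<dots> \<le> (\<integral>\<^sup>+r. ennreal C * (\<integral>\<^sup>+x. (Q x)\<^sup>2 \<partial>n) * indicator {0..1::real} r \<partial>lborel)"
    by (rule nn_integral_mono) (rule q_le)
  also have "\<dots> = ennreal C * (\<integral>\<^sup>+x. (Q x)\<^sup>2 \<partial>n)"
    by (subst nn_integral_cmult_indicator) auto
  also have "\<dots> < \<infinity>" using fin by (simp add: ennreal_mult_less_top)
  finally have "AE \<gamma> in \<pi>. (\<integral>\<^sup>+r. ?q \<gamma> r \<partial>lborel) \<noteq> \<infinity>"
    by (intro nn_integral_PInf_AE) auto
  moreover have "AE \<gamma> in \<pi>. energy \<gamma> \<noteq> \<infinity>"
    using D(5) measurable_plan[OF \<pi> measurable_energy] by (intro nn_integral_PInf_AE) auto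
  ultimately show ?thesis
    using AE_space
  proof eventually_elim
    case (elim \<gamma>)
    have \<gamma>: "\<gamma> \<in> space curve_borel" using elim(3) D(3) by simp
    have [measurable]: "(\<lambda>r. \<gamma> (clamp01 r)) \<in> borel_measurable borel" "(\<lambda>r. metric_derivative \<gamma> (clamp01 r)) \<in> borel_measurable borel"
      using measurable_clamped_pair[of "\<lambda>r. \<gamma>" borel "\<lambda>r. r"] \<gamma> by simp_all
    have ab: "a * b \<le> a\<^sup>2 + b\<^sup>2" for a b :: ennreal
    proof (cases "a \<le> b")
      case True
      then have "a * b \<le> b * b" by (rule mult_right_mono) simp
      also have "\<dots> \<le> a\<^sup>2 + b\<^sup>2" by (simp add: power2_eq_square)
      finally show ?thesis .
    next
      case False
      then have "a * b \<le> a * a" by (intro mult_left_mono) auto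
      also have "\<dots> \<le> a\<^sup>2 + b\<^sup>2" by (simp add: power2_eq_square)
      finally show ?thesis .
    qed
    have "path_integral Q \<gamma> 0 1 \<le> (\<integral>\<^sup>+r. ?q \<gamma> r + ennreal ((metric_derivative \<gamma> (clamp01 r))\<^sup>2) * indicator {0..1} r \<partial>lborel)"
      unfolding path_integral_eq[OF order_refl order_refl]
    proof (rule nn_integral_mono)
      fix r
      have "(ennreal (metric_derivative \<gamma> (clamp01 r)))\<^sup>2 \<le> ennreal ((metric_derivative \<gamma> (clamp01 r))\<^sup>2)"
        by (cases "0 \<le> metric_derivative \<gamma> (clamp01 r)") (auto simp: ennreal_power ennreal_neg)
      then have "speed_integrand Q \<gamma> r \<le> (Q (\<gamma> (clamp01 r)))\<^sup>2 + ennreal ((metric_derivative \<gamma> (clamp01 r))\<^sup>2)"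
        unfolding speed_integrand_def by (rule order_trans[OF ab add_left_mono])
      then show "speed_integrand Q \<gamma> r * indicator {0..1} r
          \<le> ?q \<gamma> r + ennreal ((metric_derivative \<gamma> (clamp01 r))\<^sup>2) * indicator {0..1} r"
        by (auto simp: indicator_def)
    qed
    also have "\<dots> = (\<integral>\<^sup>+r. ?q \<gamma> r \<partial>lborel) + energy \<gamma>"
      unfolding energy_eq by (rule nn_integral_add) auto
    also have "\<dots> < \<infinity>" using elim by (simp add: less_top)
    finally show ?case .
  qed
qed

text \<open>The \<open>m\<close>-gradient is a competitor for \<rho> since \<rho> \<le> c m;
  conversely a \<rho>-gradient can be glued into an \<open>m\<close>-gradient. The third conclusion
  keeps \<open>H\<close> arbitrary because it will be applied to a gradient of \<open>g\<close>
  obtained from its logarithm.\<close>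

lemma weak_gradient_density_eq:
  fixes m :: "'a::polish_space measure" and f g :: "'a \<Rightarrow> real"
  defines "\<rho> \<equiv> density m (\<lambda>x. ennreal (g x))"
  assumes m: "sets m = sets borel" and g: "weak_upper_gradient2 m g K"
    and c: "0 \<le> c" "AE x in m. g x \<le> c"
    and f: "f \<in> S2 m" and fin: "(\<integral>\<^sup>+x. (weak_gradient m f x)\<^sup>2 \<partial>\<rho>) < \<infinity>"
  shows "f \<in> S2 \<rho>" and "AE x in \<rho>. weak_gradient \<rho> f x = weak_gradient m f x"
    and "weak_upper_gradient2 \<rho> f H \<Longrightarrow> AE x in m. 0 < g x \<longrightarrow> weak_gradient m f x \<le> H x"
proof -
  let ?G = "weak_gradient m f"
  have \<rho>: "sets \<rho> = sets borel" unfolding \<rho>_def using m by simp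
  have g_meas: "g \<in> borel_measurable borel" by (rule weak_upper_gradient2D(1)[OF g])
  have min_G: "minimal_weak_upper_gradient m f ?G" by (rule minimal_weak_upper_gradient_weak_gradient[OF f])
  then have G: "weak_upper_gradient2 m f ?G" unfolding minimal_weak_upper_gradient_def by blast
  have G\<rho>: "weak_upper_gradient2 \<rho> f ?G"
    using emeasure_density_le[OF g_meas m c(2)] unfolding \<rho>_def by (rule weak_upper_gradient2_mono[OF G c(1)])
  show f\<rho>: "f \<in> S2 \<rho>" unfolding S2_def using G\<rho> fin by blast
  show le: "AE x in m. 0 < g x \<longrightarrow> ?G x \<le> H x" if H: "weak_upper_gradient2 \<rho> f H" for H
  proof -
    \<comment> \<open>The minimum with \<open>?G\<close> provides the pointwise order that the
      gluing asks for.\<close>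
    have "weak_upper_gradient2 m f (\<lambda>x. if 0 < g x then min (H x) (?G x) else ?G x)"
      using weak_upper_gradient2_min[OF H G\<rho>] unfolding \<rho>_def by (intro weak_upper_gradient2_glue[OF m g G]) auto
    from minimal_weak_upper_gradient_le_AE[OF m min_G this] show ?thesis
      by eventually_elim auto
  qed
  have min_H: "minimal_weak_upper_gradient \<rho> f (weak_gradient \<rho> f)"
    by (rule minimal_weak_upper_gradient_weak_gradient[OF f\<rho>])
  then have "weak_upper_gradient2 \<rho> f (weak_gradient \<rho> f)" unfolding minimal_weak_upper_gradient_def by blast
  from le[OF this] have "AE x in \<rho>. ?G x \<le> weak_gradient \<rho> f x"
    unfolding \<rho>_def using g_meas by (subst AE_density) (auto simp: measurable_cong_sets[OF m refl])
  with minimal_weak_upper_gradient_le_AE[OF \<rho> min_H G\<rho>]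
  show "AE x in \<rho>. weak_gradient \<rho> f x = ?G x" by eventually_elim simp
qed

section \<open>Square, logarithm and exponential under weak upper gradients\<close>

lemma weak_upper_gradient2_square_sqrt:
  fixes m :: "'a::polish_space measure"
  assumes m: "sets m = sets borel" and g: "g \<in> borel_measurable borel"
    and bounds: "AE x in m. 0 \<le> g x \<and> g x \<le> c"
    and K: "weak_upper_gradient2 m (\<lambda>x. sqrt (g x)) K"
  shows "weak_upper_gradient2 m g (\<lambda>x. ennreal (2 * sqrt (g x)) * K x)"
proof (rule weak_upper_gradient2_cong_AE[OF _ m g])
  show "weak_upper_gradient2 m (\<lambda>x. (sqrt (g x))\<^sup>2) (\<lambda>x. ennreal (2 * sqrt (g x)) * K x)"
  proof (rule weak_upper_gradient2_chain[OF m K, where S="{0..sqrt c}" and \<phi>="\<lambda>y. y\<^sup>2" and \<psi>="\<lambda>y. 2 * y" and c="2 * sqrt c"])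
    show "AE x in m. sqrt (g x) \<in> {0..sqrt c}" using bounds by eventually_elim simp
    fix a b :: real assume ab: "a \<in> {0..sqrt c}" "b \<in> {0..sqrt c}"
    have "\<bar>a\<^sup>2 - b\<^sup>2\<bar> = (a + b) * \<bar>a - b\<bar>"
      using ab by (simp add: square_diff_square_factored power2_eq_square abs_mult)
    also have "\<dots> \<le> max (2 * a) (2 * b) * \<bar>a - b\<bar>" by (rule mult_right_mono) auto
    finally show "\<bar>a\<^sup>2 - b\<^sup>2\<bar> \<le> max (2 * a) (2 * b) * \<bar>a - b\<bar>" .
  qed (auto intro!: continuous_intros)
  \<comment> \<open>\<open>sqrt\<close> is odd, so the square of \<open>sqrt (g x)\<close> is
    \<open>\<bar>g x\<bar>\<close>, which agrees with \<open>g x\<close> almost everywhere.\<close>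
  show "AE x in m. (sqrt (g x))\<^sup>2 = g x" using bounds by eventually_elim simp
qed

text \<open>The bound \<open>ln x \<le> x - 1\<close> is applied to the quotient in both orders; the
  larger slope is the one at the smaller point.\<close>

lemma ln_diff_le:
  fixes a b :: real
  assumes "0 < a" "0 < b"
  shows "\<bar>ln a - ln b\<bar> \<le> max (1 / a) (1 / b) * \<bar>a - b\<bar>"
proof -
  have *: "ln x - ln y \<le> 1 / y * (x - y)" if "0 < y" "0 < x" for x y :: real
  proof -
    have "ln (x / y) \<le> x / y - 1" using that by (intro ln_le_minus_one) simp
    then show ?thesis using that by (simp add: ln_div diff_divide_distrib)
  qed
  have "1 / y * (x - y) \<le> max (1 / a) (1 / b) * \<bar>a - b\<bar>" if "x = a \<and> y = b \<or> x = b \<and> y = a" for x y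
  proof -
    have "1 / y * (x - y) \<le> 1 / y * \<bar>a - b\<bar>" using that assms by (intro mult_left_mono) auto
    also have "\<dots> \<le> max (1 / a) (1 / b) * \<bar>a - b\<bar>" using that by (intro mult_right_mono) auto
    finally show ?thesis .
  qed
  then have "ln a - ln b \<le> max (1 / a) (1 / b) * \<bar>a - b\<bar>" "ln b - ln a \<le> max (1 / a) (1 / b) * \<bar>a - b\<bar>"
    using *[OF assms(2,1)] *[OF assms] by (blast intro: order_trans)+
  then show ?thesis by linarith
qed

text \<open>The tangent bound \<open>1 + x \<le> exp x\<close> in both orders; the larger slope is
  the one at the larger point.\<close>

lemma exp_diff_le:
  fixes a b :: real
  shows "\<bar>exp a - exp b\<bar> \<le> max (exp a) (exp b) * \<bar>a - b\<bar>"
proof -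
  have *: "exp x - exp y \<le> exp x * (x - y)" for x y :: real
  proof -
    have "1 + (y - x) \<le> exp (y - x)" by (rule exp_ge_add_one_self)
    then have "exp x * (1 + (y - x)) \<le> exp x * exp (y - x)" by (rule mult_left_mono) simp
    then show ?thesis by (simp add: exp_add[symmetric] algebra_simps)
  qed
  have "exp x * (x - y) \<le> max (exp a) (exp b) * \<bar>a - b\<bar>" if "x = a \<and> y = b \<or> x = b \<and> y = a" for x y
  proof -
    have "exp x * (x - y) \<le> exp x * \<bar>a - b\<bar>" using that by (intro mult_left_mono) auto
    also have "\<dots> \<le> max (exp a) (exp b) * \<bar>a - b\<bar>" using that by (intro mult_right_mono) auto
    finally show ?thesis .
  qed
  then have "exp a - exp b \<le> max (exp a) (exp b) * \<bar>a - b\<bar>" "exp b - exp a \<le> max (exp a) (exp b) * \<bar>a - b\<bar>"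
    using *[of a b] *[of b a] by (blast intro: order_trans)+
  then show ?thesis by linarith
qed

text \<open>
  A curve may run through \<open>{g = 0}\<close>, where \<open>ln g\<close> degenerates, so the chain rule is applied to
  \<open>ln (g + e)\<close> and \<open>e\<close> tends to 0; only the end points and almost every time need \<open>g > 0\<close>.
\<close>
lemma weak_upper_gradient2_ln:
  fixes n :: "'a::polish_space measure"
  assumes n: "sets n = sets borel" and G: "weak_upper_gradient2 n g G"
    and bounds: "AE x in n. 0 < g x \<and> g x \<le> c"
    and fin: "(\<integral>\<^sup>+x. (G x / ennreal (g x))\<^sup>2 \<partial>n) < \<infinity>"
  shows "weak_upper_gradient2 n (\<lambda>x. ln (g x)) (\<lambda>x. G x / ennreal (g x))"
proof (rule weak_upper_gradient2I)
  let ?Q = "\<lambda>x. G x / ennreal (g x)"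
  note [measurable] = weak_upper_gradient2D(1,2)[OF G]
  show "(\<lambda>x. ln (g x)) \<in> borel_measurable borel" and Q: "?Q \<in> borel_measurable borel" by measurable
  fix \<pi> assume \<pi>: "test_plan2 n \<pi>"
  define e where "e k = inverse (real (Suc k))" for k
  have e: "e k > 0" for k by (simp add: e_def)
  \<comment> \<open>For \<open>g x \<ge> 0\<close> the maximum is \<open>g x + e k\<close>; its
    other argument keeps the denominator at least \<open>e k\<close> for every real value, whence
    the bound \<open>1 / e k\<close>.\<close>
  define H where "H k x = ennreal (1 / max (e k) (g x + e k)) * G x" for k x
  have "weak_upper_gradient2 n (\<lambda>x. ln (g x + e k)) (H k)" for k
    unfolding H_def[abs_def]
  proof (rule weak_upper_gradient2_chain[OF n G, where S="{0..c}" and \<phi>="\<lambda>y. ln (y + e k)"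
      and \<psi>="\<lambda>y. 1 / max (e k) (y + e k)" and c="1 / e k"])
    show "AE x in n. g x \<in> {0..c}" using bounds by eventually_elim simp
    show "\<bar>ln (a + e k) - ln (b + e k)\<bar> \<le> max (1 / max (e k) (a + e k)) (1 / max (e k) (b + e k)) * \<bar>a - b\<bar>"
      if "a \<in> {0..c}" "b \<in> {0..c}" for a b
      using ln_diff_le[of "a + e k" "b + e k"] that e[of k] by (simp add: max_absorb2)
    show "continuous_on {0..c} (\<lambda>y. 1 / max (e k) (y + e k))"
      by (intro continuous_intros) (use e[of k] in auto)
    show "1 / max (e k) (a + e k) \<le> 1 / e k" for a
      using e[of k] by (intro divide_left_mono mult_pos_pos) auto
    show "0 \<le> 1 / max (e k) (a + e k)" for a using e[of k] by (simp add: le_max_iff_disj)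
  qed measurable
  note H = this
  have inc: "AE \<gamma> in \<pi>. \<forall>k. ennreal \<bar>ln (g (\<gamma> 1) + e k) - ln (g (\<gamma> 0) + e k)\<bar> \<le> path_integral (H k) \<gamma> 0 1"
  proof (subst AE_all_countable, intro allI)
    fix k
    from weak_upper_gradient2D(3)[OF H[of k] \<pi>]
    show "AE \<gamma> in \<pi>. ennreal \<bar>ln (g (\<gamma> 1) + e k) - ln (g (\<gamma> 0) + e k)\<bar> \<le> path_integral (H k) \<gamma> 0 1"
      by eventually_elim blast
  qed
  have pos: "AE x in n. 0 < g x" using bounds by eventually_elim simp
  have "AE \<gamma> in \<pi>. 0 < g (\<gamma> 0)" "AE \<gamma> in \<pi>. 0 < g (\<gamma> 1)"
    by (rule AE_plan_at[OF \<pi> n pos], simp)+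
  with inc AE_plan_time[OF \<pi> n pos] AE_path_integral_finite_L2[OF n \<pi> Q fin]
  show "AE \<gamma> in \<pi>. ennreal \<bar>ln (g (\<gamma> 1)) - ln (g (\<gamma> 0))\<bar> \<le> path_integral ?Q \<gamma> 0 1 \<and> path_integral ?Q \<gamma> 0 1 < \<infinity>"
  proof eventually_elim
    case (elim \<gamma>)
    have "path_integral (H k) \<gamma> 0 1 \<le> path_integral ?Q \<gamma> 0 1" for k
      unfolding path_integral_def
    proof (rule nn_integral_mono_AE)
      from elim(2) show "AE r in lborel. H k (\<gamma> r) * ennreal (metric_derivative \<gamma> r) * indicator {0..1} r
          \<le> ?Q (\<gamma> r) * ennreal (metric_derivative \<gamma> r) * indicator {0..1} r"
      proof eventually_elim
        case (elim r)
        show ?case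
        proof (cases "r \<in> {0..1}")
          case True
          then have g: "0 < g (\<gamma> r)" using elim by blast
          have "1 / max (e k) (g (\<gamma> r) + e k) \<le> 1 / g (\<gamma> r)"
            using g e[of k] by (intro divide_left_mono mult_pos_pos) auto
          then have "H k (\<gamma> r) \<le> ennreal (1 / g (\<gamma> r)) * G (\<gamma> r)"
            unfolding H_def by (intro mult_right_mono ennreal_leI) auto
          also have "\<dots> = ?Q (\<gamma> r)"
            using g by (simp add: divide_ennreal_def inverse_ennreal inverse_eq_divide mult.commute)
          finally show ?thesis by (intro mult_right_mono) auto
        qed simp
      qed
    qed
    then have "ennreal \<bar>ln (g (\<gamma> 1) + e k) - ln (g (\<gamma> 0) + e k)\<bar> \<le> path_integral ?Q \<gamma> 0 1" for k
      using elim(1) order_trans by blast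
    note le = this
    have "e \<longlonglongrightarrow> 0" unfolding e_def[abs_def] by (rule LIMSEQ_inverse_real_of_nat)
    then have lim: "(\<lambda>k. ennreal \<bar>ln (g (\<gamma> 1) + e k) - ln (g (\<gamma> 0) + e k)\<bar>)
        \<longlonglongrightarrow> ennreal \<bar>ln (g (\<gamma> 1) + 0) - ln (g (\<gamma> 0) + 0)\<bar>"
      using elim(4,5) by (intro tendsto_ennrealI tendsto_intros) auto
    have "ennreal \<bar>ln (g (\<gamma> 1) + 0) - ln (g (\<gamma> 0) + 0)\<bar> \<le> path_integral ?Q \<gamma> 0 1"
      by (rule LIMSEQ_le_const2[OF lim]) (use le in blast)
    then show ?case using elim(3) by simp
  qed
qed

text \<open>\<open>exp\<close> is its own derivative, and it is bounded by \<open>c\<close> on the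
  almost sure range of \<open>ln g\<close>. This recovers \<open>g\<close> from its logarithm and
  bounds the gradient of \<open>g\<close> by \<open>g\<close> times that of \<open>ln g\<close>; the
  factor stays \<open>exp (ln (g x))\<close>, which is \<open>g x\<close> where
  \<open>g x > 0\<close>.\<close>

lemma weak_upper_gradient2_exp_ln:
  fixes n :: "'a::polish_space measure"
  assumes n: "sets n = sets borel" and g: "g \<in> borel_measurable borel"
    and L: "weak_upper_gradient2 n (\<lambda>x. ln (g x)) L"
    and bounds: "AE x in n. 0 < g x \<and> g x \<le> c"
  shows "weak_upper_gradient2 n g (\<lambda>x. ennreal (exp (ln (g x))) * L x)"
proof (rule weak_upper_gradient2_cong_AE[OF _ n g])
  show "weak_upper_gradient2 n (\<lambda>x. exp (ln (g x))) (\<lambda>x. ennreal (exp (ln (g x))) * L x)"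
  proof (rule weak_upper_gradient2_chain[OF n L, where S="{y. exp y \<le> c}" and \<phi>=exp and \<psi>=exp and c=c])
    show "AE x in n. ln (g x) \<in> {y. exp y \<le> c}" using bounds by eventually_elim simp
  qed (auto intro!: continuous_intros exp_diff_le)
  show "AE x in n. exp (ln (g x)) = g x" using bounds by eventually_elim simp
qed

text \<open>The density contributes a factor \<open>g\<close>. Since \<open>G / g\<close> is at most
  \<open>2 * K / sqrt g\<close>, its weighted square is at most 4 times the square of
  \<open>K\<close>. Where \<open>g x \<le> 0\<close> the weight vanishes, so the value of the
  quotient there does not count.\<close>

lemma nn_integral_log_gradient_le:
  fixes g :: "'a \<Rightarrow> real"
  assumes g [measurable]: "g \<in> borel_measurable m" and G [measurable]: "G \<in> borel_measurable m"
    and K [measurable]: "K \<in> borel_measurable m"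
    and le: "AE x in m. G x \<le> ennreal (2 * sqrt (g x)) * K x"
  shows "(\<integral>\<^sup>+x. (G x / ennreal (g x))\<^sup>2 \<partial>density m (\<lambda>x. ennreal (g x))) \<le> 4 * (\<integral>\<^sup>+x. (K x)\<^sup>2 \<partial>m)"
proof -
  have "(\<integral>\<^sup>+x. (G x / ennreal (g x))\<^sup>2 \<partial>density m (\<lambda>x. ennreal (g x)))
      = (\<integral>\<^sup>+x. ennreal (g x) * (G x / ennreal (g x))\<^sup>2 \<partial>m)"
    by (rule nn_integral_density) measurable
  also have "\<dots> \<le> (\<integral>\<^sup>+x. 4 * (K x)\<^sup>2 \<partial>m)"
  proof (rule nn_integral_mono_AE)
    from le show "AE x in m. ennreal (g x) * (G x / ennreal (g x))\<^sup>2 \<le> 4 * (K x)\<^sup>2"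
    proof eventually_elim
      case (elim x)
      show ?case
      proof (cases "0 < g x")
        case True
        then have s: "sqrt (g x) > 0" "sqrt (g x) * sqrt (g x) = g x" by auto
        have "G x / ennreal (g x) = ennreal (1 / g x) * G x"
          using True by (simp add: divide_ennreal_def inverse_ennreal inverse_eq_divide mult.commute)
        also have "\<dots> \<le> ennreal (1 / g x) * (ennreal (2 * sqrt (g x)) * K x)"
          by (rule mult_left_mono[OF elim]) simp
        also have "\<dots> = ennreal (2 / sqrt (g x)) * K x"
        proof -
          have "1 / g x * (2 * sqrt (g x)) = 2 / sqrt (g x)"
            using s by (simp add: field_simps)
          then show ?thesis using True by (simp add: mult.assoc[symmetric] ennreal_mult'[symmetric])
        qed
        finally have "ennreal (g x) * (G x / ennreal (g x))\<^sup>2 \<le> ennreal (g x) * (ennreal (2 / sqrt (g x)) * K x)\<^sup>2"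
          by (intro mult_left_mono power_mono) auto
        also have "\<dots> = ennreal (g x * (2 / sqrt (g x))\<^sup>2) * (K x)\<^sup>2"
          using True by (simp add: power_mult_distrib ennreal_power ennreal_mult' mult.assoc)
        also have "g x * (2 / sqrt (g x))\<^sup>2 = 4"
          using True by (simp add: power_divide)
        finally show ?thesis by simp
      qed (simp add: ennreal_neg)
    qed
  qed
  also have "\<dots> = 4 * (\<integral>\<^sup>+x. (K x)\<^sup>2 \<partial>m)" by (rule nn_integral_cmult) measurable
  finally show ?thesis .
qed

section \<open>Gradients relative to \<rho>, for general functions and for the logarithm of the
  density\<close>

theorem theorem3p6:
  fixes m \<rho> :: "'a::polish_space measure" and g :: "'a \<Rightarrow> real"
  assumes "boundedly_finite_borel_measure m"
    and "measure_support m = UNIV"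
    and "g \<in> borel_measurable borel"
    and "AE x in m. 0 \<le> g x"
    and "\<exists>C. AE x in m. \<bar>g x\<bar> \<le> C"
    and "\<rho> = density m (\<lambda>x. ennreal (g x))"
    and "\<rho> \<in> P2"
    and "(\<lambda>x. sqrt (g x)) \<in> S2 m"
  shows "(\<forall>f. f \<in> S2 m \<longrightarrow> (\<integral>\<^sup>+x. (weak_gradient m f x)\<^sup>2 \<partial>\<rho>) < \<infinity> \<longrightarrow>
            f \<in> S2 \<rho> \<and> (AE x in \<rho>. weak_gradient \<rho> f x = weak_gradient m f x)) \<and>
         (\<lambda>x. ln (g x)) \<in> S2 \<rho> \<and>
         (AE x in \<rho>. weak_gradient \<rho> (\<lambda>x. ln (g x)) x = weak_gradient m g x / ennreal (g x))"
proof -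
  note g [measurable] = assms(3)
  have m: "sets m = sets borel" using assms(1) unfolding boundedly_finite_borel_measure_def by blast
  have \<rho>: "sets \<rho> = sets borel" unfolding assms(6) using m by simp
  have [measurable_cong]: "sets m = sets borel" by (rule m)
  obtain c where c: "0 \<le> c" "AE x in m. 0 \<le> g x \<and> g x \<le> c"
  proof -
    obtain C where "AE x in m. \<bar>g x\<bar> \<le> C" using assms(5) by blast
    with assms(4) have "AE x in m. 0 \<le> g x \<and> g x \<le> max C 0" by eventually_elim auto
    then show thesis by (rule that[rotated]) simp
  qed
  from c(2) have c': "AE x in m. g x \<le> c" by eventually_elim simp
  obtain K where K: "weak_upper_gradient2 m (\<lambda>x. sqrt (g x)) K" "(\<integral>\<^sup>+x. (K x)\<^sup>2 \<partial>m) < \<infinity>"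
    using assms(8) unfolding S2_def by blast
  note [measurable] = weak_upper_gradient2D(2)[OF K(1)]
  let ?gK = "\<lambda>x. ennreal (2 * sqrt (g x)) * K x"
  have gK: "weak_upper_gradient2 m g ?gK" by (rule weak_upper_gradient2_square_sqrt[OF m g c(2) K(1)])
  \<comment> \<open>Boundedness of \<open>g\<close> puts \<open>?gK\<close> in L^2(m), the factor
    \<open>4 * c\<close> being the square of \<open>2 * sqrt c\<close>. This makes
    \<open>weak_gradient m g\<close> in the conclusion an actual minimal gradient.\<close>
  have "(\<integral>\<^sup>+x. (?gK x)\<^sup>2 \<partial>m) \<le> (\<integral>\<^sup>+x. ennreal (4 * c) * (K x)\<^sup>2 \<partial>m)"
  proof (rule nn_integral_mono_AE)
    from c(2) show "AE x in m. (?gK x)\<^sup>2 \<le> ennreal (4 * c) * (K x)\<^sup>2"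
      by eventually_elim (auto simp: power_mult_distrib ennreal_power intro!: mult_right_mono ennreal_leI)
  qed
  also have "\<dots> = ennreal (4 * c) * (\<integral>\<^sup>+x. (K x)\<^sup>2 \<partial>m)" by (rule nn_integral_cmult) measurable
  also have "\<dots> < \<infinity>" using K(2) by (simp add: ennreal_mult_less_top)
  finally have gS2: "g \<in> S2 m" unfolding S2_def using gK by blast
  note a = weak_gradient_density_eq[OF m gK c(1) c', folded assms(6)]
  let ?G = "weak_gradient m g" and ?Q = "\<lambda>x. weak_gradient m g x / ennreal (g x)"
  have min_G: "minimal_weak_upper_gradient m g ?G" by (rule minimal_weak_upper_gradient_weak_gradient[OF gS2])
  then have G: "weak_upper_gradient2 m g ?G" unfolding minimal_weak_upper_gradient_def by blast
  note [measurable] = weak_upper_gradient2D(2)[OF G]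
  have G\<rho>: "weak_upper_gradient2 \<rho> g ?G"
    using emeasure_density_le[OF g m c'] unfolding assms(6) by (rule weak_upper_gradient2_mono[OF G c(1)])
  have bounds: "AE x in \<rho>. 0 < g x \<and> g x \<le> c"
    unfolding assms(6)
  proof (subst AE_density)
    from c' show "AE x in m. 0 < ennreal (g x) \<longrightarrow> 0 < g x \<and> g x \<le> c" by eventually_elim simp
  qed measurable
  \<comment> \<open>Minimality of \<open>?G\<close> compares it with \<open>?gK\<close>, so that the
    finite norm of \<open>K\<close> controls the quotient.\<close>
  have "(\<integral>\<^sup>+x. (?Q x)\<^sup>2 \<partial>\<rho>) \<le> 4 * (\<integral>\<^sup>+x. (K x)\<^sup>2 \<partial>m)"
    unfolding assms(6)
    by (rule nn_integral_log_gradient_le) (measurable, rule minimal_weak_upper_gradient_le_AE[OF m min_G gK])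
  also have "\<dots> < \<infinity>" using K(2) by (simp add: ennreal_mult_less_top)
  finally have finQ: "(\<integral>\<^sup>+x. (?Q x)\<^sup>2 \<partial>\<rho>) < \<infinity>" .
  have Q: "weak_upper_gradient2 \<rho> (\<lambda>x. ln (g x)) ?Q"
    by (rule weak_upper_gradient2_ln[OF \<rho> G\<rho> bounds finQ])
  then have lnS2: "(\<lambda>x. ln (g x)) \<in> S2 \<rho>" unfolding S2_def using finQ by blast
  let ?L = "weak_gradient \<rho> (\<lambda>x. ln (g x))"
  have min_L: "minimal_weak_upper_gradient \<rho> (\<lambda>x. ln (g x)) ?L"
    by (rule minimal_weak_upper_gradient_weak_gradient[OF lnS2])
  then have L: "weak_upper_gradient2 \<rho> (\<lambda>x. ln (g x)) ?L" unfolding minimal_weak_upper_gradient_def by blast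
  \<comment> \<open>Again \<rho> \<le> c m; this integrability is the hypothesis under which
    \<open>a(3)\<close> may be applied to \<open>g\<close> itself.\<close>
  have "(\<integral>\<^sup>+x. (?G x)\<^sup>2 \<partial>\<rho>) < \<infinity>"
  proof -
    have "(\<integral>\<^sup>+x. (?G x)\<^sup>2 \<partial>\<rho>) = (\<integral>\<^sup>+x. ennreal (g x) * (?G x)\<^sup>2 \<partial>m)"
      unfolding assms(6) by (rule nn_integral_density) measurable
    also have "\<dots> \<le> (\<integral>\<^sup>+x. ennreal c * (?G x)\<^sup>2 \<partial>m)"
    proof (rule nn_integral_mono_AE)
      from c' show "AE x in m. ennreal (g x) * (?G x)\<^sup>2 \<le> ennreal c * (?G x)\<^sup>2"
        by eventually_elim (intro mult_right_mono ennreal_leI, auto)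
    qed
    also have "\<dots> = ennreal c * (\<integral>\<^sup>+x. (?G x)\<^sup>2 \<partial>m)" by (rule nn_integral_cmult) measurable
    also have "\<dots> < \<infinity>"
      using min_G unfolding minimal_weak_upper_gradient_def by (simp add: ennreal_mult_less_top)
    finally show ?thesis .
  qed
  \<comment> \<open>The lower bound for \<open>?L\<close>: by minimality the gradient of
    \<open>g\<close> is at most the gradient \<open>exp (ln (g x)) * ?L x\<close> produced by the
    exponential. Dividing by \<open>g\<close>, which is positive \<rho>-almost everywhere, gives
    \<open>?Q x \<le> ?L x\<close>.\<close>
  from a(3)[OF gS2 this weak_upper_gradient2_exp_ln[OF \<rho> g L bounds]]
  have "AE x in \<rho>. ?G x \<le> ennreal (exp (ln (g x))) * ?L x"
    unfolding assms(6) by (subst AE_density) auto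
  with bounds have "AE x in \<rho>. ?Q x \<le> ?L x"
  proof eventually_elim
    case (elim x)
    then have "?Q x \<le> ennreal (g x) * ?L x / ennreal (g x)"
      by (intro divide_right_mono_ennreal) simp
    also have "\<dots> = ?L x"
      using elim(1) by (simp add: mult.commute[of "ennreal (g x)"] mult_divide_eq_ennreal)
    finally show ?case .
  qed
  with minimal_weak_upper_gradient_le_AE[OF \<rho> min_L Q] have "AE x in \<rho>. ?L x = ?Q x"
    by eventually_elim simp
  then show ?thesis using a(1,2) lnS2 by blast
qed

end
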